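(* Let $\mathcal{T}_3$ be the ternary rooted tree. Let $\Gamma\le\mathrm{Aut}(\mathcal{T}_3)$ be the Fabrykowski-Gupta group. Let $\mathrm{Stab}_\Gamma(n)\vartriangleleft\Gamma$ be the $n$th level stabiliser of $\Gamma$. Then there exists an absolute constant $C>0$ such that for all $n\in\mathbb{N}$, $$\mathrm{diam}^+\big(\Gamma/\mathrm{Stab}_\Gamma(n)\big)=O\big(\log^{C}|\Gamma/\mathrm{Stab}_\Gamma(n)|\big).$$ Moreover there exists an absolute constant $C'>0$ such that the directed navigation problem for $\Gamma/\mathrm{Stab}_\Gamma(n)$ is solvable for this bound in time $$O\big(\log^{C'}|\Gamma/\mathrm{Stab}_\Gamma(n)|\big).$$
   Context: For a finite group $G$ and a generating set $S\subseteq G$, $B^+_S(n)$ is the set of elements of $G$ expressible as positive words (no inverses of generators) of length at most $n$ in $S$; $\mathrm{diam}^+(G,S)=\min\{n\in\mathbb{N}: B^+_S(n)=G\}$; and $\mathrm{diam}^+(G)$ is the maximum of $\mathrm{diam}^+(G,S)$ over all generating subsets $S$ of $G$. Directed navigation problem: let $(G_n)_n$ be a sequence of finite groups and let $l_n,t_n\in\mathbb{N}$ with $\mathrm{diam}^+(G_n)\le l_n$ for all $n$. The directed navigation problem for $G_n$ is solvable for the bound $\mathrm{diam}^+(G_n)\le l_n$ in time $t_n$ if there is a deterministic algorithm which, given an index $n$, a generating set $S_n\subseteq G_n$ and an element $g\in G_n$, outputs in time at most $t_n$ a positive word $w$ in $S_n$ of length at most $l_n$ which is equal to $g$ in $G_n$.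 The ternary rooted tree $\mathcal{T}_3$ is the graph with vertex set the set $\{0,1,2\}^*$ of finite words over $\{0,1,2\}$, with edges $(w,wx)$ for $w\in\{0,1,2\}^*$, $x\in\{0,1,2\}$; $\mathrm{Aut}(\mathcal{T}_3)$ is the group of its graph automorphisms, which are the permutations of $\{0,1,2\}^*$ respecting prefixes. The Fabrykowski-Gupta group $\Gamma\le\mathrm{Aut}(\mathcal{T}_3)$ is generated by the two automorphisms $a,b$ defined by $a(0w)=1w$, $a(1w)=2w$, $a(2w)=0w$ and (recursively) $b(0w)=0\,a(w)$, $b(1w)=1w$, $b(2w)=2\,b(w)$. $\mathrm{Stab}_\Gamma(n)$ is the kernel of the action of $\Gamma$ on the set of words of length $n$. The constant implied by $O(\cdot)$ is absolute.
   Formalization: The navigation time bound is O(log^{C'}|Γ/Stab_Γ(n)|) plus an absolute constant times the size of the given generating set S_n, since S_n may have about |Γ/Stab_Γ(n)| elements and one needed generator may be listed last, so the literal bound is false. *)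

theory Defs
  imports Complex_Main "HOL-Algebra.Coset" "HOL-Algebra.Generated_Groups"
begin

section \<open>Directed diameter\<close>

definition word_prod :: "('a, 'b) monoid_scheme \<Rightarrow> 'a list \<Rightarrow> 'a" where
  "word_prod G w = foldr (mult G) w (one G)"

definition pos_ball :: "('a, 'b) monoid_scheme \<Rightarrow> 'a set \<Rightarrow> nat \<Rightarrow> 'a set" where
  "pos_ball G S n = {word_prod G w | w. set w \<subseteq> S \<and> length w \<le> n}"

definition generates :: "('a, 'b) monoid_scheme \<Rightarrow> 'a set \<Rightarrow> bool" where
  "generates G S \<longleftrightarrow> S \<subseteq> carrier G \<and> generate G S = carrier G"

definition diam_plus_wrt :: "('a, 'b) monoid_scheme \<Rightarrow> 'a set \<Rightarrow> nat" where
  "diam_plus_wrt G S = (LEAST n. pos_ball G S n = carrier G)"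

definition diam_plus :: "('a, 'b) monoid_scheme \<Rightarrow> nat" where
  "diam_plus G = Max {diam_plus_wrt G S | S. generates G S}"


section \<open>The Fabrykowski-Gupta group\<close>

datatype letter = L0 | L1 | L2

type_synonym vertex = "letter list"

definition tree_edge :: "vertex \<Rightarrow> vertex \<Rightarrow> bool" where
  "tree_edge u v \<longleftrightarrow> (\<exists>x. v = u @ [x])"

definition Aut_T3 :: "(vertex \<Rightarrow> vertex) monoid" where
  "Aut_T3 = \<lparr>carrier = {f. bij f \<and> (\<forall>u v. tree_edge (f u) (f v) \<longleftrightarrow> tree_edge u v)},
             mult = (\<circ>), one = id\<rparr>"

fun fg_a :: "vertex \<Rightarrow> vertex" where
  "fg_a [] = []"
| "fg_a (L0 # w) = L1 # w"
| "fg_a (L1 # w) = L2 # w"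
| "fg_a (L2 # w) = L0 # w"

fun fg_b :: "vertex \<Rightarrow> vertex" where
  "fg_b [] = []"
| "fg_b (L0 # w) = L0 # fg_a w"
| "fg_b (L1 # w) = L1 # w"
| "fg_b (L2 # w) = L2 # fg_b w"

definition FG :: "(vertex \<Rightarrow> vertex) monoid" where
  "FG = Aut_T3\<lparr>carrier := generate Aut_T3 {fg_a, fg_b}\<rparr>"

definition Stab :: "nat \<Rightarrow> (vertex \<Rightarrow> vertex) set" where
  "Stab n = {f \<in> carrier FG. \<forall>w. length w = n \<longrightarrow> f w = w}"

definition FG_level :: "nat \<Rightarrow> (vertex \<Rightarrow> vertex) set monoid" where
  "FG_level n = FG Mod Stab n"


section \<open>Algorithms and running time\<close>

text \<open>
  An algorithm is a program in a first-order functional language with call-by-value recursion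
  over binary trees (the language \<open>F\<close> of N. D. Jones, \<^emph>\<open>Computability and Complexity\<close>, with
  several functions and several arguments). Each evaluation step costs one unit of time: a value
  is a pointer into a heap of immutable cells, so that building a pair, taking it apart, testing
  it for being \<open>Nul\<close> and passing it on all take constant time. Programs of this language and Turing
  machines simulate each other with polynomial overhead.
\<close>

datatype val = Nul | Pr val val

fun fst_val :: "val \<Rightarrow> val" where
  "fst_val Nul = Nul"
| "fst_val (Pr x y) = x"

fun snd_val :: "val \<Rightarrow> val" where
  "snd_val Nul = Nul"
| "snd_val (Pr x y) = y"

datatype expr =
    Arg nat
  | ENul
  | EPr expr expr
  | EFst expr
  | ESnd expr
  | EIf expr expr expr
  | ECall nat "expr list"

text \<open>A program is the list of its function bodies; \<open>Arg i\<close> is the \<open>i\<close>-th argument of the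
  function whose body is being evaluated. \<open>eval P env e v t\<close>: \<open>e\<close> evaluates to \<open>v\<close> in time \<open>t\<close>.\<close>

inductive
  eval :: "expr list \<Rightarrow> val list \<Rightarrow> expr \<Rightarrow> val \<Rightarrow> nat \<Rightarrow> bool" and
  evals :: "expr list \<Rightarrow> val list \<Rightarrow> expr list \<Rightarrow> val list \<Rightarrow> nat \<Rightarrow> bool"
  for P :: "expr list"
where
  eval_Arg: "i < length env \<Longrightarrow> eval P env (Arg i) (env ! i) 1"
| eval_Nul: "eval P env ENul Nul 1"
| eval_Pr: "eval P env e1 v1 t1 \<Longrightarrow> eval P env e2 v2 t2 \<Longrightarrow>
    eval P env (EPr e1 e2) (Pr v1 v2) (t1 + t2 + 1)"
| eval_Fst: "eval P env e v t \<Longrightarrow> eval P env (EFst e) (fst_val v) (t + 1)"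
| eval_Snd: "eval P env e v t \<Longrightarrow> eval P env (ESnd e) (snd_val v) (t + 1)"
| eval_If_true: "eval P env c (Pr x y) t1 \<Longrightarrow> eval P env e1 v t2 \<Longrightarrow>
    eval P env (EIf c e1 e2) v (t1 + t2 + 1)"
| eval_If_false: "eval P env c Nul t1 \<Longrightarrow> eval P env e2 v t2 \<Longrightarrow>
    eval P env (EIf c e1 e2) v (t1 + t2 + 1)"
| eval_Call: "f < length P \<Longrightarrow> evals P env es vs t1 \<Longrightarrow> eval P vs (P ! f) v t2 \<Longrightarrow>
    eval P env (ECall f es) v (t1 + t2 + 1)"
| evals_Nil: "evals P env [] [] 0"
| evals_Cons: "eval P env e v t1 \<Longrightarrow> evals P env es vs t2 \<Longrightarrow>
    evals P env (e # es) (v # vs) (t1 + t2)"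

inductive_cases eval_elims:
  "eval P env (Arg i) v t" "eval P env ENul v t" "eval P env (EPr e1 e2) v t"
  "eval P env (EFst e) v t" "eval P env (ESnd e) v t" "eval P env (EIf c e1 e2) v t"
  "eval P env (ECall f es) v t" "evals P env [] vs t" "evals P env (e # es) vs t"

lemma eval_deterministic:
  "eval P env e v t \<Longrightarrow> (\<And>v' t'. eval P env e v' t' \<Longrightarrow> v' = v \<and> t' = t)" and
  "evals P env es vs s \<Longrightarrow> (\<And>vs' s'. evals P env es vs' s' \<Longrightarrow> vs' = vs \<and> s' = s)"
  apply (induction rule: eval_evals.inducts)
  apply (elim eval_elims, simp)
  apply (elim eval_elims, simp)
  subgoal premises p by (rule eval_elims(3)[OF p(5)]) (use p(2,4) in \<open>force\<close>)
  subgoal premises p by (rule eval_elims(4)[OF p(3)]) (use p(2) in \<open>force\<close>)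
  subgoal premises p by (rule eval_elims(5)[OF p(3)]) (use p(2) in \<open>force\<close>)
  subgoal premises p by (rule eval_elims(6)[OF p(5)]) (use p(2,4) in \<open>force\<close>)+
  subgoal premises p by (rule eval_elims(6)[OF p(5)]) (use p(2,4) in \<open>force\<close>)+
  subgoal premises p by (rule eval_elims(7)[OF p(6)]) (use p(3,5) in \<open>force\<close>)
  apply (elim eval_elims, simp)
  subgoal premises p by (rule eval_elims(9)[OF p(5)]) (use p(2,4) in \<open>force\<close>)
  done

definition runs :: "expr list \<Rightarrow> val list \<Rightarrow> val \<Rightarrow> nat \<Rightarrow> bool" where
  "runs P inputs v t \<longleftrightarrow> P \<noteq> [] \<and> eval P inputs (P ! 0) v t"

fun val_of_list :: "val list \<Rightarrow> val" where
  "val_of_list [] = Nul"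
| "val_of_list (v # vs) = Pr v (val_of_list vs)"

definition val_of_nat :: "nat \<Rightarrow> val" where
  "val_of_nat n = val_of_list (replicate n Nul)"

fun val_size :: "val \<Rightarrow> nat" where
  "val_size Nul = 1"
| "val_size (Pr x y) = val_size x + val_size y + 1"


section \<open>The directed navigation problem\<close>

text \<open>
  \<open>enc n\<close> encodes the elements of \<open>G n\<close>. The generating set is handed over as a list, in arbitrary
  order and without repetitions, and the answer is the list of the encoded letters of the word.

  A generating set may have about \<open>|G n|\<close> elements, and the only element of \<open>S\<close> that is of use for
  \<open>g\<close> may be the last one inspected (take \<open>S = H \<union> {x}\<close> with \<open>H\<close> a maximal subgroup, and \<open>g \<notin> H\<close>).
  So the total running time has no bound polylogarithmic in \<open>|G n|\<close> alone. Therefore \<open>t n\<close> bounds the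
  running time apart from reading the generating set, which is charged linearly in the size of
  its encoding. For generating sets of polylogarithmic size the total time is polylogarithmic.
\<close>

definition directed_navigation_solvable ::
  "(nat \<Rightarrow> ('a, 'b) monoid_scheme) \<Rightarrow> (nat \<Rightarrow> 'a \<Rightarrow> val) \<Rightarrow> (nat \<Rightarrow> nat) \<Rightarrow> (nat \<Rightarrow> nat) \<Rightarrow> bool"
where
  "directed_navigation_solvable G enc l t \<longleftrightarrow>
    (\<forall>n. diam_plus (G n) \<le> l n) \<and>
    (\<exists>P c. \<forall>n S g. generates (G n) (set S) \<and> distinct S \<and> g \<in> carrier (G n) \<longrightarrow>
      (\<exists>w T. runs P [val_of_nat n, val_of_list (map (enc n) S), enc n g]
                    (val_of_list (map (enc n) w)) T \<and>
             set w \<subseteq> set S \<and> length w \<le> l n \<and> word_prod (G n) w = g \<and>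
             T \<le> t n + c * val_size (val_of_list (map (enc n) S))))"


section \<open>Encoding the elements of the quotients\<close>

fun val_of_letter :: "letter \<Rightarrow> val" where
  "val_of_letter L0 = val_of_nat 0"
| "val_of_letter L1 = val_of_nat 1"
| "val_of_letter L2 = val_of_nat 2"

text \<open>\<open>f (u @ w) = f u @ tree_section f u w\<close> for automorphisms \<open>f\<close>\<close>

definition tree_section :: "(vertex \<Rightarrow> vertex) \<Rightarrow> vertex \<Rightarrow> vertex \<Rightarrow> vertex" where
  "tree_section f u w = drop (length u) (f (u @ w))"

text \<open>The portrait of depth \<open>n\<close>: the permutation of \<open>{0,1,2}\<close> at the root, followed by the portraits
  of depth \<open>n - 1\<close> of the three sections. It determines and is determined by the action on the
  words of length \<open>n\<close>, and its size is linear in \<open>3 ^ n\<close>.\<close>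

fun portrait :: "nat \<Rightarrow> (vertex \<Rightarrow> vertex) \<Rightarrow> val" where
  "portrait 0 f = Nul"
| "portrait (Suc n) f = val_of_list
    ([val_of_letter (hd (f [x])). x \<leftarrow> [L0, L1, L2]] @
     [portrait n (tree_section f [x]). x \<leftarrow> [L0, L1, L2]])"

text \<open>All elements of a coset of \<open>Stab n\<close> have the same portrait of depth \<open>n\<close>.\<close>

definition enc_level :: "nat \<Rightarrow> (vertex \<Rightarrow> vertex) set \<Rightarrow> val" where
  "enc_level n X = portrait n (SOME f. f \<in> X)"

end

theory Submission
  imports Defs
begin

text \<open>
  An element \<open>x\<close> with \<open>al x = be x = 1\<close> permutes every level of the tree cyclically. Hence
  \<open>T x F = F \<circ> x - F\<close> is, on the functions from a level to the field of three elements, a nilpotent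
  operator with one-dimensional kernel, and its powers filter these functions by degree. The
  filtration does not depend on \<open>x\<close> and is invariant under the group. Commutators with \<open>x\<close> lower the degree
  of the labels of an element of \<open>st m\<close> by one, those with the power \<open>3 ^ i\<close> of \<open>x\<close> lower it by \<open>3 ^ i\<close>. So
  the iterated commutators of one element \<open>u\<close> of maximal degree with these powers, for \<open>i < m\<close>, are short
  words that realise all degrees, and every element of \<open>st m\<close> can be moved into \<open>st (m + 1)\<close> by sifting it
  through them. Doing this on all levels writes every element as a word; inverses are positive powers.

  The element \<open>u\<close> for level \<open>m + 1\<close> must not be built from the one for level \<open>m\<close>, since then the lengths
  would multiply. Let \<open>s\<close> satisfy \<open>al s = 0\<close> and \<open>be s \<noteq> 0\<close>. The commutator of \<open>s\<close> with the power
  \<open>3 ^ (m - 1)\<close> of \<open>x\<close> lies in \<open>st m\<close>, and its labels have degree \<open>(3 ^ m - 1) / 2\<close>. Its iterated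
  commutators \<open>e\<close> realise all smaller degrees, so the commutators of the \<open>e\<close> with \<open>x\<close> and \<open>s\<close> can
  be sifted through the \<open>e\<close>. One of the results has maximal degree on level \<open>m + 1\<close>: otherwise the \<open>e\<close>
  would span a subspace, invariant under the whole group, of the elementary abelian quotient of \<open>Q m\<close> by the
  elements of \<open>st (m + 1)\<close> of smaller degree, and this contradicts the branching over the commutator subgroup.

  By the same branching, the logarithm of the order of the \<open>n\<close>-th quotient is at least a constant times
  \<open>3 ^ n\<close>, so that polynomials in \<open>3 ^ n\<close> are polylogarithmic in the order.
\<close>

section \<open>The field of three elements on the letters\<close>

text \<open>Degrees are computed by descent: in characteristic 3 the cube of \<open>T x\<close> is
  the difference operator of the cube of \<open>x\<close>, which acts on each first-level subtree as
  such an \<open>x\<close> again. An exponent \<open>r + 3 * q\<close> thus splits into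
  \<open>r\<close> differences in the first letter and exponent \<open>q\<close> below. The group
  enters through \<open>be_sec\<close>: exponents of \<open>b\<close> in one section are root labels
  of the next section. On levels \<open>m >= 2\<close> this forces the labels of an element of
  \<open>st m\<close> to sum to zero over siblings, so that the maximal degree there is governed by
  \<open>2 * 3 ^ (m - 1)\<close> instead of \<open>3 ^ m\<close>. The obstacle in passing to the
  next level: the coefficient of maximal degree is additive on \<open>st (m + 1)\<close>, but on
  \<open>Q m\<close> the labels of level \<open>m + 1\<close> are rotated inside sibling triples. A
  quadratic term in the labels of level 1 repairs this (\<open>Om\<close>). Lengths stay polynomial
  in \<open>3 ^ n\<close> because a table entry needs at most two commutators for each of at most
  \<open>n\<close> powers of \<open>x\<close>, two of them multiplying lengths by about 4, and
  because the contributions of the levels are added.\<close>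

instantiation letter :: comm_ring_1
begin

definition zero_letter :: letter where "zero_letter = L0"
definition one_letter :: letter where "one_letter = L1"

fun uminus_letter :: "letter \<Rightarrow> letter" where
  "uminus_letter L0 = L0" | "uminus_letter L1 = L2" | "uminus_letter L2 = L1"

fun plus_letter :: "letter \<Rightarrow> letter \<Rightarrow> letter" where
  "plus_letter L0 y = y"
| "plus_letter L1 L0 = L1" | "plus_letter L1 L1 = L2" | "plus_letter L1 L2 = L0"
| "plus_letter L2 L0 = L2" | "plus_letter L2 L1 = L0" | "plus_letter L2 L2 = L1"

definition minus_letter :: "letter \<Rightarrow> letter \<Rightarrow> letter" where
  "minus_letter x y = x + (- y)"

fun times_letter :: "letter \<Rightarrow> letter \<Rightarrow> letter" where
  "times_letter L0 y = L0" | "times_letter L1 y = y" | "times_letter L2 y = - y"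

instance
proof
  fix a b c :: letter
  show "a * b * c = a * (b * c)" "a * b = b * a" "1 * a = a"
    "a + b + c = a + (b + c)" "a + b = b + a" "0 + a = a" "- a + a = 0" "a - b = a + - b"
    "(a + b) * c = a * c + b * c"
    by (cases a; cases b; cases c; simp add: zero_letter_def one_letter_def minus_letter_def)+
  show "(0::letter) \<noteq> 1"
    by (simp add: zero_letter_def one_letter_def)
qed

end

lemma letter_simps:
  "L0 = 0" "L1 = 1" "L2 = - 1"
  by (simp_all add: zero_letter_def one_letter_def)

lemma letter_cases: "(x::letter) = 0 \<or> x = 1 \<or> x = - 1"
  by (cases x) (simp_all add: letter_simps)

lemma letter_char3 [simp]: "(x::letter) + x + x = 0" "x + (x + x) = 0" "(1::letter) + 1 = - 1"
   "- (1::letter) - 1 = 1"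
  by (cases x; simp add: zero_letter_def one_letter_def minus_letter_def)+

lemma letter_nz [simp]: "(1::letter) \<noteq> - 1" "- 1 \<noteq> (1::letter)"
  by (simp_all add: one_letter_def)

lemma letter_double: "(x::letter) + x = - x"
  by (cases x; simp)

lemma letter_three [simp]: "(3::letter) = 0" "(2::letter) = - 1"
proof -
  show two: "(2::letter) = - 1" by (simp flip: one_add_one)
  have "(3::letter) = 2 + 1" by simp
  then show "(3::letter) = 0" by (simp only: two left_minus)
qed

lemma letter_all: "(\<forall>i. P i) \<longleftrightarrow> P 0 \<and> P 1 \<and> P (- 1 :: letter)"
  using letter_cases by metis

section \<open>Sections and labels\<close>

text \<open>Every local permutation of an element of the group is a power of the cycle \<open>(0 1 2)\<close>; \<open>al f\<close>
  is the exponent at the root and \<open>lab f w\<close> the one at \<open>w\<close>.\<close>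

definition al :: "(vertex \<Rightarrow> vertex) \<Rightarrow> letter" where
  "al f = hd (f [0])"

definition sec :: "(vertex \<Rightarrow> vertex) \<Rightarrow> letter \<Rightarrow> vertex \<Rightarrow> vertex" where
  "sec f i w = tl (f (i # w))"

fun lab :: "(vertex \<Rightarrow> vertex) \<Rightarrow> vertex \<Rightarrow> letter" where
  "lab f [] = al f"
| "lab f (i # w) = lab (sec f i) w"

text \<open>Positive words suffice: both generators have order 3 (\<open>fg_cubed\<close>), so this
  monoid is already the group, and inductions need no case for inverses.\<close>

inductive_set Gam :: "(vertex \<Rightarrow> vertex) set" where
  Gam_id: "id \<in> Gam"
| Gam_a: "f \<in> Gam \<Longrightarrow> fg_a \<circ> f \<in> Gam"
| Gam_b: "f \<in> Gam \<Longrightarrow> fg_b \<circ> f \<in> Gam"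

lemma fg_a_Cons: "fg_a (i # w) = (i + 1) # w"
  by (cases i) (simp_all add: one_letter_def)

lemma fg_b_Cons: "fg_b (i # w) = i # (if i = 0 then fg_a w else if i = 1 then w else fg_b w)"
  by (cases i) (simp_all add: one_letter_def zero_letter_def)

lemma Gam_Nil [simp]: "f \<in> Gam \<Longrightarrow> f [] = []"
  by (induction rule: Gam.induct) simp_all

lemma Gam_Cons_ex: "f \<in> Gam \<Longrightarrow> \<exists>c. \<forall>i w. \<exists>v. f (i # w) = (i + c) # v"
proof (induction rule: Gam.induct)
  case Gam_id
  show ?case by (intro exI[of _ 0]) simp
next
  case (Gam_a f)
  then obtain c where "\<forall>i w. \<exists>v. f (i # w) = (i + c) # v" by blast
  then have "\<exists>v. (fg_a \<circ> f) (i # w) = (i + (c + 1)) # v" for i w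
    by (metis comp_apply fg_a_Cons add.assoc)
  then show ?case by blast
next
  case (Gam_b f)
  then obtain c where "\<forall>i w. \<exists>v. f (i # w) = (i + c) # v" by blast
  then have "\<exists>v. (fg_b \<circ> f) (i # w) = (i + c) # v" for i w
    by (metis comp_apply fg_b_Cons)
  then show ?case by blast
qed

lemma Gam_Cons: assumes "f \<in> Gam" shows "f (i # w) = (i + al f) # sec f i w"
proof -
  obtain c where c: "\<forall>i w. \<exists>v. f (i # w) = (i + c) # v" using Gam_Cons_ex[OF assms] by blast
  obtain v where "f (i # w) = (i + c) # v" using c by blast
  moreover obtain u where "f [0] = (0 + c) # u" using c by blast
  ultimately show ?thesis by (simp add: al_def sec_def)
qed

lemma fg_in_Gam [simp]: "fg_a \<in> Gam" "fg_b \<in> Gam"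
  using Gam_a[OF Gam_id] Gam_b[OF Gam_id] by simp_all

lemma Gam_comp [simp]: "f \<in> Gam \<Longrightarrow> g \<in> Gam \<Longrightarrow> f \<circ> g \<in> Gam"
  by (induction rule: Gam.induct) (simp_all add: comp_assoc Gam.intros)

lemma al_simps [simp]: "al id = 0" "al fg_a = 1" "al fg_b = 0"
  by (simp_all add: al_def fg_a_Cons fg_b_Cons)

lemma sec_simps [simp]: "sec id i = id" "sec fg_a i = id"
  "sec fg_b i = (if i = 0 then fg_a else if i = 1 then id else fg_b)"
  by (auto simp: sec_def fun_eq_iff fg_a_Cons fg_b_Cons)

lemma al_comp: "f \<in> Gam \<Longrightarrow> g \<in> Gam \<Longrightarrow> al (f \<circ> g) = al f + al g"
  using Gam_Cons[of g 0 "[]"] Gam_Cons[of f "al g"] by (simp add: al_def[of "f \<circ> g"])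

lemma sec_comp: "f \<in> Gam \<Longrightarrow> g \<in> Gam \<Longrightarrow> sec (f \<circ> g) i = sec f (i + al g) \<circ> sec g i"
  by (simp add: fun_eq_iff sec_def[of "f \<circ> g"] Gam_Cons)

lemma sec_in_Gam [simp]: "f \<in> Gam \<Longrightarrow> sec f i \<in> Gam"
proof (induction arbitrary: i rule: Gam.induct)
  case Gam_id
  show ?case by (simp add: Gam.Gam_id del: id_apply)
next
  case (Gam_a f)
  then show ?case by (simp add: sec_comp del: o_apply)
next
  case (Gam_b f)
  then show ?case by (simp add: sec_comp del: o_apply)
qed

lemma Gam_length [simp]: "f \<in> Gam \<Longrightarrow> length (f w) = length w"
  by (induction w arbitrary: f) (simp_all add: Gam_Cons)

lemma lab_comp: "f \<in> Gam \<Longrightarrow> g \<in> Gam \<Longrightarrow> lab (f \<circ> g) w = lab f (g w) + lab g w"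
  by (induction w arbitrary: f g) (simp_all add: al_comp sec_comp Gam_Cons)

lemma lab_id [simp]: "lab id w = 0"
  by (induction w) (simp_all del: id_apply)

lemma Gam_inj: "f \<in> Gam \<Longrightarrow> f w = f v \<Longrightarrow> w = v"
proof (induction w arbitrary: f v)
  case Nil
  then have "length (f v) = 0" by simp
  then show ?case using Nil by simp
next
  case (Cons i w)
  then obtain j u where "v = j # u" by (cases v) (auto simp: Gam_Cons)
  with Cons show ?case by (metis Gam_Cons add_right_cancel list.inject sec_in_Gam)
qed

lemma fg_cubed: "fg_a (fg_a (fg_a w)) = w" "fg_b (fg_b (fg_b w)) = w"
proof -
  show a: "fg_a (fg_a (fg_a w)) = w" for w
    by (cases w) (simp_all add: fg_a_Cons algebra_simps)
  show "fg_b (fg_b (fg_b w)) = w" for w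
    by (induction w) (simp_all add: fg_b_Cons a)
qed

lemma Gam_inverse: "f \<in> Gam \<Longrightarrow> \<exists>g\<in>Gam. (\<forall>w. f (g w) = w) \<and> (\<forall>w. g (f w) = w)"
proof (induction rule: Gam.induct)
  case Gam_id
  show ?case by (intro bexI[of _ id] Gam.Gam_id) simp_all
next
  case (Gam_a f)
  then obtain g where "g \<in> Gam" "\<And>w. f (g w) = w" "\<And>w. g (f w) = w" by blast
  then show ?case by (intro bexI[of _ "g \<circ> (fg_a \<circ> fg_a)"]) (simp_all add: fg_cubed)
next
  case (Gam_b f)
  then obtain g where "g \<in> Gam" "\<And>w. f (g w) = w" "\<And>w. g (f w) = w" by blast
  then show ?case by (intro bexI[of _ "g \<circ> (fg_b \<circ> fg_b)"]) (simp_all add: fg_cubed)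
qed

lemma Gam_bij: "f \<in> Gam \<Longrightarrow> bij f"
  using Gam_inverse[of f] by (metis bijI')

abbreviation iv :: "(vertex \<Rightarrow> vertex) \<Rightarrow> vertex \<Rightarrow> vertex" where
  "iv \<equiv> inv_into UNIV"

lemma Gam_inv [simp]: "f \<in> Gam \<Longrightarrow> iv f \<in> Gam"
  using Gam_inverse[of f] by (metis inv_equality)

lemma inv_cancel [simp]: "f \<in> Gam \<Longrightarrow> iv f (f w) = w" "f \<in> Gam \<Longrightarrow> f (iv f w) = w"
  by (simp_all add: Gam_bij bij_is_inj bij_is_surj surj_f_inv_f)

lemma inv_comp_cancel [simp]: "f \<in> Gam \<Longrightarrow> iv f \<circ> f = id" "f \<in> Gam \<Longrightarrow> f \<circ> iv f = id"
  by (simp_all add: fun_eq_iff)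

lemma Gam_inv_comp: "f \<in> Gam \<Longrightarrow> g \<in> Gam \<Longrightarrow> iv (f \<circ> g) = iv g \<circ> iv f"
  by (simp add: Gam_bij o_inv_distrib)

lemma Gam_inv_inv: "f \<in> Gam \<Longrightarrow> iv (iv f) = f"
  by (simp add: Gam_bij inv_inv_eq)

lemma lab_inv: "f \<in> Gam \<Longrightarrow> lab (iv f) w = - lab f (iv f w)"
  using lab_comp[of f "iv f" w] by (simp add: eq_neg_iff_add_eq_0 add.commute)

lemma al_inv: "f \<in> Gam \<Longrightarrow> al (iv f) = - al f"
  using lab_inv[of f "[]"] by simp

text \<open>\<open>al\<close> and \<open>be\<close> together are the abelianisation of the group.\<close>

definition be :: "(vertex \<Rightarrow> vertex) \<Rightarrow> letter" where
  "be f = lab f [0] + lab f [1] + lab f [- 1]"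

lemma sum_shift: "h (i::letter) + h (i + 1) + h (i - 1) = (h 0 + h 1 + h (- 1) :: letter)"
  using letter_cases[of i] by (auto simp: algebra_simps)

lemma be_comp: assumes "f \<in> Gam" "g \<in> Gam" shows "be (f \<circ> g) = be f + be g"
proof -
  have "be (f \<circ> g) = (lab f [al g] + lab f [al g + 1] + lab f [al g - 1]) + be g"
    using assms by (simp only: be_def lab_comp) (simp add: Gam_Cons algebra_simps)
  then show ?thesis using sum_shift[of "\<lambda>i. lab f [i]" "al g"] by (simp add: be_def)
qed

lemma be_simps [simp]: "be id = 0" "be fg_a = 0" "be fg_b = 1"
  by (simp_all add: be_def)

lemma be_inv: "f \<in> Gam \<Longrightarrow> be (iv f) = - be f"
  using be_comp[of f "iv f"] by (simp add: eq_neg_iff_add_eq_0 add.commute)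

text \<open>A factor \<open>b\<close> puts \<open>a\<close> into the section at \<open>0\<close> and
  \<open>b\<close> into the section at \<open>- 1\<close>. So \<open>b\<close> at \<open>i\<close>
  and \<open>a\<close> at \<open>i + 1\<close> always arise in pairs, and rotations by
  \<open>a\<close> preserve this.\<close>

lemma be_sec: "f \<in> Gam \<Longrightarrow> be (sec f i) = lab f [i + 1]"
proof (induction arbitrary: i rule: Gam.induct)
  case Gam_id
  show ?case by (simp del: id_apply)
next
  case (Gam_a f)
  then show ?case by (simp add: sec_comp be_comp al_comp lab_comp Gam_Cons algebra_simps del: o_apply)
next
  case (Gam_b f)
  have b: "be (sec fg_b k) = lab fg_b [k + 1]" for k
    using letter_cases[of k] by auto
  have "f [i + 1] = [i + al f + 1]"
    using Gam_b by (simp add: Gam_Cons algebra_simps)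
  then have "lab (fg_b \<circ> f) [i + 1] = lab fg_b [i + al f + 1] + lab f [i + 1]"
    using Gam_b by (simp only: lab_comp fg_in_Gam)
  moreover have "be (sec (fg_b \<circ> f) i) = be (sec fg_b (i + al f)) + be (sec f i)"
    using Gam_b by (simp only: sec_comp be_comp fg_in_Gam sec_in_Gam)
  ultimately show ?case using Gam_b by (simp only: b)
qed

section \<open>Level stabilisers, and the labels of conjugates and commutators\<close>

definition st :: "nat \<Rightarrow> (vertex \<Rightarrow> vertex) set" where
  "st m = {f \<in> Gam. \<forall>w. length w < m \<longrightarrow> lab f w = 0}"

lemma st_Gam: "f \<in> st m \<Longrightarrow> f \<in> Gam"
  by (simp add: st_def)

lemma st_0 [simp]: "st 0 = Gam"
  by (auto simp: st_def)

lemma st_mono: "f \<in> st k \<Longrightarrow> m \<le> k \<Longrightarrow> f \<in> st m"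
  by (auto simp: st_def)

lemma st_Suc: "f \<in> st (Suc m) \<longleftrightarrow> f \<in> Gam \<and> al f = 0 \<and> (\<forall>i. sec f i \<in> st m)"
proof
  assume f: "f \<in> st (Suc m)"
  then have "lab f w = 0" if "length w < Suc m" for w using that by (auto simp: st_def)
  from this[of "[]"] this[of "i # w" for i w] f show "f \<in> Gam \<and> al f = 0 \<and> (\<forall>i. sec f i \<in> st m)"
    by (auto simp: st_def)
next
  assume f: "f \<in> Gam \<and> al f = 0 \<and> (\<forall>i. sec f i \<in> st m)"
  then have "lab f w = 0" if "length w < Suc m" for w
    using that by (cases w) (auto simp: st_def)
  then show "f \<in> st (Suc m)" using f by (auto simp: st_def)
qed

lemma st_Suc_lab: "f \<in> st (Suc m) \<longleftrightarrow> f \<in> st m \<and> (\<forall>w. length w = m \<longrightarrow> lab f w = 0)"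
  by (auto simp: st_def less_Suc_eq)

lemma st_fix: "f \<in> Gam \<Longrightarrow> f \<in> st m \<longleftrightarrow> (\<forall>w. length w = m \<longrightarrow> f w = w)"
proof (induction m arbitrary: f)
  case (Suc m)
  have "f (i # w) = i # w \<longleftrightarrow> al f = 0 \<and> sec f i w = w" for i w
    using Suc.prems by (simp add: Gam_Cons)
  moreover have "(\<forall>w. length w = Suc m \<longrightarrow> P w) \<longleftrightarrow> (\<forall>i w. length w = m \<longrightarrow> P (i # w))" for P :: "vertex \<Rightarrow> bool"
    by (auto simp: length_Suc_conv)
  moreover have "\<exists>w::vertex. length w = m" by (rule exI[of _ "replicate m 0"]) simp
  ultimately show ?case using Suc by (auto simp: st_Suc)
qed simp

lemma st_app: "f \<in> st m \<Longrightarrow> length w \<le> m \<Longrightarrow> f w = w"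
  using st_mono[of f m "length w"] by (simp add: st_Gam st_fix[THEN iffD1, rule_format])

lemma st_id [simp]: "id \<in> st m" by (simp add: st_def Gam_id del: id_apply)

lemma st_comp [simp]: "f \<in> st m \<Longrightarrow> g \<in> st m \<Longrightarrow> f \<circ> g \<in> st m"
  by (auto simp: st_def lab_comp)

lemma st_inv [simp]: "f \<in> st m \<Longrightarrow> iv f \<in> st m"
  by (auto simp: st_def lab_inv)

definition conj_by :: "(vertex \<Rightarrow> vertex) \<Rightarrow> (vertex \<Rightarrow> vertex) \<Rightarrow> vertex \<Rightarrow> vertex" where
  "conj_by g f = iv g \<circ> f \<circ> g"

text \<open>The factors are ordered so that, for \<open>f\<close> in \<open>st m\<close>, the labels
  on level \<open>m\<close> become the plain difference of \<open>lab f\<close> along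
  \<open>g\<close> (\<open>lab_comm\<close>).\<close>

definition comm :: "(vertex \<Rightarrow> vertex) \<Rightarrow> (vertex \<Rightarrow> vertex) \<Rightarrow> vertex \<Rightarrow> vertex" where
  "comm f g = iv g \<circ> f \<circ> g \<circ> iv f"

lemma conj_comm_Gam [simp]: "f \<in> Gam \<Longrightarrow> g \<in> Gam \<Longrightarrow> conj_by g f \<in> Gam"
  "f \<in> Gam \<Longrightarrow> g \<in> Gam \<Longrightarrow> comm f g \<in> Gam"
  by (simp_all add: conj_by_def comm_def)

lemma st_conj [simp]: "f \<in> st m \<Longrightarrow> g \<in> Gam \<Longrightarrow> conj_by g f \<in> st m"
  by (simp add: conj_by_def st_Gam st_fix) (simp add: st_app[of f m "g _"])

lemma comm_eq_conj: "comm f g = conj_by g f \<circ> iv f"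
  by (simp add: comm_def conj_by_def)

lemma st_comm [simp]: "f \<in> st m \<Longrightarrow> g \<in> Gam \<Longrightarrow> comm f g \<in> st m"
  by (simp only: comm_eq_conj st_comp st_conj st_inv)

lemma lab_conj: assumes "f \<in> st m" "g \<in> Gam" "length w = m" shows "lab (conj_by g f) w = lab f (g w)"
  using assms st_app[of f m "g w"] by (simp add: conj_by_def lab_comp lab_inv st_Gam)

lemma lab_comm: assumes "f \<in> st m" "g \<in> Gam" "length w = m"
  shows "lab (comm f g) w = lab f (g w) - lab f w"
proof -
  have "comm f g = conj_by g f \<circ> iv f" by (simp add: comm_def conj_by_def)
  moreover have "iv f w = w" using assms st_app st_inv by blast
  ultimately show ?thesis using assms by (simp add: lab_comp lab_conj lab_inv st_Gam)
qed

section \<open>Difference operators along an odometer\<close>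

definition odo :: "(vertex \<Rightarrow> vertex) \<Rightarrow> bool" where
  "odo x \<longleftrightarrow> x \<in> Gam \<and> al x = 1 \<and> be x = 1"

definition cube :: "(vertex \<Rightarrow> vertex) \<Rightarrow> vertex \<Rightarrow> vertex" where
  "cube f = f \<circ> f \<circ> f"

text \<open>The return map of \<open>x\<close> to the subtree at \<open>[i]\<close>. Together with \<open>T_cubed\<close> it reduces the operator \<open>T x\<close>
  on a level to the operators \<open>T (ret x i)\<close> on the previous one.\<close>

definition ret :: "(vertex \<Rightarrow> vertex) \<Rightarrow> letter \<Rightarrow> vertex \<Rightarrow> vertex" where
  "ret x i = sec (cube x) i"

definition T :: "(vertex \<Rightarrow> vertex) \<Rightarrow> (vertex \<Rightarrow> letter) \<Rightarrow> vertex \<Rightarrow> letter" where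
  "T x F w = F (x w) - F w"

definition con :: "nat \<Rightarrow> (vertex \<Rightarrow> letter) \<Rightarrow> letter \<Rightarrow> bool" where
  "con m F c \<longleftrightarrow> (\<forall>w. length w = m \<longrightarrow> F w = c)"

definition D :: "(letter \<Rightarrow> letter) \<Rightarrow> letter \<Rightarrow> letter" where
  "D h i = h (i + 1) - h i"

definition pw :: "(vertex \<Rightarrow> vertex) \<Rightarrow> nat \<Rightarrow> vertex \<Rightarrow> vertex" where
  "pw x j = (cube ^^ j) x"

lemma cube_Gam [simp]: "f \<in> Gam \<Longrightarrow> cube f \<in> Gam"
  by (simp add: cube_def)

lemma pw_0 [simp]: "pw x 0 = x"
  by (simp add: pw_def)

lemma pw_Suc: "pw x (Suc j) = cube (pw x j)"
  by (simp add: pw_def)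

lemma pw_Suc_right: "pw x (Suc j) = pw (cube x) j"
  by (simp add: pw_def funpow_swap1)

lemma pw_Gam [simp]: "x \<in> Gam \<Longrightarrow> pw x j \<in> Gam"
  by (induction j) (simp_all add: pw_Suc)

lemma al_cube [simp]: "f \<in> Gam \<Longrightarrow> al (cube f) = 0"
  by (simp add: cube_def al_comp)

lemma sec_cube: "f \<in> Gam \<Longrightarrow> sec (cube f) i = sec f (i + al f + al f) \<circ> sec f (i + al f) \<circ> sec f i"
  by (simp add: cube_def sec_comp al_comp add.assoc comp_assoc)

lemma sec_cube_0: "f \<in> Gam \<Longrightarrow> al f = 0 \<Longrightarrow> sec (cube f) i = cube (sec f i)"
  by (simp add: sec_cube cube_def[of "sec f i"])

text \<open>Root labels have order 3, and on elements with trivial root label cubing commutes with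
  taking sections.\<close>

lemma cube_st: "f \<in> st m \<Longrightarrow> cube f \<in> st (Suc m)"
proof (induction m arbitrary: f)
  case 0
  then show ?case by (simp add: st_Suc)
next
  case (Suc m)
  then show ?case by (simp add: st_Suc[of f] st_Suc[of "cube f" "Suc m"] sec_cube_0)
qed

lemma pw_st: "x \<in> Gam \<Longrightarrow> pw x j \<in> st j"
  by (induction j) (simp_all add: pw_Suc cube_st)

lemma cube_Cons: "x \<in> Gam \<Longrightarrow> x (x (x (i # w))) = i # ret x i w"
  using Gam_Cons[of "cube x" i w] by (simp add: ret_def) (simp add: cube_def)

lemma odo_Gam: "odo x \<Longrightarrow> x \<in> Gam"
  by (simp add: odo_def)

text \<open>The cube of \<open>x\<close> multiplies the sections of \<open>x\<close> at all three
  letters. So both \<open>al\<close> and \<open>be\<close> of the return map are sums of the labels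
  of \<open>x\<close> over level 1, the latter by \<open>be_sec\<close>, and equal
  \<open>be x\<close>.\<close>

lemma ret_odo: assumes "odo x" shows "odo (ret x i)"
proof -
  have x: "x \<in> Gam" "al x = 1" "be x = 1" using assms by (auto simp: odo_def)
  have s: "h (i + 1 + 1) + h (i + 1) + h i = h 0 + h 1 + h (- 1)" for h :: "letter \<Rightarrow> letter"
    using letter_cases[of i] by (auto simp: algebra_simps)
  have "al (sec x j) = lab x [j]" for j by simp
  then have "al (ret x i) = 1" "be (ret x i) = 1"
    using x s[of "\<lambda>j. lab x [j]"] s[of "\<lambda>j. lab x [j + 1]"]
    by (simp_all add: ret_def sec_cube al_comp be_comp be_sec be_def[of x] algebra_simps)
  then show ?thesis using x by (simp add: odo_def ret_def)
qed

text \<open>The Frobenius identity \<open>(X - 1) ^ 3 = X ^ 3 - 1\<close> in characteristic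
  3.\<close>

lemma T_cubed: "T x (T x (T x F)) w = F (x (x (x w))) - F w"
proof -
  have "T x (T x (T x F)) w = F (x (x (x w))) - F w
      - (F (x (x w)) + F (x (x w)) + F (x (x w))) + (F (x w) + F (x w) + F (x w))"
    unfolding T_def by (simp only: algebra_simps)
  then show ?thesis by (simp only: letter_char3 diff_0_right add_0_right)
qed

lemma T_cube: "T (cube x) F = T x (T x (T x F))"
  by (rule ext) (simp add: T_cubed, simp add: T_def cube_def)

lemma T_pw: "T (pw x j) F = (T x ^^ 3 ^ j) F"
proof (induction j arbitrary: F)
  case (Suc j)
  have "3 ^ Suc j = 3 ^ j + (3 ^ j + 3 ^ j :: nat)" by simp
  then show ?case by (simp only: pw_Suc T_cube Suc funpow_add comp_apply)
qed simp

lemma T_triple: assumes "x \<in> Gam"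
  shows "(T x ^^ (3 * k)) F (i # w) = (T (ret x i) ^^ k) (\<lambda>v. F (i # v)) w"
proof (induction k arbitrary: w)
  case (Suc k)
  have "3 * Suc k = Suc (Suc (Suc (3 * k)))" by simp
  then have "(T x ^^ (3 * Suc k)) F (i # w) = (T x ^^ (3 * k)) F (x (x (x (i # w)))) - (T x ^^ (3 * k)) F (i # w)"
    by (simp only: funpow.simps comp_apply T_cubed)
  also have "\<dots> = T (ret x i) ((T (ret x i) ^^ k) (\<lambda>v. F (i # v))) w"
    by (simp only: cube_Cons[OF assms] Suc) (rule T_def[symmetric])
  finally show ?case by simp
qed simp

lemma T_add: "(T x ^^ k) (\<lambda>w. F w + G w) = (\<lambda>w. (T x ^^ k) F w + (T x ^^ k) G w)"
  by (induction k) (simp_all add: T_def fun_eq_iff)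

lemma T_diff: "(T x ^^ k) (\<lambda>w. F w - G w) = (\<lambda>w. (T x ^^ k) F w - (T x ^^ k) G w)"
  by (induction k) (simp_all add: T_def fun_eq_iff)

lemma T_minus: "(T x ^^ k) (\<lambda>w. - F w) = (\<lambda>w. - (T x ^^ k) F w)"
  by (induction k) (simp_all add: T_def fun_eq_iff)

lemma T_cong: assumes "x \<in> Gam" "\<And>w. length w = m \<Longrightarrow> F w = G w"
  shows "length w = m \<Longrightarrow> (T x ^^ k) F w = (T x ^^ k) G w"
  by (induction k arbitrary: w) (simp_all add: T_def assms)

lemma con_cong: assumes "x \<in> Gam" "\<And>w. length w = m \<Longrightarrow> F w = G w"
  shows "con m ((T x ^^ k) F) c \<longleftrightarrow> con m ((T x ^^ k) G) c"
  unfolding con_def using T_cong[of x m F G, OF assms] by simp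

lemma con_T: assumes "x \<in> Gam" "con m F c" shows "con m (T x F) 0"
  using assms by (simp add: con_def T_def)

lemma con_T_mono: assumes "x \<in> Gam" "con m ((T x ^^ k) F) 0" "k \<le> l" shows "con m ((T x ^^ l) F) 0"
  using assms(3,2) by (induction rule: dec_induct) (simp_all add: con_T[OF assms(1)])

lemma con_T_less: assumes "x \<in> Gam" "con m ((T x ^^ k) F) c" "k < l" shows "con m ((T x ^^ l) F) 0"
  using con_T[OF assms(1,2)] con_T_mono[of x m "Suc k" F l] assms by simp

lemma con_Suc: "con (Suc m) F c \<longleftrightarrow> (\<forall>i. con m (\<lambda>w. F (i # w)) c)"
  by (auto simp: con_def length_Suc_conv)

text \<open>Invariance under the cube of \<open>x\<close> gives constancy on each first-level
  subtree, by induction applied to the return maps; \<open>x\<close> permutes these subtrees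
  cyclically, so the three constants agree.\<close>

lemma T_invariant_con: "odo x \<Longrightarrow> con m (T x F) 0 \<Longrightarrow> \<exists>c. con m F c"
proof (induction m arbitrary: x F)
  case 0
  show ?case by (auto simp: con_def)
next
  case (Suc m)
  have x: "x \<in> Gam" "al x = 1" using Suc.prems by (auto simp: odo_def)
  have inv: "F (x w) = F w" if "length w = Suc m" for w
    using Suc.prems(2) that by (simp add: con_def T_def)
  have "con m (T (ret x i) (\<lambda>v. F (i # v))) 0" for i
    using inv x by (simp add: con_def T_def flip: cube_Cons)
  then have "\<exists>c. con m (\<lambda>v. F (i # v)) c" for i
    using Suc.IH[OF ret_odo[OF Suc.prems(1)]] by blast
  then obtain c where c: "con m (\<lambda>v. F (i # v)) (c i)" for i by metis
  define v where "v = replicate m (0::letter)"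
  have "c (i + 1) = c i" for i
  proof -
    have "F (x (i # v)) = F (i # v)" using inv by (simp add: v_def)
    then show ?thesis using c[of i] c[of "i + 1"] x by (simp add: con_def Gam_Cons v_def)
  qed
  from this[of 0] this[of 1] have "c i = c 0" for i
    using letter_cases[of i] by auto
  then show ?case using c by (metis con_Suc)
qed

lemma T_nilpotent: "odo x \<Longrightarrow> con m ((T x ^^ 3 ^ m) F) 0"
proof (induction m arbitrary: x F)
  case 0
  then show ?case by (simp add: con_def T_def odo_def)
next
  case (Suc m)
  then show ?case by (simp add: con_Suc T_triple odo_Gam ret_odo)
qed

lemma T_first_letter:
  assumes "x \<in> Gam" "al x = 1" "\<And>i w. length w = m \<Longrightarrow> H (i # w) = h i"
  shows "length w = m \<Longrightarrow> (T x ^^ r) H (i # w) = (D ^^ r) h i"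
  by (induction r arbitrary: i w) (simp_all add: assms T_def D_def Gam_Cons)

lemma D_shift: "(D ^^ r) (\<lambda>i. h (i + a)) i = (D ^^ r) h (i + a)"
  by (induction r arbitrary: i) (simp_all add: D_def algebra_simps)

text \<open>After \<open>3 * q\<close> differences the function is already constant on each
  first-level subtree: three further differences kill it, and these are one difference of each
  return map.\<close>

lemma con_T_split:
  assumes x: "odo x" and r: "r < 3" and c: "con (Suc m) ((T x ^^ (r + 3 * q)) F) c"
  obtains h where "\<And>i. con m ((T (ret x i) ^^ q) (\<lambda>v. F (i # v))) (h i)" "\<And>i. (D ^^ r) h i = c"
proof -
  define H where "H = (T x ^^ (3 * q)) F"
  have xG: "x \<in> Gam" "al x = 1" using x by (auto simp: odo_def)
  have rH: "con (Suc m) ((T x ^^ r) H) c" using c by (simp add: H_def funpow_add)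
  have H_eq: "H (i # w) = (T (ret x i) ^^ q) (\<lambda>v. F (i # v)) w" for i w
    by (simp add: H_def T_triple xG)
  have "con (Suc m) ((T x ^^ (3 * 1)) H) 0"
    using con_T_less[OF xG(1) rH] r by simp
  then have "con m ((T (ret x i) ^^ 1) (\<lambda>v. H (i # v))) 0" for i
    unfolding con_Suc T_triple[OF xG(1)] by blast
  then have "con m (T (ret x i) (\<lambda>v. H (i # v))) 0" for i
    by simp
  then have "\<exists>c. con m (\<lambda>v. H (i # v)) c" for i
    using T_invariant_con[OF ret_odo[OF x]] by blast
  then obtain h where h: "con m (\<lambda>v. H (i # v)) (h i)" for i by metis
  have "(D ^^ r) h i = c" for i
  proof -
    define v where "v = replicate m (0::letter)"
    have "(T x ^^ r) H (i # v) = (D ^^ r) h i"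
      using h by (intro T_first_letter[OF xG, of m]) (auto simp: con_def v_def)
    then show ?thesis using rH by (simp add: con_def v_def)
  qed
  then show ?thesis using h that unfolding H_eq by blast
qed

lemma con_T_combine:
  assumes x: "odo x" and h: "\<And>i. con m ((T (ret x i) ^^ q) (\<lambda>v. F (i # v))) (h i)"
    and d: "\<And>i. (D ^^ r) h i = c"
  shows "con (Suc m) ((T x ^^ (r + 3 * q)) F) c"
  unfolding con_Suc
proof
  fix i
  have xG: "x \<in> Gam" "al x = 1" using x by (auto simp: odo_def)
  have "(T x ^^ (r + 3 * q)) F (i # w) = c" if "length w = m" for w
  proof -
    have "(T x ^^ r) ((T x ^^ (3 * q)) F) (i # w) = (D ^^ r) h i"
      using h that by (intro T_first_letter[OF xG, of m]) (auto simp: T_triple[OF xG(1)] con_def)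
    then show ?thesis using d by (simp add: funpow_add)
  qed
  then show "con m (\<lambda>w. (T x ^^ (r + 3 * q)) F (i # w)) c" by (simp add: con_def)
qed

text \<open>In the first letter, precomposition with \<open>g\<close> is a shift by
  \<open>al g\<close>, which commutes with \<open>D\<close>; the sections of \<open>g\<close> are
  left to the induction. That even the constant \<open>c\<close> is preserved is what makes every
  commutator lower the degree (\<open>dle_comm\<close>).\<close>

lemma con_T_invariant:
  "odo x \<Longrightarrow> odo x' \<Longrightarrow> g \<in> Gam \<Longrightarrow> con m ((T x ^^ k) F) c \<Longrightarrow>
    con m ((T x' ^^ k) (\<lambda>w. F (g w))) c"
proof (induction m arbitrary: x x' g k F c)
  case 0
  have "(T y ^^ Suc j) G [] = 0" if "odo y" for y j G
    using that by (simp add: T_def odo_def)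
  then show ?case using 0 by (cases k) (auto simp: con_def)
next
  case (Suc m)
  define r q where "r = k mod 3" and "q = k div 3"
  have k: "k = r + 3 * q" and r: "r < 3" by (simp_all add: r_def q_def)
  obtain h where h: "\<And>i. con m ((T (ret x i) ^^ q) (\<lambda>v. F (i # v))) (h i)" "\<And>i. (D ^^ r) h i = c"
    using con_T_split[OF Suc.prems(1) r] Suc.prems(4) unfolding k by metis
  have "con m ((T (ret x' i) ^^ q) (\<lambda>v. F (g (i # v)))) (h (i + al g))" for i
    using Suc.IH[OF ret_odo[OF Suc.prems(1)] ret_odo[OF Suc.prems(2)] _ h(1)[of "i + al g"], of "sec g i"] Suc.prems(3)
    by (simp add: Gam_Cons)
  then show ?case unfolding k
    by (rule con_T_combine[OF Suc.prems(2)]) (simp add: D_shift h(2))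
qed

section \<open>Degrees of elements of the level stabilisers\<close>

text \<open>Along the orbit of \<open>x\<close>, the labels of \<open>f\<close> on level \<open>m\<close> form a polynomial of degree less than \<open>k\<close>.\<close>

definition dle :: "(vertex \<Rightarrow> vertex) \<Rightarrow> nat \<Rightarrow> nat \<Rightarrow> (vertex \<Rightarrow> vertex) \<Rightarrow> bool" where
  "dle x m k f \<longleftrightarrow> con m ((T x ^^ k) (lab f)) 0"

lemma dle_mono: "odo x \<Longrightarrow> dle x m k f \<Longrightarrow> k \<le> l \<Longrightarrow> dle x m l f"
  using con_T_mono odo_Gam unfolding dle_def by blast

lemma dle_max: "odo x \<Longrightarrow> dle x m (3 ^ m) f"
  by (simp add: dle_def T_nilpotent)

lemma dle_0: "f \<in> st m \<Longrightarrow> dle x m 0 f \<longleftrightarrow> f \<in> st (Suc m)"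
  by (simp add: dle_def con_def st_Suc_lab)

lemma T_lab_comp: assumes "x \<in> Gam" "f \<in> st m" "g \<in> st m" "length w = m"
  shows "(T x ^^ k) (lab (f \<circ> g)) w = (T x ^^ k) (lab f) w + (T x ^^ k) (lab g) w"
proof -
  have "(T x ^^ k) (lab (f \<circ> g)) w = (T x ^^ k) (\<lambda>w. lab f w + lab g w) w"
    using assms by (intro T_cong[of x m]) (simp_all add: lab_comp st_Gam st_app[of g m])
  then show ?thesis by (simp add: T_add)
qed

text \<open>The leading coefficients \<open>a\<close> of \<open>f\<close> and \<open>b\<close> of
  \<open>e\<close> are constants with \<open>b\<close> nonzero, so one of \<open>a\<close>,
  \<open>a + b\<close>, \<open>a + 2 * b\<close> vanishes in the field of three elements.\<close>

lemma dle_reduce: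
  assumes x: "odo x" and f: "f \<in> st m" "dle x m (Suc k) f" and e: "e \<in> st m" "dle x m (Suc k) e" "\<not> dle x m k e"
  shows "dle x m k f \<or> dle x m k (f \<circ> e) \<or> dle x m k (f \<circ> e \<circ> e)"
proof -
  obtain a where a: "con m ((T x ^^ k) (lab f)) a" using T_invariant_con[OF x] f(2) by (auto simp: dle_def)
  obtain b where b: "con m ((T x ^^ k) (lab e)) b" using T_invariant_con[OF x] e(2) by (auto simp: dle_def)
  have "b \<noteq> 0" using b e(3) by (auto simp: dle_def)
  then have "a = 0 \<or> a + b = 0 \<or> a + b + b = 0"
    by (cases a; cases b; simp add: zero_letter_def)
  moreover have "con m ((T x ^^ k) (lab (f \<circ> e))) (a + b)" "con m ((T x ^^ k) (lab (f \<circ> e \<circ> e))) (a + b + b)"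
    using a b x f(1) e(1) by (simp_all add: con_def T_lab_comp[where m = m] odo_Gam)
  ultimately show ?thesis using a by (auto simp: dle_def)
qed

lemma T_lab_comm: assumes "x \<in> Gam" "f \<in> st m" "g \<in> Gam" "length w = m"
  shows "(T x ^^ k) (lab (comm f g)) w = (T x ^^ k) (\<lambda>w. lab f (g w) - lab f w) w"
  using assms by (intro T_cong[of x m]) (simp_all add: lab_comm)

lemma dle_comm_pw: assumes "x \<in> Gam" "f \<in> st m" shows "dle x m k (comm f (pw x j)) \<longleftrightarrow> dle x m (k + 3 ^ j) f"
proof -
  have "(T x ^^ k) (lab (comm f (pw x j))) w = (T x ^^ (k + 3 ^ j)) (lab f) w" if "length w = m" for w
  proof -
    have "(T x ^^ k) (lab (comm f (pw x j))) w = (T x ^^ k) (T (pw x j) (lab f)) w"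
      using assms that by (intro T_cong[of x m]) (simp_all add: lab_comm T_def)
    then show ?thesis by (simp add: T_pw funpow_add)
  qed
  then show ?thesis by (simp add: dle_def con_def)
qed

lemma dle_conj: assumes "odo x" "f \<in> st m" "g \<in> Gam" "dle x m k f" shows "dle x m k (conj_by g f)"
proof -
  have "con m ((T x ^^ k) (\<lambda>w. lab f (g w))) 0"
    using con_T_invariant[OF assms(1,1,3)] assms(4) by (simp add: dle_def)
  then show ?thesis unfolding dle_def
    using assms by (subst con_cong[of x m _ "\<lambda>w. lab f (g w)"]) (simp_all add: lab_conj odo_Gam)
qed

lemma dle_comm: assumes "odo x" "f \<in> st m" "g \<in> Gam" "dle x m (Suc k) f" shows "dle x m k (comm f g)"
proof -
  obtain a where a: "con m ((T x ^^ k) (lab f)) a"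
    using T_invariant_con[OF assms(1)] assms(4) by (auto simp: dle_def)
  then have "con m ((T x ^^ k) (\<lambda>w. lab f (g w))) a"
    using con_T_invariant[OF assms(1,1,3)] by blast
  then show ?thesis using a assms by (simp add: dle_def con_def T_lab_comm T_diff odo_Gam)
qed

section \<open>Maximal degrees, and the leading coefficient of commutators with powers of
  \<open>x\<close>\<close>

text \<open>For \<open>m \<ge> 1\<close> these are the elements of \<open>st m\<close> whose labels on level \<open>m\<close> sum to zero over siblings;
  only for \<open>m = 1\<close> this is an additional condition.\<close>

definition Q :: "nat \<Rightarrow> (vertex \<Rightarrow> vertex) set" where
  "Q m = {f \<in> st m. m = 1 \<longrightarrow> be f = 0}"

lemma Q_st: "f \<in> Q m \<Longrightarrow> f \<in> st m"
  by (simp add: Q_def)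

lemma st_Suc_Q: "f \<in> st (Suc m) \<Longrightarrow> f \<in> Q m"
  by (simp add: Q_def be_def st_Suc_lab del: lab.simps)

text \<open>For \<open>m = 0\<close> the sum condition on the sections is \<open>be_sec\<close>:
  their \<open>be\<close> is a label of \<open>f\<close> on level 1.\<close>

lemma Q_sec: "f \<in> Q (Suc (Suc m)) \<Longrightarrow> sec f i \<in> Q (Suc m)"
  by (auto simp: Q_def st_Suc[of f] be_sec st_Gam) (auto simp: st_def)

lemma Q_comp: "f \<in> Q m \<Longrightarrow> g \<in> Q m \<Longrightarrow> f \<circ> g \<in> Q m"
  by (auto simp: Q_def be_comp st_Gam)

lemma Q_inv: "f \<in> Q m \<Longrightarrow> iv f \<in> Q m"
  by (auto simp: Q_def be_inv st_Gam)

lemma be_conj: "f \<in> Gam \<Longrightarrow> g \<in> Gam \<Longrightarrow> be (conj_by g f) = be f"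
  by (simp add: conj_by_def be_comp be_inv)

lemma Q_conj: "f \<in> Q m \<Longrightarrow> g \<in> Gam \<Longrightarrow> conj_by g f \<in> Q m"
  by (auto simp add: Q_def be_conj dest: st_Gam)

lemma Q_comm: "f \<in> Q m \<Longrightarrow> g \<in> Gam \<Longrightarrow> comm f g \<in> Q m"
  by (simp add: comm_eq_conj Q_comp Q_conj Q_inv)

text \<open>Modulo 3 the coefficients \<open>1, - 2, 1\<close> of the second difference are all
  1.\<close>

lemma D_D: "D (D h) i = h 0 + h 1 + h (- 1)"
proof -
  have "D (D h) i = h (i + 1 + 1) - (h (i + 1) + h (i + 1)) + h i"
    by (simp add: D_def)
  then show ?thesis using letter_cases[of i] unfolding letter_double by (auto simp: algebra_simps)
qed

text \<open>Zero sums over siblings mean that two differences in the last letter suffice instead of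
  three; every letter above it contributes a factor 3.\<close>

lemma dle_Q: "odo x \<Longrightarrow> f \<in> Q (Suc m) \<Longrightarrow> dle x (Suc m) (2 * 3 ^ m) f"
proof (induction m arbitrary: f x)
  case 0
  have "con (Suc 0) ((T x ^^ (2 + 3 * 0)) (lab f)) 0"
    by (rule con_T_combine[OF 0(1), where h = "\<lambda>i. lab f [i]"])
      (use 0 in \<open>simp_all add: con_def D_D Q_def be_def numeral_2_eq_2\<close>)
  then show ?case by (simp add: dle_def)
next
  case (Suc m)
  have "con (Suc (Suc m)) ((T x ^^ (0 + 3 * (2 * 3 ^ m))) (lab f)) 0"
  proof (rule con_T_combine[OF Suc.prems(1), where h = "\<lambda>i. 0"])
    show "con (Suc m) ((T (ret x i) ^^ (2 * 3 ^ m)) (\<lambda>v. lab f (i # v))) 0" for i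
      using Suc.IH[OF ret_odo[OF Suc.prems(1)] Q_sec[OF Suc.prems(2)]] by (simp add: dle_def)
  qed simp
  then show ?case by (simp add: dle_def ac_simps)
qed

text \<open>This is \<open>(3 ^ m - 1) / 2\<close>, with all \<open>m\<close> ternary digits equal
  to 1: in \<open>comm_pw_leading\<close> each letter contributes exactly one difference.\<close>

fun dd :: "nat \<Rightarrow> nat" where
  "dd 0 = 0"
| "dd (Suc m) = 3 * dd m + 1"

lemma pw_sec: "x \<in> Gam \<Longrightarrow> sec (pw x (Suc j)) i = pw (ret x i) j"
proof (induction j)
  case 0
  then show ?case by (simp add: pw_Suc ret_def)
next
  case (Suc j)
  have "al (pw x (Suc j)) = 0" using Suc.prems by (simp add: pw_Suc)
  then have "sec (cube (pw x (Suc j))) i = cube (sec (pw x (Suc j)) i)"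
    using Suc.prems by (intro sec_cube_0) simp_all
  then show ?case using Suc by (simp add: pw_Suc)
qed

lemma comm_shift: assumes "g \<in> Gam" "x \<in> Gam" shows "comm (g \<circ> x) (pw x m) = comm g (pw x m)"
proof -
  have "x (pw x m w) = pw x m (x w)" for w
    by (induction m arbitrary: w) (simp_all add: pw_Suc cube_def)
  then have "x (pw x m (iv x w)) = pw x m w" for w
    using assms by simp
  then show ?thesis using assms by (simp add: fun_eq_iff comm_def Gam_inv_comp)
qed

text \<open>Commutators with \<open>x\<close> do not change when \<open>g\<close> is multiplied by a power of \<open>x\<close>, so that
  \<open>g\<close> may be assumed to fix the first level.\<close>

lemma comm_pw_leading:
  "odo x \<Longrightarrow> g \<in> Gam \<Longrightarrow> comm g (pw x m) \<in> st (Suc m) \<and>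
    con (Suc m) ((T x ^^ dd (Suc m)) (lab (comm g (pw x m)))) (be g - al g)"
proof (induction m arbitrary: x g)
  case (0 x g)
  have x: "x \<in> Gam" "al x = 1" "be x = 1" using 0 by (auto simp: odo_def)
  have *: "comm g x \<in> st 1 \<and> con 1 ((T x ^^ 1) (lab (comm g x))) (be g)"
    if g: "g \<in> Gam" "al g = 0" for g
  proof -
    have g1: "g \<in> st 1" using g by (simp add: st_Suc)
    \<comment> \<open>Two differences of the labels of \<open>g\<close> sum them to
      \<open>be g\<close>; the first of the two is supplied by the commutator.\<close>
    have "con (Suc 0) ((T x ^^ (2 + 3 * 0)) (lab g)) (be g)"
      by (rule con_T_combine[OF 0(1), where h = "\<lambda>i. lab g [i]"])
        (simp_all add: con_def D_D be_def numeral_2_eq_2)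
    then have "con 1 ((T x ^^ 1) (T x (lab g))) (be g)"
      by (simp add: numeral_2_eq_2)
    moreover have "lab (comm g x) w = T x (lab g) w" if "length w = 1" for w
      using lab_comm[OF g1 x(1) that] by (simp add: T_def)
    ultimately show ?thesis using g1 x con_cong[of x 1 "lab (comm g x)" "T x (lab g)" 1] by simp
  qed
  have g: "g \<circ> x \<in> Gam" "g \<circ> x \<circ> x \<in> Gam" "comm (g \<circ> x) x = comm g x" "comm (g \<circ> x \<circ> x) x = comm g x"
    using comm_shift[of g x 0] comm_shift[of "g \<circ> x" x 0] 0 x by simp_all
  show ?case using letter_cases[of "al g"]
    by (elim disjE) (use *[of g] *[OF g(1)] *[OF g(2)] 0 x g in \<open>simp_all add: al_comp be_comp\<close>)
next
  case (Suc m x g)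
  have x: "x \<in> Gam" "al x = 1" "be x = 1" using Suc.prems by (auto simp: odo_def)
  let ?X = "pw x (Suc m)"
  have X: "?X \<in> Gam" "al ?X = 0" using x by (simp_all add: pw_Suc)
  have *: "comm g ?X \<in> st (Suc (Suc m)) \<and>
     con (Suc (Suc m)) ((T x ^^ (1 + 3 * dd (Suc m))) (lab (comm g ?X))) (be g)"
    if g: "g \<in> Gam" "al g = 0" for g
  proof -
    have inv: "al (iv h) = 0" "sec (iv h) i = iv (sec h i)" if "h \<in> Gam" "al h = 0" for h i
    proof -
      show a: "al (iv h) = 0" using that by (simp add: al_inv)
      have "sec h i (sec (iv h) i w) = w" "sec (iv h) i (sec h i w) = w" for w
        using sec_comp[of h "iv h" i] sec_comp[of "iv h" h i] that a by (simp_all add: fun_eq_iff)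
      then show "sec (iv h) i = iv (sec h i)" by (metis inv_equality)
    qed
    have s: "sec (comm g ?X) i = comm (sec g i) (pw (ret x i) m)" for i
      using g X x unfolding comm_def by (simp add: sec_comp al_comp inv pw_sec)
    \<comment> \<open>By \<open>be_sec\<close> the leading coefficient \<open>be - al\<close> of the
      section of \<open>g\<close> at \<open>i\<close> is a first difference of the labels of
      \<open>g\<close> on level 1. One more difference in the first letter turns it into their sum
      \<open>be g\<close>.\<close>
    have IH: "comm (sec g i) (pw (ret x i) m) \<in> st (Suc m)"
      "con (Suc m) ((T (ret x i) ^^ dd (Suc m)) (lab (comm (sec g i) (pw (ret x i) m)))) (lab g [i + 1] - lab g [i])" for i
      using Suc.IH[OF ret_odo[OF Suc.prems(1)], of "sec g i" i] g by (simp_all add: be_sec)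
    have "al (comm g ?X) = 0" using g X by (simp add: comm_def al_comp inv)
    then have st: "comm g ?X \<in> st (Suc (Suc m))" using IH(1) g X by (simp add: st_Suc[of _ "Suc m"] s)
    have "con (Suc (Suc m)) ((T x ^^ (1 + 3 * dd (Suc m))) (lab (comm g ?X))) (be g)"
    proof (rule con_T_combine[OF Suc.prems(1)])
      show "con (Suc m) ((T (ret x i) ^^ dd (Suc m)) (\<lambda>v. lab (comm g ?X) (i # v))) (D (\<lambda>i. lab g [i]) i)" for i
        using IH(2) by (simp only: lab.simps s D_def)
      show "(D ^^ 1) (D (\<lambda>i. lab g [i])) i = be g" for i by (simp add: D_D be_def)
    qed
    with st show ?thesis by simp
  qed
  \<comment> \<open>As \<open>al x = be x\<close>, the value \<open>be g - al g\<close> is unchanged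
    when \<open>g\<close> is replaced by its product with \<open>x\<close>; one of the three
    products has trivial \<open>al\<close>.\<close>
  have g: "g \<circ> x \<in> Gam" "g \<circ> x \<circ> x \<in> Gam" "comm (g \<circ> x) ?X = comm g ?X" "comm (g \<circ> x \<circ> x) ?X = comm g ?X"
    using comm_shift[of g x "Suc m"] comm_shift[of "g \<circ> x" x "Suc m"] Suc.prems x by simp_all
  have d: "dd (Suc (Suc m)) = 1 + 3 * dd (Suc m)" by simp
  show ?case unfolding d using letter_cases[of "al g"]
    by (elim disjE) (use *[of g] *[OF g(1)] *[OF g(2)] Suc.prems x g in \<open>simp_all add: al_comp be_comp\<close>)
qed

section \<open>A functional detecting elements of maximal degree\<close>

text \<open>The coefficient left after \<open>2 * 3 ^ m - 1\<close> differences on level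
  \<open>m + 1\<close>. On a triple with sum zero the first difference is constant
  (\<open>D_sum_0\<close>), which settles the last letter; in each earlier letter two differences
  amount to summation.\<close>

fun Psi :: "nat \<Rightarrow> (vertex \<Rightarrow> letter) \<Rightarrow> letter" where
  "Psi 0 F = F [1] - F [0]"
| "Psi (Suc m) F = Psi m (\<lambda>v. F (0 # v)) + Psi m (\<lambda>v. F (1 # v)) + Psi m (\<lambda>v. F (- 1 # v))"

lemma D_sum_0: "h 0 + h 1 + h (- 1) = 0 \<Longrightarrow> D h i = h 1 - h 0"
  using letter_cases[of i] by (cases "h 0"; cases "h 1"; cases "h (- 1)") (auto simp: D_def letter_simps)

lemma con_Psi: "odo x \<Longrightarrow> f \<in> Q (Suc m) \<Longrightarrow>
  con (Suc m) ((T x ^^ (2 * 3 ^ m - 1)) (lab f)) (Psi m (lab f))"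
proof (induction m arbitrary: f x)
  case 0
  have s: "lab f [0] + lab f [1] + lab f [- 1] = 0" using 0 by (simp add: Q_def be_def)
  have "con (Suc 0) ((T x ^^ (1 + 3 * 0)) (lab f)) (Psi 0 (lab f))"
  proof (rule con_T_combine[OF 0(1), where h = "\<lambda>i. lab f [i]"])
    show "(D ^^ 1) (\<lambda>i. lab f [i]) i = Psi 0 (lab f)" for i
      using D_sum_0[of "\<lambda>i. lab f [i]" i, OF s] by simp
  qed (simp_all add: con_def)
  then show ?case by simp
next
  case (Suc m)
  have e: "2 * 3 ^ Suc m - 1 = 2 + 3 * (2 * 3 ^ m - 1 :: nat)" by (cases "3 ^ m :: nat") simp_all
  show ?case unfolding e
  proof (rule con_T_combine[OF Suc.prems(1), where h = "\<lambda>i. Psi m (\<lambda>v. lab f (i # v))"])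
    show "con (Suc m) ((T (ret x i) ^^ (2 * 3 ^ m - 1)) (\<lambda>v. lab f (i # v))) (Psi m (\<lambda>v. lab f (i # v)))" for i
      using Suc.IH[OF ret_odo[OF Suc.prems(1)] Q_sec[OF Suc.prems(2)]] by simp
  qed (simp add: numeral_2_eq_2 D_D)
qed

text \<open>The bilinear correction term makes \<open>Om\<close> additive.\<close>

fun Om :: "nat \<Rightarrow> (vertex \<Rightarrow> vertex) \<Rightarrow> letter" where
  "Om 0 f = Psi (Suc 0) (lab f) + (lab f [0] * lab f [1] + lab f [1] * lab f [- 1] + lab f [- 1] * lab f [0])"
| "Om (Suc m) f = Om m (sec f 0) + Om m (sec f 1) + Om m (sec f (- 1))"

lemma Om_Psi: "f \<in> st (Suc (Suc m)) \<Longrightarrow> Om m f = Psi (Suc m) (lab f)"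
proof (induction m arbitrary: f)
  case 0
  then have "lab f [i] = 0" for i by (simp add: st_def del: lab.simps)
  then show ?case by (simp del: lab.simps)
next
  case (Suc m)
  then show ?case by (simp add: st_Suc[of f])
qed

text \<open>This measures how far \<open>Psi\<close> is from additive: rotating a sibling triple by
  \<open>c\<close> costs \<open>c\<close> times its sum.\<close>

lemma difference_shift:
  "h (1 + c) - h c = h 1 - h 0 + c * (h 0 + h 1 + h (- 1))" for h :: "letter \<Rightarrow> letter"
  using letter_cases[of c] by (cases "h 0"; cases "h 1"; cases "h (- 1)") (auto simp: letter_simps)

text \<open>On triples with sum zero the polarisation of the quadratic form
  \<open>n0 * n1 + n1 * n2 + n2 * n0\<close> is, modulo 3, the negative of the cyclic form
  \<open>p0 * n1 + p1 * n2 + p2 * n0\<close>.\<close>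

lemma Om_additive_identity:
  assumes "n0 + n1 + n2 = 0" "p0 + p1 + p2 = (0::letter)"
  shows "(n0 + p0) * (n1 + p1) + (n1 + p1) * (n2 + p2) + (n2 + p2) * (n0 + p0) + (p0 * n1 + p1 * n2 + p2 * n0)
    = n0 * n1 + n1 * n2 + n2 * n0 + (p0 * p1 + p1 * p2 + p2 * p0)"
proof -
  have "n2 = - n0 - n1" "p2 = - p0 - p1" using assms by (simp_all add: eq_neg_iff_add_eq_0 algebra_simps)
  then show ?thesis
    by (cases n0; cases n1; cases p0; cases p1) (simp_all add: letter_simps)
qed

lemma sec_comp_0: "f \<in> Gam \<Longrightarrow> g \<in> Gam \<Longrightarrow> al g = 0 \<Longrightarrow> sec (f \<circ> g) i = sec f i \<circ> sec g i"
  by (simp add: sec_comp)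

lemma Q_al: "f \<in> Q (Suc m) \<Longrightarrow> al f = 0"
  by (simp add: Q_def st_Suc)

lemma Q_Gam: "f \<in> Q m \<Longrightarrow> f \<in> Gam"
  by (auto simp: Q_def dest: st_Gam)

lemma Om_comp: "f \<in> Q (Suc m) \<Longrightarrow> g \<in> Q (Suc m) \<Longrightarrow> Om m (f \<circ> g) = Om m f + Om m g"
proof (induction m arbitrary: f g)
  case 0
  have G: "f \<in> Gam" "g \<in> Gam" "al g = 0" using 0 by (simp_all add: Q_Gam Q_al)
  define n p where "n i = lab f [i]" and "p i = lab g [i]" for i
  have n: "n 0 + n 1 + n (- 1) = 0" and p: "p 0 + p 1 + p (- 1) = 0"
    using 0 by (simp_all add: Q_def be_def n_def p_def)
  have l1: "lab (f \<circ> g) [i] = n i + p i" for i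
    using G by (simp add: sec_comp_0 al_comp n_def p_def)
  have l2: "lab (f \<circ> g) [i, j] = lab f [i, j + p i] + lab g [i, j]" for i j
    using G by (simp add: sec_comp_0 p_def) (simp add: sec_comp al_comp)
  \<comment> \<open>\<open>be_sec\<close> turns the sum of a sibling triple on level 2 into a label
    on level 1, so the defect of \<open>Psi\<close> is precisely the cyclic form in the level 1
    labels of \<open>g\<close> and \<open>f\<close>.\<close>
  have s: "lab f [i, 0] + lab f [i, 1] + lab f [i, - 1] = n (i + 1)" for i
    using be_sec[OF G(1), of i] by (simp add: be_def n_def)
  have d: "lab f [i, 1 + p i] - lab f [i, p i] = lab f [i, 1] - lab f [i, 0] + p i * n (i + 1)" for i
    unfolding s[symmetric] by (rule difference_shift[of "\<lambda>j. lab f [i, j]"])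
  have Psi: "Psi (Suc 0) (lab (f \<circ> g)) = Psi (Suc 0) (lab f) + Psi (Suc 0) (lab g) + (p 0 * n 1 + p 1 * n (- 1) + p (- 1) * n 0)"
  proof -
    have A: "lab (f \<circ> g) [i, 1] - lab (f \<circ> g) [i, 0] =
      (lab f [i, 1] - lab f [i, 0]) + (lab g [i, 1] - lab g [i, 0]) + p i * n (i + 1)" for i
      using d[of i] unfolding l2 by (simp add: algebra_simps del: lab.simps)
    have P: "Psi (Suc 0) F = (F [0, 1] - F [0, 0]) + (F [1, 1] - F [1, 0]) + (F [- 1, 1] - F [- 1, 0])" for F
      by simp
    show ?thesis
      unfolding P A by (simp add: algebra_simps del: lab.simps Psi.simps)
  qed
  have "y + x = u + v \<Longrightarrow> a + b + x + y = a + u + (b + v)" for a b x y u v :: letter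
    by (simp add: algebra_simps)
  from this[OF Om_additive_identity[OF n p]] show ?case
    unfolding Om.simps Psi l1 n_def[symmetric] p_def[symmetric] .
next
  case (Suc m)
  have "sec (f \<circ> g) i = sec f i \<circ> sec g i" for i
    using Suc.prems by (simp add: sec_comp_0 Q_Gam Q_al)
  then show ?case using Suc by (simp add: Q_sec algebra_simps del: o_apply)
qed

text \<open>The root, which is not on level \<open>Suc m\<close>, is used to store the value of \<open>Om m\<close>.\<close>

definition cl :: "nat \<Rightarrow> (vertex \<Rightarrow> vertex) \<Rightarrow> vertex \<Rightarrow> letter" where
  "cl m f w = (if w = [] then Om m f else if length w = Suc m then lab f w else 0)"

definition adf :: "(vertex \<Rightarrow> letter) \<Rightarrow> letter \<Rightarrow> (vertex \<Rightarrow> letter) \<Rightarrow> vertex \<Rightarrow> letter" where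
  "adf F c G = (\<lambda>w. F w + c * G w)"

lemma cl_comp: "f \<in> Q (Suc m) \<Longrightarrow> g \<in> Q (Suc m) \<Longrightarrow> cl m (f \<circ> g) = adf (cl m f) 1 (cl m g)"
  by (simp add: fun_eq_iff cl_def adf_def Om_comp lab_comp Q_Gam) (metis Q_st le_refl st_app)

text \<open>Together with \<open>cl_comp\<close> this makes \<open>cl m\<close> the map from
  \<open>Q (Suc m)\<close> onto the elementary abelian quotient of the overview, with elements of
  the quotient represented by functions.\<close>

lemma cl_eq_0: assumes "odo x"
  shows "f \<in> Q (Suc m) \<and> cl m f = (\<lambda>w. 0) \<longleftrightarrow> f \<in> st (Suc (Suc m)) \<and> dle x (Suc (Suc m)) (2 * 3 ^ Suc m - 1) f"
proof -
  have "cl m f = (\<lambda>w. 0) \<longleftrightarrow> Om m f = 0 \<and> (\<forall>w. length w = Suc m \<longrightarrow> lab f w = 0)"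
    unfolding cl_def fun_eq_iff by (metis length_0_conv nat.distinct(1))
  then have "f \<in> Q (Suc m) \<and> cl m f = (\<lambda>w. 0) \<longleftrightarrow> f \<in> st (Suc (Suc m)) \<and> Om m f = 0"
    using Q_st[of f "Suc m"] st_Suc_Q[of f "Suc m"] st_Suc_lab[of f "Suc m"] by blast
  moreover have "Om m f = 0 \<longleftrightarrow> dle x (Suc (Suc m)) (2 * 3 ^ Suc m - 1) f" if "f \<in> st (Suc (Suc m))"
  proof -
    have "con (Suc (Suc m)) ((T x ^^ (2 * 3 ^ Suc m - 1)) (lab f)) (Psi (Suc m) (lab f))"
      by (rule con_Psi[OF assms]) (use that in \<open>simp add: Q_def\<close>)
    moreover have "\<exists>w::vertex. length w = Suc (Suc m)" by (rule exI[of _ "replicate (Suc (Suc m)) 0"]) simp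
    ultimately show ?thesis using Om_Psi[OF that] by (auto simp: dle_def con_def)
  qed
  ultimately show ?thesis by blast
qed

lemma exists_odo: "odo (fg_a \<circ> fg_b)"
  by (simp add: odo_def al_comp be_comp)

lemma cl_conj_0: assumes "f \<in> Q (Suc m)" "cl m f = (\<lambda>w. 0)" "g \<in> Gam" shows "cl m (conj_by g f) = (\<lambda>w. 0)"
  using cl_eq_0[OF exists_odo, of f m] cl_eq_0[OF exists_odo, of "conj_by g f" m] assms
    dle_conj[OF exists_odo] by simp

text \<open>Commutators lower the degree, so \<open>st (Suc (Suc m))\<close> is central modulo the
  kernel of \<open>cl m\<close>.\<close>

lemma cl_comm_st: assumes "f \<in> st (Suc (Suc m))" "g \<in> Gam" shows "cl m (comm f g) = (\<lambda>w. 0)"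
proof -
  have e: "Suc (2 * 3 ^ Suc m - 1) = 2 * 3 ^ Suc m" by simp
  have "f \<in> Q (Suc (Suc m))" using assms by (simp add: Q_def)
  then have "dle (fg_a \<circ> fg_b) (Suc (Suc m)) (Suc (2 * 3 ^ Suc m - 1)) f"
    using dle_Q[OF exists_odo, of f "Suc m"] by (simp only: e)
  then show ?thesis
    using cl_eq_0[OF exists_odo, of "comm f g" m] assms dle_comm[OF exists_odo assms] by simp
qed

section \<open>Spans of classes\<close>

text \<open>The linear span, described by eliminating one vector at a time so that proofs run along
  the list just as sifting does.\<close>

fun W :: "(vertex \<Rightarrow> letter) list \<Rightarrow> (vertex \<Rightarrow> letter) set" where
  "W [] = {\<lambda>w. 0}"
| "W (e # es) = {v. \<exists>c. adf v c e \<in> W es}"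

lemma adf_0 [simp]: "adf v 0 e = v"
  by (simp add: adf_def)

lemma W_adf: "u \<in> W es \<Longrightarrow> v \<in> W es \<Longrightarrow> adf u d v \<in> W es"
proof (induction es arbitrary: u v)
  case (Cons e es)
  then obtain a b where ab: "adf u a e \<in> W es" "adf v b e \<in> W es" by auto
  have "adf (adf u d v) (a + d * b) e = adf (adf u a e) d (adf v b e)"
    by (simp add: adf_def algebra_simps)
  then show ?case using Cons.IH[OF ab] by (simp del: adf_0) metis
qed (simp add: adf_def)

lemma W_0 [simp]: "(\<lambda>w. 0) \<in> W es"
  by (induction es) (auto intro: exI[of _ 0])

lemma W_Cons: "u \<in> W es \<Longrightarrow> u \<in> W (e # es)"
  by (auto intro: exI[of _ 0])

lemma W_mem: "e \<in> set es \<Longrightarrow> e \<in> W es"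
proof (induction es)
  case (Cons a es)
  have "adf a (- 1) a = (\<lambda>w. 0)" by (simp add: adf_def)
  then have "a \<in> W (a # es)" using W_0[of es] by (auto intro: exI[of _ "- 1"])
  then show ?case using Cons W_Cons by auto
qed simp

lemma W_adf_iff: "v \<in> W es \<Longrightarrow> adf u c v \<in> W es \<longleftrightarrow> u \<in> W es"
proof -
  assume v: "v \<in> W es"
  have "adf (adf u c v) (- c) v = u" by (simp add: adf_def)
  then show ?thesis using v W_adf by metis
qed

definition deg_vec :: "(vertex \<Rightarrow> vertex) \<Rightarrow> nat \<Rightarrow> nat \<Rightarrow> (vertex \<Rightarrow> letter) \<Rightarrow> bool" where
  "deg_vec x m k F \<longleftrightarrow> con m ((T x ^^ Suc k) F) 0 \<and> \<not> con m ((T x ^^ k) F) 0"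

fun chain :: "(vertex \<Rightarrow> vertex) \<Rightarrow> nat \<Rightarrow> (vertex \<Rightarrow> letter) list \<Rightarrow> bool" where
  "chain x m [] \<longleftrightarrow> True"
| "chain x m (e # es) \<longleftrightarrow> deg_vec x m (length es) e \<and> chain x m es"

lemma T_adf: "(T x ^^ k) (adf F c G) = adf ((T x ^^ k) F) c ((T x ^^ k) G)"
proof (induction k)
  case (Suc k)
  then show ?case by (simp add: fun_eq_iff) (simp add: T_def adf_def algebra_simps)
qed simp

lemma W_degree: assumes "odo x" shows "chain x m es \<Longrightarrow> v \<in> W es \<Longrightarrow> con m ((T x ^^ length es) v) 0"
proof (induction es arbitrary: v)
  case (Cons e es)
  then obtain c where c: "adf v c e \<in> W es" by auto
  have "con m ((T x ^^ Suc (length es)) (adf v c e)) 0"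
    by (rule con_T_mono[OF odo_Gam[OF assms] Cons.IH]) (use Cons c in auto)
  moreover have "con m ((T x ^^ Suc (length es)) e) 0" using Cons.prems by (simp add: deg_vec_def)
  ultimately show ?case unfolding T_adf by (simp add: con_def adf_def)
qed (simp add: con_def)

text \<open>Distinct degrees force all coefficients to vanish. Since \<open>con m\<close> looks only
  at level \<open>m\<close>, the labels on that level determine a vector of the span completely,
  including the value of \<open>Om\<close> stored at the root.\<close>

lemma W_independent: assumes "odo x"
  shows "chain x m es \<Longrightarrow> v \<in> W es \<Longrightarrow> con m v 0 \<Longrightarrow> v = (\<lambda>w. 0)"
proof (induction es arbitrary: v)
  case (Cons e es)
  then obtain c where c: "adf v c e \<in> W es" by auto
  have "con m ((T x ^^ length es) (adf v c e)) 0"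
    using W_degree[OF assms] Cons.prems c by simp
  moreover have "con m ((T x ^^ length es) v) 0"
    using con_T_mono[OF odo_Gam[OF assms], of m 0 v] Cons.prems by simp
  ultimately have *: "c * (T x ^^ length es) e w = 0" if "length w = m" for w
    using that unfolding T_adf by (simp add: con_def adf_def)
  have "c = 0"
  proof (rule ccontr)
    assume "c \<noteq> 0"
    then have "c * c = 1" by (cases c) (simp_all add: letter_simps)
    then have "(T x ^^ length es) e w = 0" if "length w = m" for w
      using *[OF that] by (metis mult.assoc mult_1 mult_zero_right)
    then show False using Cons.prems(1) by (simp add: deg_vec_def con_def)
  qed
  then show ?case using c Cons by simp
qed simp

lemma W_complete: assumes "odo x"
  shows "chain x m es \<Longrightarrow> con m ((T x ^^ length es) F) 0 \<Longrightarrow> \<exists>u\<in>W es. \<forall>w. length w = m \<longrightarrow> u w = F w"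
proof (induction es arbitrary: F)
  case (Cons e es)
  obtain a where a: "con m ((T x ^^ length es) F) a"
    using T_invariant_con[OF assms] Cons.prems(2) by auto
  obtain b where b: "con m ((T x ^^ length es) e) b"
    using T_invariant_con[OF assms] Cons.prems(1) by (auto simp: deg_vec_def)
  have "b \<noteq> 0" using b Cons.prems(1) by (auto simp: deg_vec_def)
  \<comment> \<open>A nonzero \<open>b\<close> is its own inverse, so the factor
    \<open>- a * b\<close> is \<open>- a / b\<close>.\<close>
  then have ab: "a + (- a * b) * b = 0"
    by (cases a; cases b) (simp_all add: letter_simps)
  have "con m ((T x ^^ length es) (adf F (- a * b) e)) 0"
    using a b ab unfolding T_adf by (simp add: con_def adf_def)
  then obtain u where u: "u \<in> W es" "\<forall>w. length w = m \<longrightarrow> u w = adf F (- a * b) e w"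
    using Cons by auto
  have e: "e \<in> W (e # es)" by (rule W_mem) simp
  show ?case
    by (rule bexI[OF _ W_adf[OF W_Cons[OF u(1)] e, of "a * b"]]) (use u(2) in \<open>simp add: adf_def\<close>)
qed (auto simp: con_def)

section \<open>Branching over the commutator subgroup\<close>

text \<open>The commutator subgroup, as the normal closure of the commutator of the two
  generators.\<close>

inductive_set KK :: "(vertex \<Rightarrow> vertex) set" where
  KK_base: "comm fg_b fg_a \<in> KK"
| KK_comp: "f \<in> KK \<Longrightarrow> g \<in> KK \<Longrightarrow> f \<circ> g \<in> KK"
| KK_inv: "f \<in> KK \<Longrightarrow> iv f \<in> KK"
| KK_conj: "f \<in> KK \<Longrightarrow> g \<in> Gam \<Longrightarrow> conj_by g f \<in> KK"

fun emb :: "letter \<Rightarrow> (vertex \<Rightarrow> vertex) \<Rightarrow> vertex \<Rightarrow> vertex" where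
  "emb i f [] = []"
| "emb i f (j # w) = j # (if j = i then f w else w)"

lemma KK_Gam: "f \<in> KK \<Longrightarrow> f \<in> Gam"
  by (induction rule: KK.induct) (simp_all del: o_apply)

lemma emb_comp: "emb i (f \<circ> g) = emb i f \<circ> emb i g"
proof
  show "emb i (f \<circ> g) w = (emb i f \<circ> emb i g) w" for w by (cases w) simp_all
qed

lemma iv_eq: "(\<And>w. f (g w) = w) \<Longrightarrow> (\<And>w. g (f w) = w) \<Longrightarrow> iv f = g"
  by (metis inv_equality)

lemma emb_inv: assumes "f \<in> Gam" shows "iv (emb i f) = emb i (iv f)"
proof (rule iv_eq)
  show "emb i f (emb i (iv f) w) = w" "emb i (iv f) (emb i f w) = w" for w
    by (cases w; use assms in simp)+
qed

lemma iv_Cons: assumes "g \<in> Gam" "al g = 0" shows "iv g (i # w) = i # iv (sec g i) w"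
proof -
  have "g (i # iv (sec g i) w) = i # w" using assms by (simp add: Gam_Cons)
  then show ?thesis using assms by (metis inv_cancel(1))
qed

lemma emb_conj: assumes "f \<in> Gam" "g \<in> Gam" "al g = 0" shows "conj_by g (emb i f) = emb i (conj_by (sec g i) f)"
proof
  show "conj_by g (emb i f) w = emb i (conj_by (sec g i) f) w" for w
    using assms by (cases w) (simp_all add: conj_by_def Gam_Cons[OF assms(2)] iv_Cons)
qed

lemma iv_fg: "iv fg_a = fg_a \<circ> fg_a" "iv fg_b = fg_b \<circ> fg_b"
  by (rule iv_eq; simp add: fg_cubed)+

lemma conj_emb_a: "conj_by fg_a (emb (i + 1) f) = emb i f"
proof
  show "conj_by fg_a (emb (i + 1) f) w = emb i f w" for w
    by (cases w) (simp_all add: conj_by_def fg_a_Cons iv_fg algebra_simps)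
qed

text \<open>At the letters \<open>0, 1, - 1\<close> the sections of \<open>b\<close> are
  \<open>a, 1, b\<close> and those of its conjugate by \<open>a\<close> are \<open>1, b, a\<close>.
  Their commutator therefore lives at \<open>- 1\<close> only. It is also a product of a conjugate
  of the inverse of \<open>?k\<close> with \<open>?k\<close>, so it lies in
  \<open>KK\<close>.\<close>

lemma emb_base: "emb (- 1) (comm fg_b fg_a) \<in> KK"
proof -
  let ?k = "comm fg_b fg_a" and ?c = "conj_by fg_a fg_b"
  have c: "?c = ?k \<circ> fg_b" by (simp add: fun_eq_iff comm_def conj_by_def)
  have c_Cons: "?c (i # w) = i # (if i = 0 then w else if i = 1 then fg_b w else fg_a w)" for i w
    using letter_cases[of i] by (auto simp: conj_by_def fg_a_Cons fg_b_Cons iv_fg)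
  have "iv ?c (i # w) = i # (if i = 0 then w else if i = 1 then iv fg_b w else iv fg_a w)" for i w
  proof -
    have "?c (i # (if i = 0 then w else if i = 1 then iv fg_b w else iv fg_a w)) = i # w"
      by (simp add: c_Cons)
    then show ?thesis by (metis conj_comm_Gam(1) fg_in_Gam inv_cancel(1))
  qed
  moreover have "iv fg_b (i # w) = i # (if i = 0 then iv fg_a w else if i = 1 then w else iv fg_b w)" for i w
    by (auto simp: iv_Cons)
  ultimately have "comm fg_b ?c (i # w) = emb (- 1) ?k (i # w)" for i w
    using letter_cases[of i] by (auto simp: comm_def fg_b_Cons c_Cons)
  then have "comm fg_b ?c w = emb (- 1) ?k w" for w
    by (cases w) simp_all
  moreover have "comm fg_b ?c = conj_by fg_b (iv ?k) \<circ> ?k"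
    unfolding c by (simp add: fun_eq_iff comm_def conj_by_def Gam_inv_comp)
  ultimately show ?thesis
    by (metis KK.intros fg_in_Gam ext)
qed

text \<open>\<open>b\<close> and its conjugate by \<open>a\<close> fix the first letter and have the
  sections \<open>b\<close> and \<open>a\<close> at \<open>- 1\<close>.\<close>

lemma exists_section: "h \<in> Gam \<Longrightarrow> \<exists>g\<in>Gam. al g = 0 \<and> sec g (- 1) = h"
proof (induction rule: Gam.induct)
  case Gam_id
  show ?case by (intro bexI[of _ id] Gam.Gam_id) (simp_all del: id_apply)
next
  case (Gam_a h)
  then obtain g where g: "g \<in> Gam" "al g = 0" "sec g (- 1) = h" by blast
  have c: "sec (conj_by fg_a fg_b) (- 1) = fg_a" "al (conj_by fg_a fg_b) = 0"
    by (simp_all add: conj_by_def sec_comp al_comp al_inv iv_fg)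
  show ?case
    by (rule bexI[of _ "conj_by fg_a fg_b \<circ> g"]) (use g c in \<open>simp_all add: sec_comp al_comp del: o_apply\<close>)
next
  case (Gam_b h)
  then obtain g where g: "g \<in> Gam" "al g = 0" "sec g (- 1) = h" by blast
  show ?case
    by (rule bexI[of _ "fg_b \<circ> g"]) (use g in \<open>simp_all add: sec_comp al_comp del: o_apply\<close>)
qed

text \<open>A conjugation inside the subtree at \<open>- 1\<close> is induced by conjugating with an
  element that has the required section there; conjugation by \<open>a\<close> reaches the other two
  subtrees.\<close>

lemma emb_KK: assumes "f \<in> KK" shows "emb i f \<in> KK"
proof -
  have 2: "emb (- 1) f \<in> KK" using assms
  proof (induction rule: KK.induct)
    case KK_base
    show ?case by (rule emb_base)
  next
    case (KK_comp f g)
    then show ?case unfolding emb_comp by (intro KK.KK_comp)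
  next
    case (KK_inv f)
    then show ?case using emb_inv[OF KK_Gam] by (metis KK.KK_inv)
  next
    case (KK_conj f g)
    then obtain h where "h \<in> Gam" "al h = 0" "sec h (- 1) = g" using exists_section by blast
    then show ?case using emb_conj[OF KK_Gam, of f h "- 1"] KK_conj by (metis KK.KK_conj)
  qed
  have 1: "emb 1 f \<in> KK" using KK_conj[OF 2 fg_in_Gam(1)] conj_emb_a[of 1 f] by simp
  have 0: "emb 0 f \<in> KK" using KK_conj[OF 1 fg_in_Gam(1)] conj_emb_a[of 0 f] by simp
  show ?thesis using 0 1 2 letter_cases[of i] by auto
qed

lemma emb_al_sec: "f \<in> Gam \<Longrightarrow> al (emb i f) = 0" "sec (emb i f) j = (if j = i then f else id)"
  by (auto simp: al_def sec_def fun_eq_iff)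

lemma sec_comm_0: assumes "f \<in> Gam" "g \<in> Gam" "al f = 0" "al g = 0"
  shows "sec (comm f g) i = comm (sec f i) (sec g i)"
proof
  show "sec (comm f g) i w = comm (sec f i) (sec g i) w" for w
    using assms by (simp add: sec_def[of "comm f g"]) (simp add: comm_def iv_Cons Gam_Cons[of f] Gam_Cons[of g])
qed

lemma comm_id [simp]: "g \<in> Gam \<Longrightarrow> comm id g = id" "g \<in> Gam \<Longrightarrow> comm g id = id"
  by (simp_all add: comm_def fun_eq_iff inv_id)

lemma id_Q: "id \<in> Q (Suc m)"
  by (simp add: Q_def del: id_apply)

lemma Om_id [simp]: "Om m id = 0"
  using Om_comp[OF id_Q id_Q, of m] by (simp del: id_apply)

lemma cl_id: "cl m id = (\<lambda>w. 0)"
  by (simp add: cl_def fun_eq_iff del: id_apply)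

lemma al_comm: "f \<in> Gam \<Longrightarrow> g \<in> Gam \<Longrightarrow> al (comm f g) = 0"
  by (simp add: comm_def al_comp al_inv)

text \<open>The degree of \<open>w\<close> is low enough for its labels to be realised in the span
  of a chain of length \<open>Suc (dd (Suc m))\<close>, while its commutator with
  \<open>fg_b\<close> has zero labels on the level of \<open>w\<close> but maximal degree on the
  next one.\<close>

lemma exists_witness: "\<exists>w\<in>KK. w \<in> Q (Suc m) \<and> (\<forall>x. odo x \<longrightarrow> dle x (Suc m) (Suc (dd (Suc m))) w) \<and>
  comm w fg_b \<in> st (Suc (Suc m)) \<and> Om m (comm w fg_b) \<noteq> 0"
proof (induction m)
  case 0
  let ?k = "comm fg_b fg_a"
  have st: "?k \<in> st (Suc 0)" by (simp add: st_Suc al_comm)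
  have Q: "?k \<in> Q (Suc 0)" using st by (simp add: Q_def comm_def be_comp be_inv)
  have "fg_b w = w" if "length w = Suc 0" for w
    using that by (auto simp: length_Suc_conv fg_b_Cons)
  then have "lab (comm ?k fg_b) w = 0" if "length w = Suc 0" for w
    using lab_comm[OF st fg_in_Gam(2) that] that by simp
  then have st2: "comm ?k fg_b \<in> st (Suc (Suc 0))"
    using st by (simp add: st_Suc_lab[of _ "Suc 0"])
  have "Om 0 (comm ?k fg_b) = - 1"
    unfolding Om_Psi[OF st2]
    by (simp add: comm_def Gam_inv_comp iv_fg sec_comp al_comp)
  then have "Om 0 (comm ?k fg_b) \<noteq> 0" by simp
  moreover have "dle x (Suc 0) (Suc (dd (Suc 0))) ?k" if "odo x" for x
    using dle_Q[OF that Q] by (simp add: numeral_2_eq_2)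
  ultimately show ?case using Q st2 KK_base by blast
next
  case (Suc m)
  then obtain w where w: "w \<in> KK" "w \<in> Q (Suc m)" "\<And>x. odo x \<Longrightarrow> dle x (Suc m) (Suc (dd (Suc m))) w"
    "comm w fg_b \<in> st (Suc (Suc m))" "Om m (comm w fg_b) \<noteq> 0" by blast
  \<comment> \<open>\<open>w\<close> at \<open>- 1\<close> alone could exceed the degree bound by
    one. Its inverse at \<open>1\<close> makes the leading coefficients \<open>0, - c, c\<close> sum
    to zero, and it disappears from the commutator with \<open>fg_b\<close>, whose section at
    \<open>1\<close> is trivial. The section of \<open>fg_b\<close> at \<open>- 1\<close> is
    \<open>fg_b\<close> again.\<close>
  define v where "v = emb 1 (iv w) \<circ> emb (- 1) w"
  have wG: "w \<in> Gam" and wst: "w \<in> st (Suc m)" using w by (auto simp: KK_Gam Q_st)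
  have v: "v \<in> KK" unfolding v_def using w(1) by (intro KK_comp emb_KK KK_inv)
  have vG: "v \<in> Gam" using KK_Gam[OF v] .
  have e: "emb 1 (iv w) \<in> Gam" "emb (- 1) w \<in> Gam"
    using w(1) KK_Gam emb_KK KK_inv by blast+
  have al: "al v = 0" using e wG by (simp add: v_def al_comp emb_al_sec)
  have s: "sec v i = (if i = 1 then iv w else if i = - 1 then w else id)" for i
    using e wG by (simp add: v_def sec_comp emb_al_sec)
  have "v \<in> st (Suc (Suc m))" unfolding st_Suc[of v] using vG al wst by (simp add: s del: id_apply)
  then have Q: "v \<in> Q (Suc (Suc m))" by (simp add: Q_def)
  have sc: "sec (comm v fg_b) i = (if i = - 1 then comm w fg_b else id)" for i
    using letter_cases[of i] vG al wG by (auto simp: sec_comm_0 s simp del: id_apply)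
  have "comm v fg_b \<in> st (Suc (Suc (Suc m)))"
    unfolding st_Suc[of "comm v fg_b"] using w(4) vG by (simp add: sc al_comm del: id_apply)
  moreover have "Om (Suc m) (comm v fg_b) \<noteq> 0" using w(5) by (simp add: sc del: id_apply)
  moreover have "dle x (Suc (Suc m)) (Suc (dd (Suc (Suc m)))) v" if x: "odo x" for x
  proof -
    define q where "q = dd (Suc m)"
    have "con (Suc m) (T (ret x 0) ((T (ret x 0) ^^ q) (lab w))) 0"
      using w(3)[OF ret_odo[OF x], of 0] unfolding dle_def q_def[symmetric] by simp
    then obtain c where c0: "con (Suc m) ((T (ret x 0) ^^ q) (lab w)) c"
      using T_invariant_con[OF ret_odo[OF x]] by blast
    have c: "con (Suc m) ((T (ret x i) ^^ q) (lab w)) c" for i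
      using con_T_invariant[OF ret_odo[OF x] ret_odo[OF x] Gam_id c0] by simp
    have inv: "lab (iv w) u = - lab w u" if "length u = Suc m" for u
      using lab_inv[OF wG, of u] st_app[of "iv w" "Suc m" u] wst that by simp
    have "con (Suc m) ((T (ret x i) ^^ q) (\<lambda>u. - lab w u)) (- c)" for i
      unfolding T_minus using c[of i] by (simp add: con_def)
    then have c': "con (Suc m) ((T (ret x i) ^^ q) (lab (iv w))) (- c)" for i
      by (simp only: con_cong[OF odo_Gam[OF ret_odo[OF x]] inv])
    have l0: "lab id = (\<lambda>u. 0)" by (rule ext) (rule lab_id)
    have z: "(T y ^^ n) (lab id) = (\<lambda>u. 0)" for y n
      unfolding l0 by (induction n) (simp_all add: T_def fun_eq_iff)
    define h :: "letter \<Rightarrow> letter" where "h i = (if i = 1 then - c else if i = - 1 then c else (0::letter))" for i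
    have "con (Suc (Suc m)) ((T x ^^ (2 + 3 * q)) (lab v)) 0"
    proof (rule con_T_combine[OF x, where h = h])
      show "con (Suc m) ((T (ret x i) ^^ q) (\<lambda>u. lab v (i # u))) (h i)" for i
        using c[of i] c'[of i] z by (auto simp: s h_def con_def simp del: id_apply)
      show "(D ^^ 2) h i = 0" for i by (simp add: numeral_2_eq_2 D_D h_def)
    qed
    then show ?thesis by (simp add: dle_def q_def)
  qed
  ultimately show ?case using v Q by blast
qed

section \<open>Producing an element of maximal degree on the next level\<close>

inductive_set Gen :: "(vertex \<Rightarrow> vertex) \<Rightarrow> (vertex \<Rightarrow> vertex) \<Rightarrow> (vertex \<Rightarrow> vertex) set" for x s where
  Gen_id: "id \<in> Gen x s"
| Gen_x: "x \<in> Gen x s"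
| Gen_s: "s \<in> Gen x s"
| Gen_comp: "f \<in> Gen x s \<Longrightarrow> g \<in> Gen x s \<Longrightarrow> f \<circ> g \<in> Gen x s"
| Gen_inv: "f \<in> Gen x s \<Longrightarrow> iv f \<in> Gen x s"

lemma conj_by_comp: "g \<in> Gam \<Longrightarrow> conj_by g (f \<circ> h) = conj_by g f \<circ> conj_by g h"
  by (simp add: conj_by_def fun_eq_iff)

lemma conj_by_conj: "f \<in> Gam \<Longrightarrow> g \<in> Gam \<Longrightarrow> conj_by (f \<circ> g) h = conj_by g (conj_by f h)"
  by (simp add: conj_by_def fun_eq_iff Gam_inv_comp)

lemma cl_comp2: assumes "f \<in> Q (Suc m)" "g \<in> Q (Suc m)"
  shows "cl m (f \<circ> g \<circ> g) = adf (cl m f) (- 1) (cl m g)"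
proof -
  have "a + b + b = a + (- 1) * b" for a b :: letter
    using letter_double[of b] by (simp add: add.assoc)
  then show ?thesis using assms by (simp add: cl_comp Q_comp) (simp add: adf_def)
qed

lemma cl_adf: assumes "f \<in> Q (Suc m)" "g \<in> Q (Suc m)"
  shows "\<exists>h\<in>Q (Suc m). cl m h = adf (cl m f) c (cl m g)"
proof -
  consider "c = 0" | "c = 1" | "c = - 1" using letter_cases by blast
  then show ?thesis
  proof cases
    case 1
    then show ?thesis using assms by auto
  next
    case 2
    then show ?thesis using assms by (intro bexI[of _ "f \<circ> g"]) (simp_all only: cl_comp Q_comp)
  next
    case 3
    then show ?thesis using assms by (intro bexI[of _ "f \<circ> g \<circ> g"]) (simp_all only: cl_comp2 Q_comp)
  qed
qed

lemma W_realized: "\<forall>e\<in>set es. e \<in> Q (Suc m) \<Longrightarrow> v \<in> W (map (cl m) es) \<Longrightarrow> \<exists>z\<in>Q (Suc m). cl m z = v"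
proof (induction es arbitrary: v)
  case Nil
  then show ?case using cl_id id_Q by auto
next
  case (Cons e es)
  then obtain c where "adf v c (cl m e) \<in> W (map (cl m) es)" by auto
  then obtain z where z: "z \<in> Q (Suc m)" "cl m z = adf v c (cl m e)" using Cons by auto
  have "adf (adf v c (cl m e)) (- c) (cl m e) = v" by (simp add: adf_def)
  then show ?case using cl_adf[OF z(1), of e "- c"] Cons.prems(1) z(2) by simp
qed

text \<open>The kernel of \<open>cl m\<close> is normal (\<open>cl_conj_0\<close>), so conjugation
  acts linearly on classes and it is enough to know its effect on a spanning list.\<close>

lemma conj_span:
  assumes "g \<in> Gam"
  shows "\<forall>e\<in>set es. e \<in> Q (Suc m) \<and> cl m (conj_by g e) \<in> W ds \<Longrightarrow>
    h \<in> Q (Suc m) \<Longrightarrow> cl m h \<in> W (map (cl m) es) \<Longrightarrow> cl m (conj_by g h) \<in> W ds"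
proof (induction es arbitrary: h)
  case Nil
  then show ?case using cl_conj_0[of h m g] assms by simp
next
  case (Cons e es)
  have e: "e \<in> Q (Suc m)" "cl m (conj_by g e) \<in> W ds" using Cons.prems(1) by auto
  obtain c where c: "adf (cl m h) c (cl m e) \<in> W (map (cl m) es)" using Cons.prems(3) by auto
  have Qc: "conj_by g h \<in> Q (Suc m)" "conj_by g e \<in> Q (Suc m)" "h \<circ> e \<in> Q (Suc m)" "h \<circ> e \<circ> e \<in> Q (Suc m)"
    using e Cons.prems(2) assms by (simp_all add: Q_conj Q_comp)
  consider "c = 0" | "c = 1" | "c = - 1" using letter_cases by blast
  then show ?case
  proof cases
    case 1
    then show ?thesis using c Cons by simp
  next
    case 2
    then have "cl m (conj_by g (h \<circ> e)) \<in> W ds"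
      using c Cons.IH[OF _ Qc(3)] Cons.prems e by (simp add: cl_comp del: o_apply)
    then show ?thesis using e Qc by (simp add: conj_by_comp assms cl_comp W_adf_iff)
  next
    case 3
    then have "cl m (conj_by g (h \<circ> e \<circ> e)) \<in> W ds"
      using c Cons.IH[OF _ Qc(4)] Cons.prems e by (simp add: cl_comp2 del: o_apply)
    then show ?thesis using e Qc by (simp add: conj_by_comp assms cl_comp2 W_adf_iff)
  qed
qed

text \<open>The power of \<open>g\<close> with exponent \<open>3 ^ M\<close> lies in
  \<open>st M\<close>, which contains inverses; from there the inverse of \<open>q\<close> is
  obtained from that of its cube as \<open>q * q * (q ^ 3) ^ (- 1)\<close>.\<close>

lemma inverse_closed:
  assumes N: "N \<subseteq> Gam" "st M \<subseteq> N" "\<And>f g. f \<in> N \<Longrightarrow> g \<in> N \<Longrightarrow> f \<circ> g \<in> N" and g: "g \<in> N"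
  shows "iv g \<in> N"
proof -
  have p: "pw g k \<in> N" for k
    by (induction k) (simp_all add: g pw_Suc cube_def N(3) del: o_apply)
  have "iv (pw g (M - k)) \<in> N" if "k \<le> M" for k
    using that
  proof (induction k)
    case 0
    then show ?case using pw_st[of g M] g N by (metis diff_zero st_inv subsetD)
  next
    case (Suc k)
    define q where "q = pw g (M - Suc k)"
    have q: "pw g (M - k) = cube q" using Suc.prems by (simp add: q_def Suc_diff_Suc flip: pw_Suc)
    have "q \<in> N" using p by (simp add: q_def)
    moreover have "iv q = q \<circ> (q \<circ> iv (cube q))"
      using \<open>q \<in> N\<close> N(1) by (auto simp: cube_def Gam_inv_comp subset_iff fun_eq_iff)
    moreover have "iv (cube q) \<in> N" using Suc q by simp
    ultimately show ?case using N(3) by (metis q_def)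
  qed
  from this[of M] show ?thesis by simp
qed

lemma comm_eq_conj': assumes "f \<in> Q (Suc m)" "g \<in> Gam" "cl m f \<in> W ds"
  shows "cl m (comm f g) \<in> W ds \<longleftrightarrow> cl m (conj_by g f) \<in> W ds"
proof -
  have "conj_by g f = comm f g \<circ> f" using assms(1) by (simp add: comm_def conj_by_def fun_eq_iff Q_Gam)
  then have "cl m (conj_by g f) = adf (cl m (comm f g)) 1 (cl m f)"
    using assms by (simp add: cl_comp Q_comm)
  then show ?thesis using W_adf_iff[OF assms(3)] by simp
qed

text \<open>Otherwise the span of the classes of \<open>es\<close> would be invariant under conjugation by \<open>x\<close> and \<open>s\<close>, hence
  by the whole group. As it contains the labels of the witness \<open>w\<close> from the branching structure, it would
  also contain the class of \<open>comm w fg_b\<close>, which is nonzero but has zero labels.\<close>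

theorem exists_residue:
  assumes x: "odo x" and s: "s \<in> Gam" and es: "\<forall>e\<in>set es. e \<in> Q (Suc m)"
    and ch: "chain x (Suc m) (map (cl m) es)" and len: "length es = Suc (dd (Suc m))"
    and surj: "\<And>g. g \<in> Gam \<Longrightarrow> \<exists>z\<in>Gen x s. g \<circ> z \<in> st (Suc (Suc m))"
  shows "\<exists>e\<in>set es. \<exists>t\<in>{x, s}. cl m (comm e t) \<notin> W (map (cl m) es)"
proof (rule ccontr)
  let ?W = "W (map (cl m) es)"
  assume "\<not> ?thesis"
  then have c: "cl m (comm e t) \<in> ?W" if "e \<in> set es" "t \<in> {x, s}" for e t using that by blast
  define N where "N = {g \<in> Gam. \<forall>h\<in>Q (Suc m). cl m h \<in> ?W \<longrightarrow> cl m (conj_by g h) \<in> ?W}"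
  have N_comp: "f \<circ> g \<in> N" if "f \<in> N" "g \<in> N" for f g
    using that by (simp add: N_def conj_by_conj Q_conj)
  have N_st: "st (Suc (Suc m)) \<subseteq> N"
  proof
    fix k assume k: "k \<in> st (Suc (Suc m))"
    \<comment> \<open>\<open>k\<close> has a class itself, so conjugation by it adds and subtracts
      this class.\<close>
    have kQ: "k \<in> Q (Suc m)" using st_Suc_Q[OF k] .
    have "cl m (conj_by k h) = cl m h" if "h \<in> Q (Suc m)" for h
    proof -
      have "adf (adf (cl m (iv k)) 1 (cl m h)) 1 (cl m k) = adf (cl m h) 1 (adf (cl m (iv k)) 1 (cl m k))"
        by (simp add: adf_def algebra_simps)
      moreover have "adf (cl m (iv k)) 1 (cl m k) = (\<lambda>w. 0)"
        using cl_comp[OF Q_inv[OF kQ] kQ] k by (simp add: cl_id st_Gam)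
      ultimately show ?thesis
        using that kQ by (simp add: conj_by_def cl_comp Q_comp Q_inv) (simp add: adf_def)
    qed
    then show "k \<in> N" using k by (simp add: N_def st_Gam)
  qed
  have N_gen: "t \<in> N" if t: "t \<in> {x, s}" for t
  proof -
    have tG: "t \<in> Gam" using t s x by (auto simp: odo_def)
    have "cl m (conj_by t e) \<in> ?W" if "e \<in> set es" for e
      using comm_eq_conj'[of e m t] c[OF that t] es that tG W_mem[of "cl m e" "map (cl m) es"] by auto
    then show ?thesis unfolding N_def using tG es conj_span[OF tG, of es m "map (cl m) es"] by blast
  qed
  have N_sub: "N \<subseteq> Gam" by (auto simp: N_def)
  have "Gen x s \<subseteq> N"
  proof
    show "f \<in> N" if "f \<in> Gen x s" for f
      using that
    proof (induction rule: Gen.induct)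
      case Gen_id
      show ?case using N_st st_id by blast
    next
      case (Gen_inv f)
      then show ?case using inverse_closed[OF N_sub N_st N_comp] by blast
    qed (use N_gen N_comp in \<open>simp_all del: o_apply\<close>)
  qed
  \<comment> \<open>\<open>fg_b\<close> is the product of an element of
    \<open>st (Suc (Suc m))\<close> with the inverse of \<open>z\<close>, and both factors lie in
    \<open>N\<close>.\<close>
  moreover obtain z where z: "z \<in> Gen x s" "fg_b \<circ> z \<in> st (Suc (Suc m))"
    using surj[of fg_b] by auto
  ultimately have "z \<in> N" by blast
  then have "iv z \<in> N" "z \<in> Gam" using inverse_closed[OF N_sub N_st N_comp] N_sub by auto
  then have "fg_b \<circ> z \<circ> iv z \<in> N" using z(2) N_st N_comp by blast
  moreover have "fg_b \<circ> z \<circ> iv z = fg_b" using \<open>z \<in> Gam\<close> by (simp add: fun_eq_iff)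
  ultimately have bN: "fg_b \<in> N" by simp
  obtain w where w: "w \<in> Q (Suc m)" "dle x (Suc m) (Suc (dd (Suc m))) w"
    "comm w fg_b \<in> st (Suc (Suc m))" "Om m (comm w fg_b) \<noteq> 0" using exists_witness[of m] x by blast
  obtain u where u: "u \<in> ?W" "\<forall>v. length v = Suc m \<longrightarrow> u v = lab w v"
    using W_complete[OF x ch, of "lab w"] w(2) len by (auto simp: dle_def)
  obtain y where y: "y \<in> Q (Suc m)" "cl m y = u" using W_realized[OF es u(1)] by blast
  \<comment> \<open>\<open>y\<close> has the labels of \<open>w\<close> and a class in the span. The
    quotient \<open>k\<close> has zero labels, so its commutators have class zero, and
    \<open>w\<close> may be replaced by \<open>y\<close> in the class of the commutator with
    \<open>fg_b\<close>.\<close>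
  define k where "k = iv y \<circ> w"
  have kQ: "k \<in> Q (Suc m)" using y w by (simp add: k_def Q_comp Q_inv)
  have wk: "w = y \<circ> k" using y(1) by (simp add: k_def fun_eq_iff Q_Gam)
  have "lab k v = 0" if "length v = Suc m" for v
  proof -
    have "k v = v" using kQ Q_st st_app that by (metis order_refl)
    moreover have "cl m y v = lab w v" using u(2) y(2) that by simp
    then have "lab y v = lab w v" using that by (cases v) (simp_all add: cl_def del: lab.simps)
    ultimately show ?thesis using lab_comp[of y k v] wk y(1) kQ by (simp add: Q_Gam)
  qed
  then have "k \<in> st (Suc (Suc m))" using kQ by (simp add: st_Suc_lab[of k "Suc m"] Q_st)
  then have ck: "cl m (comm k fg_b) = (\<lambda>w. 0)" by (rule cl_comm_st) simp
  have yc: "cl m (comm y fg_b) \<in> ?W"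
    using bN y u(1) comm_eq_conj'[of y m fg_b] by (simp add: N_def)
  have "comm w fg_b = conj_by fg_b y \<circ> comm k fg_b \<circ> iv y"
    using y(1) kQ unfolding wk by (simp add: comm_def conj_by_def Gam_inv_comp Q_Gam fun_eq_iff)
  moreover have "cl m (conj_by fg_b y \<circ> comm k fg_b \<circ> iv y) = cl m (conj_by fg_b y \<circ> iv y)"
    using y(1) kQ by (simp add: cl_comp Q_comp Q_conj Q_comm Q_inv ck) (simp add: adf_def)
  ultimately have "cl m (comm w fg_b) \<in> ?W" using yc by (simp add: comm_eq_conj)
  then have "cl m (comm w fg_b) = (\<lambda>w. 0)"
    by (rule W_independent[OF x ch]) (use w(3) in \<open>auto simp: con_def cl_def st_def\<close>)
  then have "cl m (comm w fg_b) [] = 0" by simp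
  then show False using w(4) by (simp add: cl_def)
qed

section \<open>The algorithm on elements that carry words\<close>

text \<open>An element comes with two trees: a word for it and a word for its inverse.\<close>

datatype elt = Elt (ef: "vertex \<Rightarrow> vertex") (wt: val) (iw: val)

text \<open>A node for concatenation, built in constant time. Words remain shared trees until
  \<open>flat\<close> lists them at the end, so long words do not slow down the group operations. A
  leaf is \<open>Pr Nul p\<close>, the empty word is \<open>Nul\<close>.\<close>

definition nd :: "val \<Rightarrow> val \<Rightarrow> val" where
  "nd t v = Pr (Pr t v) Nul"

definition tmul :: "elt \<Rightarrow> elt \<Rightarrow> elt" where
  "tmul A B = Elt (ef A \<circ> ef B) (nd (wt A) (wt B)) (nd (iw B) (iw A))"

definition tinv :: "elt \<Rightarrow> elt" where
  "tinv A = Elt (iv (ef A)) (iw A) (wt A)"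

definition tcm :: "elt \<Rightarrow> elt \<Rightarrow> elt" where
  "tcm H X = tmul (tmul (tmul (tinv X) H) X) (tinv H)"

text \<open>For \<open>h\<close> and \<open>e\<close> in \<open>st m\<close> this compares their degrees, by group operations alone.\<close>

definition dless :: "(vertex \<Rightarrow> vertex) \<Rightarrow> nat \<Rightarrow> (vertex \<Rightarrow> vertex) \<Rightarrow> (vertex \<Rightarrow> vertex) \<Rightarrow> bool" where
  "dless x m h e \<longleftrightarrow> (\<exists>k. ((\<lambda>f. comm f x) ^^ k) h \<in> st (Suc m) \<and> ((\<lambda>f. comm f x) ^^ k) e \<notin> st (Suc m))"

text \<open>The final \<open>H\<close> is the answer when \<open>E\<close> lies in
  \<open>st (Suc m)\<close>, for which all three tests fail. That such an \<open>E\<close> is never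
  multiplied in is essential for \<open>tsift_class\<close>.\<close>

definition tpick :: "elt \<Rightarrow> nat \<Rightarrow> elt \<Rightarrow> elt \<Rightarrow> elt" where
  "tpick x m H E =
    (if dless (ef x) m (ef H) (ef E) then H
     else if dless (ef x) m (ef (tmul H E)) (ef E) then tmul H E
     else if dless (ef x) m (ef (tmul (tmul H E) E)) (ef E) then tmul (tmul H E) E
     else H)"

fun tsift :: "elt \<Rightarrow> nat \<Rightarrow> elt \<Rightarrow> elt list \<Rightarrow> elt" where
  "tsift x m H [] = H"
| "tsift x m H (E # es) = tsift x m (tpick x m H E) es"

text \<open>Each power of \<open>x\<close> is used zero, one or two times, as a ternary digit. With
  the powers in descending order, as \<open>tpl\<close> lists them, entry number \<open>i\<close>
  has lost \<open>i\<close> degrees, as far as degrees are left.\<close>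

fun texp :: "elt \<Rightarrow> elt list \<Rightarrow> elt list \<Rightarrow> elt list" where
  "texp y [] acc = y # acc"
| "texp y (X # Xs) acc = texp y Xs (texp (tcm y X) Xs (texp (tcm (tcm y X) X) Xs acc))"

fun tpl :: "elt \<Rightarrow> nat \<Rightarrow> elt list \<Rightarrow> elt list" where
  "tpl x 0 acc = acc"
| "tpl x (Suc m) acc = tpl (tmul (tmul x x) x) m (x # acc)"

definition tbb :: "elt \<Rightarrow> nat \<Rightarrow> elt \<Rightarrow> elt \<Rightarrow> elt" where
  "tbb x m c r = (if dless (ef x) m (ef c) (ef r) then r else c)"

fun tbst :: "elt \<Rightarrow> elt \<Rightarrow> nat \<Rightarrow> elt list \<Rightarrow> elt \<Rightarrow> elt list \<Rightarrow> elt" where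
  "tbst x s m Y c [] = c"
| "tbst x s m Y c (e # es) =
    tbst x s m Y (tbb x (Suc m) (tbb x (Suc m) c (tsift x m (tcm e x) Y)) (tsift x m (tcm e s) Y)) es"

definition tY :: "elt \<Rightarrow> elt \<Rightarrow> nat \<Rightarrow> elt list" where
  "tY x s m = texp (tcm s (hd (tpl x m []))) (tpl x m []) []"

text \<open>From level 2 on this depends on \<open>x\<close> and \<open>s\<close> only, not on
  \<open>tu\<close> of a lower level. The product of \<open>x\<close> and its inverse is a trivial
  starting value for the search of a residue of greatest degree.\<close>

fun tu :: "elt \<Rightarrow> elt \<Rightarrow> nat \<Rightarrow> elt" where
  "tu x s 0 = x"
| "tu x s (Suc 0) = s"
| "tu x s (Suc (Suc m)) = tbst x s (Suc m) (tY x s (Suc m)) (tmul x (tinv x)) (tY x s (Suc m))"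

definition ttab :: "elt \<Rightarrow> elt \<Rightarrow> nat \<Rightarrow> elt list" where
  "ttab x s m = texp (tu x s m) (tpl x m []) []"

fun tloop :: "elt \<Rightarrow> elt \<Rightarrow> nat \<Rightarrow> nat \<Rightarrow> elt \<Rightarrow> elt" where
  "tloop x s 0 m g = g"
| "tloop x s (Suc k) m g = tloop x s k (Suc m) (tsift x m g (ttab x s m))"

lemma ef_tmul [simp]: "ef (tmul A B) = ef A \<circ> ef B"
  by (simp add: tmul_def)

lemma ef_tinv [simp]: "ef (tinv A) = iv (ef A)"
  by (simp add: tinv_def)

lemma ef_tcm [simp]: "ef (tcm A B) = comm (ef A) (ef B)"
  by (simp add: tcm_def comm_def)

lemma tpick_cases: "tpick x m H E \<in> {H, tmul H E, tmul (tmul H E) E}"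
  by (simp add: tpick_def)

lemma tsift_closed:
  assumes "R H" "\<forall>e\<in>set es. P e" "\<And>H e. R H \<Longrightarrow> P e \<Longrightarrow> R (tmul H e)"
  shows "R (tsift x m H es)"
  using assms(1,2)
proof (induction es arbitrary: H)
  case (Cons e es)
  have "R (tmul H e)" "R (tmul (tmul H e) e)" using Cons.prems assms(3) by simp_all
  then have "R (tpick x m H e)" using tpick_cases[of x m H e] Cons.prems by auto
  then show ?case using Cons by simp
qed simp

lemma texp_closed:
  assumes "\<And>h X. P h \<Longrightarrow> R X \<Longrightarrow> P (tcm h X)"
  shows "P y \<Longrightarrow> \<forall>X\<in>set Xs. R X \<Longrightarrow> \<forall>e\<in>set acc. P e \<Longrightarrow> \<forall>e\<in>set (texp y Xs acc). P e"
proof (induction Xs arbitrary: y acc)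
  case (Cons X Xs)
  have p: "P (tcm y X)" "P (tcm (tcm y X) X)" and R: "\<forall>X\<in>set Xs. R X" using Cons.prems assms by simp_all
  show ?case unfolding texp.simps by (intro Cons.IH R Cons.prems(1,3) p)
qed simp

lemma tpl_closed:
  assumes "\<And>a b. P a \<Longrightarrow> P b \<Longrightarrow> P (tmul a b)"
  shows "P x \<Longrightarrow> \<forall>e\<in>set acc. P e \<Longrightarrow> \<forall>e\<in>set (tpl x m acc). P e"
proof (induction m arbitrary: x acc)
  case (Suc m)
  have p: "P (tmul (tmul x x) x)" using Suc.prems assms by blast
  have "\<forall>e\<in>set (x # acc). P e" using Suc.prems by simp
  then show ?case unfolding tpl.simps by (rule Suc.IH[OF p])
qed simp

lemma length_tpl [simp]: "length (tpl x m acc) = m + length acc"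
  by (induction m arbitrary: x acc) simp_all

lemma map_ef_tpl: "map ef (tpl x m acc) = rev (map (pw (ef x)) [0..<m]) @ map ef acc"
proof (induction m arbitrary: x acc)
  case (Suc m)
  have "map (pw (cube f)) [0..<m] = map (pw f) (map Suc [0..<m])" for f
    by (simp add: pw_Suc_right)
  then have "pw f 0 # map (pw (cube f)) [0..<m] = map (pw f) [0..<Suc m]" for f
    by (simp only: map_Suc_upt list.map flip: upt_conv_Cons[of 0 "Suc m"]) (simp add: upt_conv_Cons del: upt_Suc)
  from this[of "ef x", symmetric] show ?case using Suc by (simp add: cube_def del: upt_Suc o_apply)
qed simp

definition op_closed :: "(elt \<Rightarrow> bool) \<Rightarrow> bool" where
  "op_closed P \<longleftrightarrow> (\<forall>A B. P A \<longrightarrow> P B \<longrightarrow> P (tmul A B)) \<and> (\<forall>A. P A \<longrightarrow> P (tinv A))"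

lemma op_closedD: "op_closed P \<Longrightarrow> P A \<Longrightarrow> P B \<Longrightarrow> P (tmul A B)" "op_closed P \<Longrightarrow> P A \<Longrightarrow> P (tinv A)"
  "op_closed P \<Longrightarrow> P A \<Longrightarrow> P B \<Longrightarrow> P (tcm A B)"
  by (auto simp: op_closed_def tcm_def)

lemma tY_closed: assumes "op_closed P" "P x" "P s" "m > 0" shows "\<forall>e\<in>set (tY x s m). P e"
proof -
  note c = op_closedD[OF assms(1)]
  have p: "\<forall>e\<in>set (tpl x m []). P e" by (rule tpl_closed) (use assms c in auto)
  moreover have "hd (tpl x m []) \<in> set (tpl x m [])" using assms(4) by (intro hd_in_set) (metis length_greater_0_conv length_tpl add_gr_0)
  ultimately have q: "P (tcm s (hd (tpl x m [])))" using assms(3) c by blast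
  show ?thesis unfolding tY_def by (rule texp_closed[where P = P and R = P, OF c(3) q p]) simp_all
qed

lemma tbst_closed: assumes "op_closed P" "P x" "P s" "\<forall>e\<in>set Y. P e"
  shows "P c \<Longrightarrow> \<forall>e\<in>set es. P e \<Longrightarrow> P (tbst x s m Y c es)"
proof (induction es arbitrary: c)
  case (Cons e es)
  note c = op_closedD[OF assms(1)]
  have t: "P (tsift x m (tcm e t) Y)" if "P t" for t
    by (rule tsift_closed[where P = P]) (use Cons.prems assms that c in auto)
  have b: "P (tbb x k a b)" if "P a" "P b" for k a b using that by (simp add: tbb_def)
  show ?case using Cons assms t b by simp
qed simp

lemma tu_closed: assumes "op_closed P" "P x" "P s" shows "P (tu x s m)"
proof (cases "(x, s, m)" rule: tu.cases)
  case (3 x' s' k)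
  have Y: "\<forall>e\<in>set (tY x s (Suc k)). P e" using assms by (intro tY_closed) simp_all
  have "P (tbst x s (Suc k) (tY x s (Suc k)) (tmul x (tinv x)) (tY x s (Suc k)))"
    by (rule tbst_closed[OF assms Y]) (use Y op_closedD[OF assms(1)] assms in auto)
  then show ?thesis using 3 by simp
qed (use assms in auto)

lemma ttab_closed: assumes "op_closed P" "P x" "P s" shows "\<forall>e\<in>set (ttab x s m). P e"
proof -
  note c = op_closedD[OF assms(1)]
  have p: "\<forall>e\<in>set (tpl x m []). P e" by (rule tpl_closed) (use assms c in auto)
  show ?thesis unfolding ttab_def by (rule texp_closed[where P = P and R = P, OF c(3) tu_closed[OF assms] p]) simp_all
qed

lemma Gen_closed: "op_closed (\<lambda>A. ef A \<in> Gen x s)"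
  by (simp add: op_closed_def Gen_comp Gen_inv del: o_apply)

lemma Gam_closed: "op_closed (\<lambda>A. ef A \<in> Gam)"
  by (simp add: op_closed_def del: o_apply)

section \<open>Correctness of the algorithm\<close>

text \<open>Commutation with \<open>x\<close> acts on the labels as \<open>T x\<close>, so the
  \<open>k\<close>-th iterated commutator is trivial on the next level exactly when \<open>k\<close>
  differences annihilate the labels.\<close>

lemma dless_iff: assumes "x \<in> Gam" "h \<in> st m" "e \<in> st m"
  shows "dless x m h e \<longleftrightarrow> (\<exists>k. dle x m k h \<and> \<not> dle x m k e)"
proof -
  have i: "((\<lambda>f. comm f x) ^^ k) f \<in> st m \<and> (((\<lambda>f. comm f x) ^^ k) f \<in> st (Suc m) \<longleftrightarrow> dle x m k f)"
    if "f \<in> st m" for f k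
    using that
  proof (induction k arbitrary: f)
    case 0
    then show ?case by (simp add: dle_0)
  next
    case (Suc k)
    have "comm f x \<in> st m" using Suc.prems assms by simp
    then show ?case using Suc.IH[of "comm f x"] dle_comm_pw[OF assms(1) Suc.prems, of k 0]
      by (simp only: funpow_Suc_right o_apply) simp
  qed
  show ?thesis using i[OF assms(2)] i[OF assms(3)] by (simp add: dless_def)
qed

definition exact :: "(vertex \<Rightarrow> vertex) \<Rightarrow> nat \<Rightarrow> nat \<Rightarrow> (vertex \<Rightarrow> vertex) \<Rightarrow> bool" where
  "exact x m d f \<longleftrightarrow> f \<in> st m \<and> dle x m d f \<and> (\<forall>k<d. \<not> dle x m k f)"

text \<open>Truncated subtraction is intended: when \<open>N\<close> exceeds \<open>d\<close>, the
  list ends in zeros, which stand for elements of \<open>st (Suc m)\<close>.\<close>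

definition degs :: "nat \<Rightarrow> nat \<Rightarrow> nat list" where
  "degs d N = map (\<lambda>i. d - i) [0..<N]"

lemma degs_add: "degs d (M + N) = degs d M @ degs (d - M) N"
  by (induction N) (simp_all add: degs_def)

lemma degs_0 [simp]: "degs d 0 = []"
  by (simp add: degs_def)

lemma degs_Suc: "degs d (Suc N) = d # degs (d - 1) N"
  using degs_add[of d 1 N] by (simp add: degs_def)

lemma exact_comm_pw: assumes "odo x" "exact x m d f" shows "exact x m (d - 3 ^ j) (comm f (pw x j))"
proof -
  have f: "f \<in> st m" "dle x m d f" "\<And>k. k < d \<Longrightarrow> \<not> dle x m k f" using assms(2) by (auto simp: exact_def)
  have "dle x m (d - 3 ^ j + 3 ^ j) f" using dle_mono[OF assms(1) f(2)] by simp
  then show ?thesis using f odo_Gam[OF assms(1)] by (simp add: exact_def dle_comm_pw less_diff_conv)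
qed

lemma texp_exact: assumes x: "odo x"
  shows "map ef Xs = rev (map (pw x) [0..<k]) \<Longrightarrow> exact x m d (ef y) \<Longrightarrow> list_all2 (\<lambda>d e. exact x m d (ef e)) ds acc \<Longrightarrow>
    list_all2 (\<lambda>d e. exact x m d (ef e)) (degs d (3 ^ k) @ ds) (texp y Xs acc)"
proof (induction k arbitrary: y d Xs acc ds)
  case 0
  then show ?case by (simp add: degs_Suc)
next
  case (Suc k)
  then obtain X Xs' where Xs: "Xs = X # Xs'" "ef X = pw x k" "map ef Xs' = rev (map (pw x) [0..<k])"
    by (auto simp: map_eq_Cons_conv)
  have e1: "exact x m (d - 3 ^ k) (ef (tcm y X))" using exact_comm_pw[OF x Suc.prems(2), of k] Xs by simp
  have e2: "exact x m (d - 3 ^ k - 3 ^ k) (ef (tcm (tcm y X) X))" using exact_comm_pw[OF x e1, of k] Xs by simp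
  have three: "3 ^ Suc k = 3 ^ k + (3 ^ k + 3 ^ k :: nat)" by simp
  have d: "degs d (3 ^ Suc k) @ ds = degs d (3 ^ k) @ (degs (d - 3 ^ k) (3 ^ k) @ (degs (d - 3 ^ k - 3 ^ k) (3 ^ k) @ ds))"
    by (simp only: three degs_add append_assoc)
  show ?case unfolding d Xs(1) texp.simps
    by (intro Suc.IH Xs(3) Suc.prems e1 e2)
qed

lemma dless_exact: assumes x: "odo x" and h: "h \<in> st m" and e: "exact x m (Suc d) e" shows "dless x m h e \<longleftrightarrow> dle x m d h"
proof -
  have "dle x m (Suc d) e" "\<And>k. k < Suc d \<Longrightarrow> \<not> dle x m k e" using e by (auto simp: exact_def)
  then have "\<not> dle x m k e \<longleftrightarrow> k \<le> d" for k
    using dle_mono[OF x, of m "Suc d" e k] by (metis less_Suc_eq_le not_less_eq_eq)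
  then show ?thesis
    using dless_iff[OF odo_Gam[OF x] h, of e] e dle_mono[OF x, of m _ h d] by (auto simp: exact_def)
qed

lemma dless_exact_0: assumes "x \<in> Gam" "h \<in> st m" "exact x m 0 e" shows "\<not> dless x m h e"
proof -
  have e: "e \<in> st (Suc m)" using assms(3) dle_0[of e m x] by (auto simp: exact_def)
  have "((\<lambda>f. comm f x) ^^ k) e \<in> st (Suc m)" for k
    by (induction k) (simp_all add: e assms(1))
  then show ?thesis by (simp add: dless_def)
qed

lemma tpick_st: assumes "ef H \<in> st m" "ef E \<in> st m" shows "ef (tpick x m H E) \<in> st m"
  using assms tpick_cases[of x m H E] by (auto simp del: o_apply)

text \<open>Each table entry takes off one degree, and \<open>d \<le> N\<close> ensures that the
  table does not end before degree zero.\<close>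

lemma tsift_reduces: assumes x: "odo (ef x)"
  shows "ef H \<in> st m \<Longrightarrow> dle (ef x) m d (ef H) \<Longrightarrow> d \<le> N \<Longrightarrow>
    list_all2 (\<lambda>d e. exact (ef x) m d (ef e)) (degs d N) es \<Longrightarrow> ef (tsift x m H es) \<in> st (Suc m)"
proof (induction es arbitrary: H d N)
  case Nil
  then have "N = 0" by (simp add: degs_def)
  then show ?case using Nil by (simp add: dle_0)
next
  case (Cons e es)
  then obtain N' where N: "N = Suc N'" by (cases N) auto
  have e: "exact (ef x) m d (ef e)" and es: "list_all2 (\<lambda>d e. exact (ef x) m d (ef e)) (degs (d - 1) N') es"
    using Cons.prems(4) by (auto simp: N degs_Suc)
  have est: "ef e \<in> st m" using e by (simp add: exact_def)
  have "dle (ef x) m (d - 1) (ef (tpick x m H e))"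
  proof (cases d)
    case 0
    have "tpick x m H e = H"
      unfolding tpick_def using e 0 Cons.prems(1) est odo_Gam[OF x]
      by (simp add: dless_exact_0 st_comp del: o_apply)
    then show ?thesis using Cons.prems(2) 0 by simp
  next
    case (Suc k)
    have e': "exact (ef x) m (Suc k) (ef e)" using e Suc by simp
    have hs: "ef (tmul H e) \<in> st m" "ef (tmul (tmul H e) e) \<in> st m" using Cons.prems(1) est by (simp_all del: o_apply)
    have "dle (ef x) m k (ef H) \<or> dle (ef x) m k (ef (tmul H e)) \<or> dle (ef x) m k (ef (tmul (tmul H e) e))"
      using dle_reduce[OF x Cons.prems(1) _ est, of k] Cons.prems(2) e' Suc by (simp add: exact_def del: o_apply)
    then show ?thesis
      unfolding tpick_def dless_exact[OF x Cons.prems(1) e'] dless_exact[OF x hs(1) e'] dless_exact[OF x hs(2) e']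
      using Suc by (auto simp del: o_apply ef_tmul)
  qed
  then show ?case using Cons.IH[of "tpick x m H e" "d - 1" N'] tpick_st[OF Cons.prems(1) est] es Cons.prems(3) N by simp
qed

text \<open>Factors with class in the span do not affect membership in it. Table entries in
  \<open>st (Suc (Suc m))\<close> may have a class outside the span, but \<open>tpick\<close> skips
  them.\<close>

lemma tsift_class:
  assumes x: "ef x \<in> Gam"
  shows "ef H \<in> Q (Suc m) \<Longrightarrow> \<forall>e\<in>set es. ef e \<in> Q (Suc m) \<and> (ef e \<in> st (Suc (Suc m)) \<or> cl m (ef e) \<in> W vs) \<Longrightarrow>
    cl m (ef (tsift x (Suc m) H es)) \<in> W vs \<longleftrightarrow> cl m (ef H) \<in> W vs"
proof (induction es arbitrary: H)
  case (Cons e es)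
  have e: "ef e \<in> Q (Suc m)" "ef e \<in> st (Suc (Suc m)) \<or> cl m (ef e) \<in> W vs" using Cons.prems by auto
  have "ef (tpick x (Suc m) H e) \<in> Q (Suc m) \<and> (cl m (ef (tpick x (Suc m) H e)) \<in> W vs \<longleftrightarrow> cl m (ef H) \<in> W vs)"
  proof (cases "ef e \<in> st (Suc (Suc m))")
    case True
    have "exact (ef x) (Suc m) 0 (ef e)" using True e by (simp add: exact_def Q_st dle_0)
    then have "tpick x (Suc m) H e = H"
      unfolding tpick_def using e Cons.prems(1) x
      by (simp add: dless_exact_0 st_comp Q_st del: o_apply)
    then show ?thesis using Cons.prems(1) by simp
  next
    case False
    then have "cl m (ef e) \<in> W vs" using e by simp
    then show ?thesis using tpick_cases[of x "Suc m" H e] Cons.prems(1) e(1)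
      by (auto simp: cl_comp cl_comp2 Q_comp W_adf_iff simp del: o_apply)
  qed
  then show ?case using Cons by simp
qed simp

lemma filter_chain: assumes x: "odo x"
  shows "list_all2 (\<lambda>d e. exact x (Suc m) d (ef e)) (degs d N) es \<Longrightarrow> d \<le> N \<Longrightarrow>
    chain x (Suc m) (map (cl m) (filter (\<lambda>f. f \<notin> st (Suc (Suc m))) (map ef es))) \<and>
    length (filter (\<lambda>f. f \<notin> st (Suc (Suc m))) (map ef es)) = d"
proof (induction es arbitrary: d N)
  case Nil
  then have "N = 0" by (simp add: degs_def)
  then show ?case using Nil by simp
next
  case (Cons e es)
  then obtain N' where N: "N = Suc N'" by (cases N) auto
  have e: "exact x (Suc m) d (ef e)" and es: "list_all2 (\<lambda>d e. exact x (Suc m) d (ef e)) (degs (d - 1) N') es"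
    using Cons.prems(1) by (auto simp: N degs_Suc)
  have IH: "chain x (Suc m) (map (cl m) (filter (\<lambda>f. f \<notin> st (Suc (Suc m))) (map ef es)))"
    "length (filter (\<lambda>f. f \<notin> st (Suc (Suc m))) (map ef es)) = d - 1"
    using Cons.IH[OF es] Cons.prems(2) N by auto
  have st: "ef e \<in> st (Suc (Suc m)) \<longleftrightarrow> d = 0"
    using e dle_0[of "ef e" "Suc m" x] by (auto simp: exact_def)
  have "deg_vec x (Suc m) (d - 1) (cl m (ef e))" if "d \<noteq> 0"
  proof -
    have "con (Suc m) ((T x ^^ k) (cl m (ef e))) 0 \<longleftrightarrow> dle x (Suc m) k (ef e)" for k
      unfolding dle_def by (rule con_cong[OF odo_Gam[OF x]]) (auto simp: cl_def)
    then show ?thesis using e that unfolding deg_vec_def by (simp only: exact_def Suc_diff_1) auto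
  qed
  then show ?case using IH st by auto
qed

lemma tbst_max: assumes x: "odo (ef x)" and Y: "\<And>e t. e \<in> set es \<Longrightarrow> t \<in> {x, s} \<Longrightarrow> ef (tsift x m (tcm e t) Y) \<in> st (Suc m)"
  shows "ef c \<in> st (Suc m) \<Longrightarrow> ef (tbst x s m Y c es) \<in> st (Suc m) \<and>
    (\<not> dle (ef x) (Suc m) k (ef c) \<or> (\<exists>e\<in>set es. \<exists>t\<in>{x, s}. \<not> dle (ef x) (Suc m) k (ef (tsift x m (tcm e t) Y))) \<longrightarrow>
      \<not> dle (ef x) (Suc m) k (ef (tbst x s m Y c es)))"
  using Y
proof (induction es arbitrary: c)
  case (Cons e es)
  have b: "ef (tbb x (Suc m) a r) \<in> st (Suc m) \<and>
     (\<not> dle (ef x) (Suc m) k (ef a) \<or> \<not> dle (ef x) (Suc m) k (ef r) \<longrightarrow> \<not> dle (ef x) (Suc m) k (ef (tbb x (Suc m) a r)))"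
    if ar: "ef a \<in> st (Suc m)" "ef r \<in> st (Suc m)" for a r
  proof (cases "dless (ef x) (Suc m) (ef a) (ef r)")
    case True
    then obtain j where j: "dle (ef x) (Suc m) j (ef a)" "\<not> dle (ef x) (Suc m) j (ef r)"
      using dless_iff[OF odo_Gam[OF x] ar] by blast
    have "\<not> dle (ef x) (Suc m) k (ef r)" if "\<not> dle (ef x) (Suc m) k (ef a)"
      using j that dle_mono[OF x j(1), of k] dle_mono[OF x, of "Suc m" k "ef r" j] by (cases "j \<le> k") auto
    then show ?thesis using True ar by (auto simp: tbb_def)
  next
    case False
    then have "\<not> dle (ef x) (Suc m) k (ef a)" if "\<not> dle (ef x) (Suc m) k (ef r)"
      using dless_iff[OF odo_Gam[OF x] ar] that by blast
    then show ?thesis using False ar by (auto simp: tbb_def)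
  qed
  let ?r1 = "tsift x m (tcm e x) Y" and ?r2 = "tsift x m (tcm e s) Y"
  have r: "ef ?r1 \<in> st (Suc m)" "ef ?r2 \<in> st (Suc m)" using Cons.prems(2) by auto
  note b1 = b[OF Cons.prems(1) r(1)]
  note b2 = b[OF conjunct1[OF b1] r(2)]
  have Y': "\<And>e t. e \<in> set es \<Longrightarrow> t \<in> {x, s} \<Longrightarrow> ef (tsift x m (tcm e t) Y) \<in> st (Suc m)"
    using Cons.prems(2) by simp
  show ?case using Cons.IH[OF conjunct1[OF b2] Y'] b1 b2 by (simp only: tbst.simps) auto
qed simp

text \<open>On level 1 the sum over siblings is \<open>be\<close>, which is nonzero for
  \<open>s\<close>; the reduction of the degree by sibling sums starts on level 2.\<close>

definition top_deg :: "nat \<Rightarrow> nat" where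
  "top_deg m = (if m = 0 then 1 else if m = 1 then 3 else 2 * 3 ^ (m - 1))"

lemma top_deg_le: "top_deg m \<le> 3 ^ m"
  by (cases m) (auto simp: top_deg_def)

lemma dle_top: assumes "odo x" "f \<in> st m" shows "dle x m (top_deg m) f"
proof -
  consider "m = 0" | "m = 1" | k where "m = Suc (Suc k)" by (metis One_nat_def old.nat.exhaust)
  then show ?thesis
  proof cases
    case 3
    have "f \<in> Q (Suc (Suc k))" using assms 3 by (simp add: Q_def)
    from dle_Q[OF assms(1) this] show ?thesis using 3 by (simp add: top_deg_def)
  qed (use dle_max[OF assms(1), of 0 f] dle_max[OF assms(1), of 1 f] in \<open>simp_all add: top_deg_def\<close>)
qed

lemma exact_top: assumes "odo x" "f \<in> st m" "\<not> dle x m (top_deg m - 1) f" shows "exact x m (top_deg m) f"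
proof -
  have "\<not> dle x m k f" if "k < top_deg m" for k
  proof -
    have "k \<le> top_deg m - 1" using that by simp
    then show ?thesis using dle_mono[OF assms(1)] assms(3) by blast
  qed
  then show ?thesis using assms dle_top[OF assms(1,2)] by (simp add: exact_def)
qed

lemma ttab_reduces:
  assumes x: "odo (ef x)" and u: "exact (ef x) m (top_deg m) (ef (tu x s m))" and h: "ef H \<in> st m"
  shows "ef (tsift x m H (ttab x s m)) \<in> st (Suc m)"
proof -
  have "list_all2 (\<lambda>d e. exact (ef x) m d (ef e)) (degs (top_deg m) (3 ^ m) @ []) (ttab x s m)"
    unfolding ttab_def by (rule texp_exact[OF x]) (simp_all add: map_ef_tpl u)
  then show ?thesis using tsift_reduces[OF x h dle_top[OF x h] top_deg_le] by simp
qed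

lemma tsift_ttab_Gen: "\<exists>z\<in>Gen (ef x) (ef s). ef (tsift x m H (ttab x s k)) = ef H \<circ> z"
proof (rule tsift_closed[where P = "\<lambda>A. ef A \<in> Gen (ef x) (ef s)"])
  show "\<exists>z\<in>Gen (ef x) (ef s). ef H = ef H \<circ> z" by (rule bexI[OF _ Gen_id]) simp
  show "\<forall>e\<in>set (ttab x s k). ef e \<in> Gen (ef x) (ef s)"
    by (rule ttab_closed[OF Gen_closed]) (rule Gen_x Gen_s)+
  show "\<exists>z\<in>Gen (ef x) (ef s). ef (tmul H' e) = ef H \<circ> z"
    if "\<exists>z\<in>Gen (ef x) (ef s). ef H' = ef H \<circ> z" "ef e \<in> Gen (ef x) (ef s)" for H' e
    using that by (metis ef_tmul comp_assoc Gen_comp)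
qed

lemma dd_eq: "2 * dd m + 1 = 3 ^ m"
  by (induction m) simp_all

lemma degs_dle: assumes x: "odo x"
  shows "list_all2 (\<lambda>d e. exact x m d (ef e)) (degs d N) es \<Longrightarrow> e \<in> set es \<Longrightarrow> dle x m d (ef e) \<and> ef e \<in> st m"
proof (induction es arbitrary: d N)
  case (Cons a es)
  then obtain N' where N: "N = Suc N'" by (cases N) auto
  show ?case
  proof (cases "e = a")
    case True
    then show ?thesis using Cons.prems by (simp add: N degs_Suc exact_def)
  next
    case False
    then show ?thesis using Cons.IH[of "d - 1" N'] Cons.prems dle_mono[OF x, of m "d - 1" "ef e" d] by (simp add: N degs_Suc)
  qed
qed simp

text \<open>\<open>exists_residue\<close> gives a commutator with class outside the span. Sifting
  keeps it outside while moving it into the next stabiliser, where a nonzero class means maximal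
  degree (\<open>cl_eq_0\<close>). The search in \<open>tbst\<close> cannot lose this
  degree.\<close>

lemma exact_tu_Suc_Suc:
  assumes x: "odo (ef x)" and s: "ef s \<in> Gam" "al (ef s) = 0" "be (ef s) \<noteq> 0"
    and surj: "\<And>g. g \<in> Gam \<Longrightarrow> \<exists>z\<in>Gen (ef x) (ef s). g \<circ> z \<in> st (Suc (Suc j))"
  shows "exact (ef x) (Suc (Suc j)) (top_deg (Suc (Suc j))) (ef (tu x s (Suc (Suc j))))"
proof -
  define Xs where "Xs = tpl x (Suc j) []"
  define Y where "Y = tY x s (Suc j)"
  \<comment> \<open>After \<open>dd (Suc j)\<close> differences the labels of the initial commutator
    are a nonzero constant, so one more is needed to annihilate them.\<close>
  define d where "d = Suc (dd (Suc j))"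
  define es where "es = filter (\<lambda>f. f \<notin> st (Suc (Suc j))) (map ef Y)"
  have xG: "ef x \<in> Gam" using x by (rule odo_Gam)
  have mX: "map ef Xs = rev (map (pw (ef x)) [0..<Suc j])" unfolding Xs_def map_ef_tpl by simp
  then have hd: "ef (hd Xs) = pw (ef x) j" by (cases Xs) auto
  have Y: "Y = texp (tcm s (hd Xs)) Xs []" by (simp add: Y_def tY_def Xs_def)
  have y: "comm (ef s) (pw (ef x) j) \<in> st (Suc j)"
    "con (Suc j) ((T (ef x) ^^ dd (Suc j)) (lab (comm (ef s) (pw (ef x) j)))) (be (ef s))"
    using comm_pw_leading[OF x s(1), of j] s(2) by (simp_all del: dd.simps)
  have yQ: "comm (ef s) (pw (ef x) j) \<in> Q (Suc j)"
    using y(1) s(1) xG by (simp add: Q_def comm_def be_comp be_inv)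
  have "\<not> dle (ef x) (Suc j) k (comm (ef s) (pw (ef x) j))" if "k < d" for k
  proof
    assume "dle (ef x) (Suc j) k (comm (ef s) (pw (ef x) j))"
    then have "dle (ef x) (Suc j) (dd (Suc j)) (comm (ef s) (pw (ef x) j))"
      using dle_mono[OF x] that by (simp add: d_def del: dd.simps)
    moreover have "\<exists>w::vertex. length w = Suc j" by (rule exI[of _ "replicate (Suc j) 0"]) simp
    ultimately show False using y(2) s(3) by (auto simp: dle_def con_def)
  qed
  moreover have "dle (ef x) (Suc j) d (comm (ef s) (pw (ef x) j))"
    using con_T_less[OF xG y(2), of d] by (simp add: d_def dle_def)
  ultimately have ey: "exact (ef x) (Suc j) d (ef (tcm s (hd Xs)))"
    using y(1) by (simp add: exact_def hd)
  have eY: "list_all2 (\<lambda>d e. exact (ef x) (Suc j) d (ef e)) (degs d (3 ^ Suc j)) Y"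
    using texp_exact[OF x mX ey, of "[]" "[]"] unfolding Y by (simp del: power_Suc)
  have dN: "d \<le> 3 ^ Suc j" using dd_eq[of "Suc j"] by (simp add: d_def)
  have YQ: "\<forall>e\<in>set Y. ef e \<in> Q (Suc j)"
    unfolding Y
  proof (rule texp_closed[where R = "\<lambda>A. ef A \<in> Gam"])
    show "\<forall>X\<in>set Xs. ef X \<in> Gam" unfolding Xs_def by (rule tpl_closed) (simp_all add: xG del: o_apply)
  qed (simp_all add: yQ hd Q_comm)
  have fc: "chain (ef x) (Suc j) (map (cl j) es)" "length es = d"
    using filter_chain[OF x eY dN] by (simp_all add: es_def)
  obtain e t where et: "e \<in> set es" "t \<in> {ef x, ef s}" "cl j (comm e t) \<notin> W (map (cl j) es)"
    using exists_residue[OF x s(1) _ fc(1) _ surj] YQ fc(2) by (auto simp: es_def d_def)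
  obtain E where E: "E \<in> set Y" "ef E = e" using et(1) by (auto simp: es_def)
  obtain t' where t': "t' \<in> {x, s}" "ef t' = t" using et(2) by auto
  have tG: "ef t'' \<in> Gam" if "t'' \<in> {x, s}" for t'' using that xG s(1) by auto
  have red: "ef (tsift x (Suc j) (tcm E'' t'') Y) \<in> st (Suc (Suc j))" if E'': "E'' \<in> set Y" "t'' \<in> {x, s}" for E'' t''
  proof -
    have E: "dle (ef x) (Suc j) d (ef E'')" "ef E'' \<in> st (Suc j)" using degs_dle[OF x eY E''(1)] by auto
    have "dle (ef x) (Suc j) d (comm (ef E'') (ef t''))"
      using dle_comm[OF x E(2) tG[OF E''(2)]] dle_mono[OF x E(1)] by simp
    then show ?thesis
      using tsift_reduces[OF x _ _ dN eY, of "tcm E'' t''"] E tG[OF E''(2)] by simp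
  qed
  let ?r = "tsift x (Suc j) (tcm E t') Y"
  have EQ: "ef (tcm E t') \<in> Q (Suc j)" using Q_comm[OF bspec[OF YQ E(1)] tG[OF t'(1)]] by simp
  have "cl j (ef ?r) \<notin> W (map (cl j) es)"
  proof (subst tsift_class[OF xG EQ])
    show "\<forall>e\<in>set Y. ef e \<in> Q (Suc j) \<and> (ef e \<in> st (Suc (Suc j)) \<or> cl j (ef e) \<in> W (map (cl j) es))"
      using YQ W_mem[of _ "map (cl j) es"] by (auto simp: es_def)
    show "cl j (ef (tcm E t')) \<notin> W (map (cl j) es)" using et E t' by simp
  qed
  then have "cl j (ef ?r) \<noteq> (\<lambda>w. 0)" by (metis W_0)
  then have "\<not> dle (ef x) (Suc (Suc j)) (2 * 3 ^ Suc j - 1) (ef ?r)"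
    using cl_eq_0[OF x, of "ef ?r" j] red[OF E(1) t'(1)] by blast
  then have "\<exists>e\<in>set Y. \<exists>t\<in>{x, s}. \<not> dle (ef x) (Suc (Suc j)) (2 * 3 ^ Suc j - 1) (ef (tsift x (Suc j) (tcm e t) Y))"
    using E(1) t'(1) by blast
  moreover have "ef (tmul x (tinv x)) \<in> st (Suc (Suc j))" using xG by (simp del: o_apply id_apply)
  ultimately have "ef (tu x s (Suc (Suc j))) \<in> st (Suc (Suc j)) \<and>
     \<not> dle (ef x) (Suc (Suc j)) (2 * 3 ^ Suc j - 1) (ef (tu x s (Suc (Suc j))))"
    using tbst_max[OF x red, where c = "tmul x (tinv x)" and k = "2 * 3 ^ Suc j - 1" and es = Y] unfolding tu.simps Y_def[symmetric] by blast
  then show ?thesis by (intro exact_top[OF x]) (simp_all add: top_deg_def)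
qed

text \<open>The two claims need each other: maximal degree on level \<open>m\<close> requires that
  \<open>x\<close> and \<open>s\<close> generate modulo \<open>st m\<close>, and this follows by
  sifting through the tables of the lower levels.\<close>

lemma exact_tu:
  assumes x: "odo (ef x)" and s: "ef s \<in> Gam" "al (ef s) = 0" "be (ef s) \<noteq> 0"
  shows "exact (ef x) m (top_deg m) (ef (tu x s m)) \<and> (\<forall>g\<in>Gam. \<exists>z\<in>Gen (ef x) (ef s). g \<circ> z \<in> st (Suc m))"
proof (induction m rule: less_induct)
  case (less m)
  have GG: "Gen (ef x) (ef s) \<subseteq> Gam"
  proof
    show "f \<in> Gam" if "f \<in> Gen (ef x) (ef s)" for f
      using that by (induction rule: Gen.induct) (simp_all add: Gam_id odo_Gam[OF x] s del: id_apply o_apply)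
  qed
  have prev: "\<exists>z\<in>Gen (ef x) (ef s). g \<circ> z \<in> st m" if "g \<in> Gam" for g
  proof (cases m)
    case 0
    then show ?thesis using that by (intro bexI[OF _ Gen_id]) simp
  next
    case (Suc k)
    then show ?thesis using less[of k] that by (simp del: o_apply)
  qed
  consider "m = 0" | "m = 1" | k where "m = Suc (Suc k)" by (metis One_nat_def old.nat.exhaust)
  then have e: "exact (ef x) m (top_deg m) (ef (tu x s m))"
  proof cases
    case 1
    have "lab (ef x) [] \<noteq> 0" using x by (simp add: odo_def)
    then show ?thesis
      using x 1 by (intro exact_top) (simp_all add: odo_Gam top_deg_def dle_def con_def)
  next
    case 2
    have s1: "ef s \<in> st 1" using s by (simp add: st_Suc)
    have "con (Suc 0) ((T (ef x) ^^ (2 + 3 * 0)) (lab (ef s))) (be (ef s))"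
      by (rule con_T_combine[OF x, where h = "\<lambda>i. lab (ef s) [i]"])
        (simp_all add: con_def D_D be_def numeral_2_eq_2)
    then have "\<not> dle (ef x) 1 (top_deg 1 - 1) (ef s)"
      using s(3) by (auto simp: dle_def con_def top_deg_def length_Suc_conv)
    then show ?thesis using exact_top[OF x s1] 2 by simp
  next
    case 3
    show ?thesis unfolding 3
      by (rule exact_tu_Suc_Suc[OF x s]) (use less[of "Suc k"] 3 in \<open>simp_all del: o_apply\<close>)
  qed
  have "\<exists>z\<in>Gen (ef x) (ef s). g \<circ> z \<in> st (Suc m)" if g: "g \<in> Gam" for g
  proof -
    obtain z where z: "z \<in> Gen (ef x) (ef s)" "g \<circ> z \<in> st m" using prev[OF g] by blast
    obtain z' where "z' \<in> Gen (ef x) (ef s)" "ef (tsift x m (Elt (g \<circ> z) Nul Nul) (ttab x s m)) = g \<circ> z \<circ> z'"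
      using tsift_ttab_Gen[of x s m "Elt (g \<circ> z) Nul Nul" m] by auto
    moreover have "ef (tsift x m (Elt (g \<circ> z) Nul Nul) (ttab x s m)) \<in> st (Suc m)"
      by (rule ttab_reduces[OF x e]) (simp add: z(2) del: o_apply)
    ultimately show ?thesis using Gen_comp[OF z(1)] by (metis comp_assoc)
  qed
  then show ?case using e by blast
qed

theorem tloop_correct:
  assumes x: "odo (ef x)" and s: "ef s \<in> Gam" "al (ef s) = 0" "be (ef s) \<noteq> 0"
  shows "ef g \<in> st m \<Longrightarrow> ef (tloop x s k m g) \<in> st (k + m)"
proof (induction k arbitrary: m g)
  case (Suc k)
  have "ef (tsift x m g (ttab x s m)) \<in> st (Suc m)"
    using ttab_reduces[OF x conjunct1[OF exact_tu[OF x s]] Suc.prems] .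
  then show ?case using Suc.IH[of "tsift x m g (ttab x s m)" "Suc m"] by simp
qed simp

section \<open>Words of the algorithm and their lengths\<close>

fun flat :: "val \<Rightarrow> val list" where
  "flat Nul = []"
| "flat (Pr Nul p) = [p]"
| "flat (Pr (Pr t v) r) = flat t @ flat v"

lemma flat_nd [simp]: "flat (nd t v) = flat t @ flat v"
  by (simp add: nd_def)

definition wprod :: "(vertex \<Rightarrow> vertex) list \<Rightarrow> vertex \<Rightarrow> vertex" where
  "wprod l = foldr (\<circ>) l id"

lemma wprod_Gam: "set l \<subseteq> Gam \<Longrightarrow> wprod l \<in> Gam"
proof (induction l)
  case Nil
  then show ?case using Gam_id by (simp add: wprod_def id_def)
next
  case (Cons f l)
  have "wprod (f # l) = f \<circ> wprod l" by (simp add: wprod_def)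
  then show ?case using Cons by (simp del: o_apply)
qed

lemma wprod_append: "wprod (l @ k) w = wprod l (wprod k w)"
  by (induction l) (simp_all add: wprod_def)

lemma wprod_Nil [simp]: "wprod [] w = w"
  by (simp add: wprod_def)

text \<open>The trees of \<open>A\<close> spell \<open>z\<close> and its inverse, where \<open>ef A = g \<circ> z\<close> up to level \<open>n\<close>.\<close>

definition valid :: "(vertex \<Rightarrow> vertex) set \<Rightarrow> nat \<Rightarrow> (vertex \<Rightarrow> vertex) \<Rightarrow> elt \<Rightarrow> bool" where
  "valid S n g A \<longleftrightarrow> ef A \<in> Gam \<and> (\<exists>l k. set l \<subseteq> S \<and> set k \<subseteq> S \<and>
    flat (wt A) = map (portrait n) l \<and> flat (iw A) = map (portrait n) k \<and>
    (\<forall>w. length w = n \<longrightarrow> ef A w = g (wprod l w) \<and> iv (ef A) w = wprod k (iv g w)))"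

lemma valid_tmul: assumes S: "S \<subseteq> Gam" and g: "g \<in> Gam" and A: "valid S n g A" and B: "valid S n id B"
  shows "valid S n g (tmul A B)"
proof -
  obtain l k where lk: "set l \<subseteq> S" "set k \<subseteq> S" "flat (wt A) = map (portrait n) l" "flat (iw A) = map (portrait n) k"
    "\<And>w. length w = n \<Longrightarrow> ef A w = g (wprod l w)" "\<And>w. length w = n \<Longrightarrow> iv (ef A) w = wprod k (iv g w)"
    using A by (auto simp: valid_def)
  obtain l' k' where lk': "set l' \<subseteq> S" "set k' \<subseteq> S" "flat (wt B) = map (portrait n) l'" "flat (iw B) = map (portrait n) k'"
    "\<And>w. length w = n \<Longrightarrow> ef B w = wprod l' w" "\<And>w. length w = n \<Longrightarrow> iv (ef B) w = wprod k' w"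
    using B by (auto simp: valid_def inv_id)
  have G: "ef A \<in> Gam" "ef B \<in> Gam" using A B by (auto simp: valid_def)
  have w: "wprod l' \<in> Gam" "wprod k \<in> Gam" using lk' lk S by (auto intro!: wprod_Gam)
  have "ef (tmul A B) v = g (wprod (l @ l') v)" "iv (ef (tmul A B)) v = wprod (k' @ k) (iv g v)" if "length v = n" for v
    using that w g G by (simp_all add: wprod_append lk lk' Gam_inv_comp)
  then show ?thesis
    unfolding valid_def using G lk lk'
    by (intro conjI exI[of _ "l @ l'"] exI[of _ "k' @ k"]) (simp_all add: tmul_def del: o_apply)
qed

lemma valid_tinv: "S \<subseteq> Gam \<Longrightarrow> valid S n id A \<Longrightarrow> valid S n id (tinv A)"
  unfolding valid_def tinv_def by (auto simp: Gam_inv_inv inv_id)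

lemma valid_op_closed: assumes "S \<subseteq> Gam" shows "op_closed (valid S n id)"
  using valid_tmul[OF assms Gam_id] valid_tinv[OF assms] by (simp add: op_closed_def)

lemma valid_tloop: assumes S: "S \<subseteq> Gam" "g \<in> Gam" and xs: "valid S n id x" "valid S n id s"
  shows "valid S n g A \<Longrightarrow> valid S n g (tloop x s k m A)"
proof (induction k arbitrary: m A)
  case (Suc k)
  have "valid S n g (tsift x m A (ttab x s m))"
    by (rule tsift_closed[where R = "valid S n g" and P = "valid S n id", OF Suc.prems
        ttab_closed[OF valid_op_closed[OF S(1)] xs]]) (rule valid_tmul[OF S])
  then show ?case using Suc.IH by simp
qed simp

text \<open>When the product of \<open>g\<close> and \<open>z\<close> is trivial on level
  \<open>n\<close>, the inverse of \<open>z\<close> acts there as \<open>g\<close>; hence it is the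
  inverse word that spells \<open>g\<close>.\<close>

lemma valid_trivial: assumes S: "S \<subseteq> Gam" "g \<in> Gam" and A: "valid S n g A" "ef A \<in> st n"
  obtains k where "set k \<subseteq> S" "flat (iw A) = map (portrait n) k" "\<And>w. length w = n \<Longrightarrow> wprod k w = g w"
proof -
  obtain k where k: "set k \<subseteq> S" "flat (iw A) = map (portrait n) k" "\<And>w. length w = n \<Longrightarrow> iv (ef A) w = wprod k (iv g w)"
    using A by (auto simp: valid_def)
  have "wprod k w = g w" if "length w = n" for w
  proof -
    have "length (g w) = n" using that S by simp
    moreover have "iv (ef A) (g w) = g w" using st_app[OF st_inv[OF A(2)], of "g w"] that S by simp
    ultimately show ?thesis using k(3)[of "g w"] S by simp
  qed
  then show ?thesis using that k by blast
qed

section \<open>Lengths of the words, measured as sizes of trees\<close>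

definition szle :: "nat \<Rightarrow> elt \<Rightarrow> bool" where
  "szle b A \<longleftrightarrow> val_size (wt A) \<le> b \<and> val_size (iw A) \<le> b"

lemma szle_mono: "szle a A \<Longrightarrow> a \<le> b \<Longrightarrow> szle b A"
  by (auto simp: szle_def)

lemma szle_tmul: "szle a A \<Longrightarrow> szle b B \<Longrightarrow> szle (a + b + 3) (tmul A B)"
  by (auto simp: szle_def tmul_def nd_def)

lemma szle_tinv: "szle a A \<Longrightarrow> szle a (tinv A)"
  by (auto simp: szle_def tinv_def)

lemma szle_tcm: "szle a A \<Longrightarrow> szle b B \<Longrightarrow> szle (2 * a + 2 * b + 9) (tcm A B)"
  using szle_tmul[OF szle_tmul[OF szle_tmul[OF szle_tinv] ] szle_tinv, of b B a A b B a A]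
  unfolding tcm_def by (auto intro: szle_mono)

lemma szle_tpl: "szle b x \<Longrightarrow> (b + 3) * 3 ^ m \<le> c \<Longrightarrow> \<forall>e\<in>set acc. szle c e \<Longrightarrow> \<forall>e\<in>set (tpl x m acc). szle c e"
proof (induction m arbitrary: x b acc)
  case (Suc m)
  have 1: "szle (3 * b + 6) (tmul (tmul x x) x)"
    using szle_tmul[OF szle_tmul, OF Suc.prems(1) Suc.prems(1) Suc.prems(1)] by (auto intro: szle_mono)
  have "b + 3 \<le> (b + 3) * 3 ^ Suc m" by simp
  then have "b \<le> c" using Suc.prems(2) by linarith
  then have "szle c x" by (rule szle_mono[OF Suc.prems(1)])
  then have 2: "\<forall>e\<in>set (x # acc). szle c e" using Suc.prems(3) by simp
  have 3: "(3 * b + 6 + 3) * 3 ^ m \<le> c" using Suc.prems(2) by (simp add: algebra_simps)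
  show ?case unfolding tpl.simps by (rule Suc.IH[OF 1 3 2])
qed simp

text \<open>Two commutators with the same \<open>X\<close> multiply \<open>a + 2 * b + 9\<close> by
  exactly 4, which fixes both the constant and the base of the power.\<close>

lemma szle_texp: "szle a y \<Longrightarrow> \<forall>X\<in>set Xs. szle b X \<Longrightarrow> (a + 2 * b + 9) * 4 ^ length Xs \<le> c \<Longrightarrow>
  \<forall>e\<in>set acc. szle c e \<Longrightarrow> \<forall>e\<in>set (texp y Xs acc). szle c e"
proof (induction Xs arbitrary: y acc a)
  case (Cons X Xs)
  have X: "szle b X" and Xs: "\<forall>X\<in>set Xs. szle b X" using Cons.prems(2) by auto
  have 1: "szle (2 * a + 2 * b + 9) (tcm y X)" using szle_tcm[OF Cons.prems(1) X] .
  have 2: "szle (2 * (2 * a + 2 * b + 9) + 2 * b + 9) (tcm (tcm y X) X)" using szle_tcm[OF 1 X] .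
  define k where "k = (4::nat) ^ length Xs"
  have c: "(a + 2 * b + 9) * (4 * k) \<le> c" using Cons.prems(3) by (simp add: k_def ac_simps)
  have "(a + 2 * b + 9) * k \<le> c" "(2 * a + 2 * b + 9 + 2 * b + 9) * k \<le> c"
    "(2 * (2 * a + 2 * b + 9) + 2 * b + 9 + 2 * b + 9) * k \<le> c"
    using c by (simp_all add: algebra_simps)
  note c3 = this[unfolded k_def]
  show ?case unfolding texp.simps
    by (intro Cons.IH[OF Cons.prems(1) Xs c3(1)] Cons.IH[OF 1 Xs c3(2)] Cons.IH[OF 2 Xs c3(3)] Cons.prems(4))
qed (auto intro: szle_mono)

lemma length_texp [simp]: "length (texp y Xs acc) = 3 ^ length Xs + length acc"
  by (induction Xs arbitrary: y acc) simp_all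

lemma szle_tsift: "szle a H \<Longrightarrow> \<forall>e\<in>set es. szle b e \<Longrightarrow> szle (a + length es * (2 * b + 6)) (tsift x m H es)"
proof (induction es arbitrary: H a)
  case (Cons e es)
  have e: "szle b e" using Cons.prems(2) by simp
  have "szle (a + 2 * b + 6) (tpick x m H e)"
    using tpick_cases[of x m H e] szle_tmul[OF Cons.prems(1) e] szle_tmul[OF szle_tmul[OF Cons.prems(1) e] e] Cons.prems(1)
    by (auto intro: szle_mono)
  then have "szle (a + 2 * b + 6 + length es * (2 * b + 6)) (tsift x m (tpick x m H e) es)"
    using Cons by simp
  then show ?case by (auto elim: szle_mono)
qed simp

text \<open>Bounds for the trees in \<open>tpl\<close>, \<open>tY\<close>, \<open>tu\<close>, \<open>ttab\<close> and \<open>tloop\<close>, where \<open>b\<close> bounds those of \<open>x\<close> and \<open>s\<close>.\<close>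

definition SX where "SX b n = (b + 3) * 3 ^ n" for b n :: nat
definition SY where "SY b n = (2 * b + 4 * SX b n + 18) * 4 ^ n" for b n :: nat
definition SU where "SU b n = 2 * b + 3 + (2 * SY b n + 2 * b + 9 + 3 ^ n * (2 * SY b n + 6))" for b n :: nat
definition ST where "ST b n = (SU b n + 2 * SX b n + 9) * 4 ^ n" for b n :: nat
definition SL where "SL b n = 1 + n * (3 ^ n * (2 * ST b n + 6))" for b n :: nat

lemma szle_tpl': "szle b x \<Longrightarrow> m \<le> n \<Longrightarrow> \<forall>e\<in>set (tpl x m []). szle (SX b n) e"
  by (rule szle_tpl, assumption) (auto simp: SX_def intro!: mult_left_mono power_increasing)

lemma szle_tY: assumes "szle b x" "szle b s" "0 < m" "m \<le> n" shows "\<forall>e\<in>set (tY x s m). szle (SY b n) e"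
proof -
  have p: "\<forall>e\<in>set (tpl x m []). szle (SX b n) e" by (rule szle_tpl'[OF assms(1,4)])
  moreover have "hd (tpl x m []) \<in> set (tpl x m [])" using assms(3) by (intro hd_in_set) (metis length_greater_0_conv length_tpl add_gr_0)
  ultimately have q: "szle (2 * b + 2 * SX b n + 9) (tcm s (hd (tpl x m [])))" using szle_tcm[OF assms(2)] by blast
  have "(2 * b + 2 * SX b n + 9 + 2 * SX b n + 9) * 4 ^ length (tpl x m []) \<le> SY b n"
    unfolding SY_def using assms(4) by (intro mult_mono) (simp_all add: power_increasing)
  then show ?thesis unfolding tY_def by (rule szle_texp[OF q p]) simp
qed

lemma szle_tbst: assumes "szle b x" "szle b s" and Y: "\<forall>e\<in>set Y. szle y e" "length Y \<le> N"
  shows "szle c C \<Longrightarrow> \<forall>e\<in>set es. szle y e \<Longrightarrow> 2 * y + 2 * b + 9 + N * (2 * y + 6) \<le> c \<Longrightarrow> szle c (tbst x s m Y C es)"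
proof (induction es arbitrary: C)
  case (Cons e es)
  have e: "szle y e" using Cons.prems by simp
  have "szle c (tsift x m (tcm e t) Y)" if "szle b t" for t
    by (rule szle_mono[OF szle_tsift[OF szle_tcm[OF e that] Y(1)]])
      (rule order_trans[OF _ Cons.prems(3)], intro add_mono mult_right_mono Y(2), simp_all)
  moreover have "szle c (tbb x k A B)" if "szle c A" "szle c B" for k A B using that by (simp add: tbb_def)
  ultimately show ?case using Cons assms by simp
qed simp

lemma szle_tu: assumes "szle b x" "szle b s" "m \<le> n" shows "szle (SU b n) (tu x s m)"
proof (cases "(x, s, m)" rule: tu.cases)
  case (3 x' s' k)
  have m: "m = Suc (Suc k)" using 3 by simp
  have Y: "\<forall>e\<in>set (tY x s (Suc k)). szle (SY b n) e" using assms m by (intro szle_tY) auto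
  have l: "length (tY x s (Suc k)) \<le> 3 ^ n" using assms(3) m by (simp add: tY_def del: power_Suc add: power_increasing)
  have 0: "szle (SU b n) (tmul x (tinv x))"
    by (rule szle_mono[OF szle_tmul[OF assms(1) szle_tinv[OF assms(1)]]]) (simp add: SU_def)
  show ?thesis unfolding m tu.simps
    by (rule szle_tbst[OF assms(1,2) Y l 0 Y]) (simp add: SU_def)
qed (use assms in \<open>auto simp: SU_def elim: szle_mono\<close>)

lemma szle_ttab: assumes "szle b x" "szle b s" "m \<le> n" shows "\<forall>e\<in>set (ttab x s m). szle (ST b n) e"
proof -
  have "(SU b n + 2 * SX b n + 9) * 4 ^ length (tpl x m []) \<le> ST b n"
    unfolding ST_def using assms(3) by (intro mult_mono) (simp_all add: power_increasing)
  then show ?thesis unfolding ttab_def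
    by (intro szle_texp[OF szle_tu[OF assms] szle_tpl'[OF assms(1,3)]]) simp_all
qed

lemma length_ttab [simp]: "length (ttab x s m) = 3 ^ m"
  by (simp add: ttab_def)

text \<open>The tables of all levels obey the same bound \<open>ST b n\<close>, so the levels
  contribute a sum and not a product.\<close>

lemma szle_tloop: assumes "szle b x" "szle b s"
  shows "k + m \<le> n \<Longrightarrow> szle a A \<Longrightarrow> szle (a + k * (3 ^ n * (2 * ST b n + 6))) (tloop x s k m A)"
proof (induction k arbitrary: m A a)
  case (Suc k)
  have t: "\<forall>e\<in>set (ttab x s m). szle (ST b n) e" by (rule szle_ttab[OF assms]) (use Suc.prems in simp)
  have "(3::nat) ^ m \<le> 3 ^ n" using Suc.prems by (simp add: power_increasing)
  then have l: "a + length (ttab x s m) * (2 * ST b n + 6) \<le> a + 3 ^ n * (2 * ST b n + 6)"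
    by (simp only: length_ttab) (intro add_mono mult_right_mono, simp_all)
  note s = szle_mono[OF szle_tsift[OF Suc.prems(2) t] l]
  have "szle (a + 3 ^ n * (2 * ST b n + 6) + k * (3 ^ n * (2 * ST b n + 6))) (tloop x s k (Suc m) (tsift x m A (ttab x s m)))"
    by (rule Suc.IH[OF _ s]) (use Suc.prems in simp)
  then show ?case by (simp add: add.assoc)
qed simp

section \<open>Bounds polynomial in the number of vertices\<close>

text \<open>Polynomial growth in \<open>3 ^ n\<close>; \<open>Suc n\<close> in the exponent leaves
  room for constant factors, also at \<open>n = 0\<close>.\<close>

definition pb :: "(nat \<Rightarrow> nat) \<Rightarrow> bool" where
  "pb f \<longleftrightarrow> (\<exists>k. \<forall>n. f n \<le> 3 ^ (k * Suc n))"

lemma pb_mono: "pb g \<Longrightarrow> (\<And>n. f n \<le> g n) \<Longrightarrow> pb f"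
  unfolding pb_def by (meson order_trans)

lemma pb_mult: assumes "pb f" "pb g" shows "pb (\<lambda>n. f n * g n)"
proof -
  obtain k l where "\<And>n. f n \<le> 3 ^ (k * Suc n)" "\<And>n. g n \<le> 3 ^ (l * Suc n)" using assms by (auto simp: pb_def)
  then have "f n * g n \<le> 3 ^ ((k + l) * Suc n)" for n
    by (simp only: power_add distrib_right) (intro mult_mono, simp_all)
  then show ?thesis unfolding pb_def by blast
qed

lemma pb_add: assumes "pb f" "pb g" shows "pb (\<lambda>n. f n + g n)"
proof -
  obtain k l where kl: "\<And>n. f n \<le> 3 ^ (k * Suc n)" "\<And>n. g n \<le> 3 ^ (l * Suc n)" using assms by (auto simp: pb_def)
  have "f n + g n \<le> 3 ^ (Suc (k + l) * Suc n)" for n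
  proof -
    have "f n \<le> 3 ^ ((k + l) * Suc n)" "g n \<le> 3 ^ ((k + l) * Suc n)"
      using order_trans[OF kl(1) power_increasing[of "k * Suc n" "(k + l) * Suc n" 3]]
        order_trans[OF kl(2) power_increasing[of "l * Suc n" "(k + l) * Suc n" 3]]
      by (simp_all only: mult_le_mono1 le_add1 le_add2 one_le_numeral)
    moreover have "(3::nat) * 3 ^ ((k + l) * Suc n) \<le> 3 ^ (Suc (k + l) * Suc n)"
      unfolding power_Suc[symmetric] by (rule power_increasing) simp_all
    ultimately show ?thesis by linarith
  qed
  then show ?thesis unfolding pb_def by blast
qed

lemma pb_power: assumes "a \<le> 3 ^ k" shows "pb (\<lambda>n. a ^ n)"
proof -
  have "a ^ n \<le> 3 ^ (k * Suc n)" for n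
  proof -
    have "a ^ n \<le> (3 ^ k) ^ n" by (rule power_mono[OF assms]) simp
    also have "\<dots> \<le> 3 ^ (k * Suc n)" unfolding power_mult[symmetric] by (rule power_increasing) simp_all
    finally show ?thesis .
  qed
  then show ?thesis unfolding pb_def by blast
qed

lemma pb_3: "pb (\<lambda>n. 3 ^ n)" and pb_4: "pb (\<lambda>n. 4 ^ n)"
  using pb_power[of 3 1] pb_power[of 4 2] by simp_all

lemma pb_n: "pb (\<lambda>n. n)"
  by (rule pb_mono[OF pb_3]) (simp add: less_imp_le)

lemma pb_const: "pb (\<lambda>n. c)"
proof -
  have "c \<le> 3 ^ (c * Suc n)" for n
  proof -
    have "c < 3 ^ c" by (induction c) auto
    also have "\<dots> \<le> 3 ^ (c * Suc n)" by (rule power_increasing) simp_all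
    finally show ?thesis by simp
  qed
  then show ?thesis unfolding pb_def by blast
qed

lemmas pb_intros = pb_add pb_mult pb_3 pb_4 pb_n pb_const

lemma pb_SL: assumes "pb b" shows "pb (\<lambda>n. SX (b n) n)" "pb (\<lambda>n. SL (b n) n)"
  unfolding SX_def SY_def SU_def ST_def SL_def by (intro pb_intros assms)+

section \<open>The program\<close>

text \<open>
  \<open>ECall i\<close> calls the \<open>i\<close>-th entry of the list \<open>prog\<close> below. The functions multiply portraits
  (\<open>pm\<close>), select by a letter (\<open>sel\<close>), test membership in \<open>st m\<close> (\<open>tz\<close>), form products and
  commutators of pairs (portrait, portrait of the inverse) (\<open>vpm\<close>, \<open>vcm\<close>), decide \<open>dless\<close> on such
  pairs (\<open>less\<close>), and compute \<open>tmul\<close>, \<open>tinv\<close>, \<open>tcm\<close>, \<open>tpick\<close> (in three stages), \<open>tsift\<close>, \<open>texp\<close>,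
  \<open>tpl\<close>, \<open>tbst\<close>, \<open>tbb\<close>, \<open>tu\<close> (in three stages), \<open>tloop\<close> and \<open>flat\<close>; \<open>hm\<close>, \<open>pinv\<close>, \<open>mkt\<close> and \<open>comb\<close>
  supply inverses, and the rest chooses \<open>x\<close> and \<open>s\<close> from the generating set. Functions that work
  on level \<open>m\<close> receive \<open>Suc m\<close> in unary, the depth to which \<open>tz\<close> has to look.
\<close>

definition body_pm :: expr where
  "body_pm = EIf (Arg 1)
    (EPr (ECall 2 [Arg 0, EFst (Arg 1)])
    (EPr (ECall 2 [Arg 0, EFst (ESnd (Arg 1))])
    (EPr (ECall 2 [Arg 0, EFst (ESnd (ESnd (Arg 1)))])
    (EPr (ECall 1 [ECall 2 [ESnd (ESnd (ESnd (Arg 0))), EFst (Arg 1)], EFst (ESnd (ESnd (ESnd (Arg 1))))])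
    (EPr (ECall 1 [ECall 2 [ESnd (ESnd (ESnd (Arg 0))), EFst (ESnd (Arg 1))], EFst (ESnd (ESnd (ESnd (ESnd (Arg 1)))))])
    (EPr (ECall 1 [ECall 2 [ESnd (ESnd (ESnd (Arg 0))), EFst (ESnd (ESnd (Arg 1)))], EFst (ESnd (ESnd (ESnd (ESnd (ESnd (Arg 1))))))])
    ENul)))))) ENul"

definition body_sel :: expr where
  "body_sel = EIf (Arg 1) (EIf (ESnd (Arg 1)) (EFst (ESnd (ESnd (Arg 0)))) (EFst (ESnd (Arg 0)))) (EFst (Arg 0))"

definition body_tz :: expr where
  "body_tz = EIf (Arg 1) (EIf (EFst (Arg 0)) ENul
    (EIf (ECall 3 [EFst (ESnd (ESnd (ESnd (Arg 0)))), ESnd (Arg 1)])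
      (EIf (ECall 3 [EFst (ESnd (ESnd (ESnd (ESnd (Arg 0))))), ESnd (Arg 1)])
        (ECall 3 [EFst (ESnd (ESnd (ESnd (ESnd (ESnd (Arg 0)))))), ESnd (Arg 1)]) ENul) ENul))
    (EPr ENul ENul)"

definition body_vpm :: expr where
  "body_vpm = EPr (ECall 1 [EFst (Arg 0), EFst (Arg 1)]) (ECall 1 [ESnd (Arg 1), ESnd (Arg 0)])"

definition body_vcm :: expr where
  "body_vcm = ECall 4 [ECall 4 [ECall 4 [EPr (ESnd (Arg 1)) (EFst (Arg 1)), Arg 0], Arg 1], EPr (ESnd (Arg 0)) (EFst (Arg 0))]"

definition body_less :: expr where
  "body_less = EIf (ECall 3 [EFst (Arg 1), Arg 3]) ENul (EIf (ECall 3 [EFst (Arg 0), Arg 3]) (EPr ENul ENul)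
    (ECall 6 [ECall 5 [Arg 0, Arg 2], ECall 5 [Arg 1, Arg 2], Arg 2, Arg 3]))"

definition body_tmul :: expr where
  "body_tmul = EPr (ECall 4 [EFst (Arg 0), EFst (Arg 1)])
    (EPr (EPr (EPr (EFst (ESnd (Arg 0))) (EFst (ESnd (Arg 1)))) ENul)
         (EPr (EPr (ESnd (ESnd (Arg 1))) (ESnd (ESnd (Arg 0)))) ENul))"

definition body_tin :: expr where
  "body_tin = EPr (EPr (ESnd (EFst (Arg 0))) (EFst (EFst (Arg 0)))) (EPr (ESnd (ESnd (Arg 0))) (EFst (ESnd (Arg 0))))"

definition body_tcm :: expr where
  "body_tcm = ECall 7 [ECall 7 [ECall 7 [ECall 8 [Arg 1], Arg 0], Arg 1], ECall 8 [Arg 0]]"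

text \<open>The language has no local definitions. A product that is both tested and returned is
  passed as an argument to the next stage; the same device splits \<open>tu\<close> and the main
  function.\<close>

definition body_pick :: expr where
  "body_pick = EIf (ECall 6 [EFst (Arg 0), EFst (Arg 1), EFst (Arg 2), Arg 3]) (Arg 0)
    (ECall 11 [Arg 0, ECall 7 [Arg 0, Arg 1], Arg 1, Arg 2, Arg 3])"

definition body_pick1 :: expr where
  "body_pick1 = EIf (ECall 6 [EFst (Arg 1), EFst (Arg 2), EFst (Arg 3), Arg 4]) (Arg 1)
    (ECall 12 [Arg 0, ECall 7 [Arg 1, Arg 2], Arg 2, Arg 3, Arg 4])"

definition body_pick2 :: expr where
  "body_pick2 = EIf (ECall 6 [EFst (Arg 1), EFst (Arg 2), EFst (Arg 3), Arg 4]) (Arg 1) (Arg 0)"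

definition body_sift :: expr where
  "body_sift = EIf (Arg 1) (ECall 13 [ECall 10 [Arg 0, EFst (Arg 1), Arg 2, Arg 3], ESnd (Arg 1), Arg 2, Arg 3]) (Arg 0)"

definition body_exp :: expr where
  "body_exp = EIf (Arg 1) (ECall 14 [Arg 0, ESnd (Arg 1), ECall 14 [ECall 9 [Arg 0, EFst (Arg 1)], ESnd (Arg 1),
     ECall 14 [ECall 9 [ECall 9 [Arg 0, EFst (Arg 1)], EFst (Arg 1)], ESnd (Arg 1), Arg 2]]]) (EPr (Arg 0) (Arg 2))"

definition body_pl :: expr where
  "body_pl = EIf (Arg 1) (ECall 15 [ECall 7 [ECall 7 [Arg 0, Arg 0], Arg 0], ESnd (Arg 1), EPr (Arg 0) (Arg 2)]) (Arg 2)"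

definition body_bst :: expr where
  "body_bst = EIf (Arg 1) (ECall 16 [ECall 17 [ECall 17 [Arg 0, ECall 13 [ECall 9 [EFst (Arg 1), Arg 3], Arg 2, Arg 3, Arg 5], Arg 3, Arg 6],
     ECall 13 [ECall 9 [EFst (Arg 1), Arg 4], Arg 2, Arg 3, Arg 5], Arg 3, Arg 6], ESnd (Arg 1), Arg 2, Arg 3, Arg 4, Arg 5, Arg 6]) (Arg 0)"

definition body_bb :: expr where
  "body_bb = EIf (ECall 6 [EFst (Arg 0), EFst (Arg 1), EFst (Arg 2), Arg 3]) (Arg 1) (Arg 0)"

definition body_uu :: expr where
  "body_uu = EIf (Arg 2) (EIf (ESnd (Arg 2)) (ECall 19 [Arg 0, Arg 1, Arg 2, ECall 15 [Arg 0, ESnd (Arg 2), ENul]]) (Arg 1)) (Arg 0)"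

definition body_uu2 :: expr where
  "body_uu2 = ECall 20 [Arg 0, Arg 1, Arg 2, ECall 14 [ECall 9 [Arg 1, EFst (Arg 3)], Arg 3, ENul]]"

definition body_uu3 :: expr where
  "body_uu3 = ECall 16 [ECall 7 [Arg 0, ECall 8 [Arg 0]], Arg 3, Arg 3, Arg 0, Arg 1, Arg 2, EPr ENul (Arg 2)]"

definition body_loop :: expr where
  "body_loop = EIf (Arg 3) (ECall 21 [ECall 13 [Arg 0, ECall 14 [ECall 18 [Arg 1, Arg 2, Arg 4], ECall 15 [Arg 1, Arg 4, ENul], ENul],
     Arg 1, EPr ENul (Arg 4)], Arg 1, Arg 2, ESnd (Arg 3), EPr ENul (Arg 4)]) (Arg 0)"

definition body_flat :: expr where
  "body_flat = EIf (Arg 0) (EIf (EFst (Arg 0)) (ECall 22 [EFst (EFst (Arg 0)), ECall 22 [ESnd (EFst (Arg 0)), Arg 1]])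
     (EPr (ESnd (Arg 0)) (Arg 1))) (Arg 1)"

definition body_hm :: expr where
  "body_hm = EPr (ECall 1 [EFst (Arg 0), EFst (Arg 1)]) (EPr (EPr (ESnd (Arg 0)) (ESnd (Arg 1))) ENul)"

definition body_pinv :: expr where
  "body_pinv = EIf (Arg 0) (ECall 24 [ESnd (Arg 0), ECall 23 [ECall 23 [Arg 1, Arg 2], Arg 2],
     ECall 23 [ECall 23 [Arg 2, Arg 2], Arg 2]]) (Arg 1)"

definition body_mkt :: expr where
  "body_mkt = ECall 26 [EPr (Arg 1) (Arg 2), ECall 24 [ESnd (Arg 0), ECall 23 [EPr (Arg 1) (Arg 2), EPr (Arg 1) (Arg 2)],
     ECall 23 [ECall 23 [EPr (Arg 1) (Arg 2), EPr (Arg 1) (Arg 2)], EPr (Arg 1) (Arg 2)]]]"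

definition body_comb :: expr where
  "body_comb = EPr (EPr (EFst (Arg 0)) (EFst (Arg 1))) (EPr (ESnd (Arg 0)) (ESnd (Arg 1)))"

definition body_fp :: expr where
  "body_fp = EIf (Arg 0) (EIf (EFst (EFst (Arg 0))) (EFst (Arg 0)) (ECall 27 [ESnd (Arg 0)])) ENul"

definition body_succ3 :: expr where
  "body_succ3 = EIf (Arg 0) (EIf (ESnd (Arg 0)) ENul (EPr ENul (Arg 0))) (EPr ENul ENul)"

definition body_add3 :: expr where
  "body_add3 = EIf (Arg 0) (EIf (ESnd (Arg 0)) (ECall 28 [ECall 28 [Arg 1]]) (ECall 28 [Arg 1])) (Arg 1)"

definition body_be :: expr where
  "body_be = ECall 29 [EFst (EFst (ESnd (ESnd (ESnd (Arg 0))))), ECall 29 [EFst (EFst (ESnd (ESnd (ESnd (ESnd (Arg 0)))))),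
     EFst (EFst (ESnd (ESnd (ESnd (ESnd (ESnd (Arg 0)))))))]]"

definition body_rd :: expr where
  "body_rd = EIf (Arg 0) (ECall 31 [ECall 29 [Arg 0, Arg 2], ECall 29 [Arg 1, Arg 3], Arg 2, Arg 3]) (Arg 1)"

definition body_f2 :: expr where
  "body_f2 = EIf (Arg 0) (EIf (ECall 31 [EFst (EFst (Arg 0)), ECall 30 [EFst (Arg 0)], EFst (Arg 1), ECall 30 [Arg 1]])
     (EFst (Arg 0)) (ECall 32 [ESnd (Arg 0), Arg 1])) ENul"

definition body_rs :: expr where
  "body_rs = EIf (EFst (EFst (EFst (Arg 0)))) (ECall 33 [ECall 7 [Arg 0, Arg 1], Arg 1]) (Arg 0)"

definition body_rx :: expr where
  "body_rx = EIf (ECall 30 [EFst (EFst (Arg 0))])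
     (EIf (ESnd (ECall 30 [EFst (EFst (Arg 0))])) (ECall 34 [ECall 7 [Arg 0, Arg 1], Arg 1]) (Arg 0))
     (ECall 34 [ECall 7 [Arg 0, Arg 1], Arg 1])"

definition body_n1 :: expr where
  "body_n1 = EIf (EFst (Arg 1)) (EIf (ECall 29 [EFst (Arg 1), ECall 29 [EFst (Arg 0), EFst (Arg 0)]])
     (EPr (Arg 0) (EPr (Arg 0) ENul)) (EPr (Arg 0) ENul)) ENul"

definition body_m2 :: expr where
  "body_m2 = ECall 37 [Arg 0, Arg 2, ECall 40 [Arg 0, Arg 3], ECall 40 [Arg 0, ECall 32 [Arg 1, Arg 3]]]"

definition body_m3 :: expr where
  "body_m3 = ECall 38 [Arg 0, Arg 1, Arg 2, ECall 33 [Arg 3, Arg 2]]"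

definition body_m4 :: expr where
  "body_m4 = ECall 39 [Arg 0, Arg 1, ECall 34 [EIf (ESnd (EFst (EFst (EFst (Arg 2))))) (ECall 7 [Arg 2, Arg 2]) (Arg 2), Arg 3], Arg 3]"

definition body_m5 :: expr where
  "body_m5 = ECall 22 [ESnd (ESnd (ECall 21 [ECall 41 [Arg 0, Arg 1], Arg 2, Arg 3, Arg 0, ENul])), ENul]"

definition body_mk1 :: expr where
  "body_mk1 = ECall 25 [Arg 0, Arg 1, EPr ENul (Arg 1)]"

definition body_mkg :: expr where
  "body_mkg = EPr (EFst (ECall 25 [Arg 0, Arg 1, ENul])) (EPr ENul ENul)"

definition body_main :: expr where
  "body_main = EIf (Arg 0) (EIf (ESnd (Arg 0)) (ECall 36 [Arg 0, Arg 1, Arg 2, ECall 27 [Arg 1]]) (ECall 35 [ECall 27 [Arg 1], Arg 2])) ENul"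

definition prog :: "expr list" where
  "prog = [body_main, body_pm, body_sel, body_tz, body_vpm, body_vcm, body_less, body_tmul, body_tin, body_tcm,
    body_pick, body_pick1, body_pick2, body_sift, body_exp, body_pl, body_bst, body_bb, body_uu, body_uu2,
    body_uu3, body_loop, body_flat, body_hm, body_pinv, body_mkt, body_comb, body_fp, body_succ3, body_add3,
    body_be, body_rd, body_f2, body_rs, body_rx, body_n1, body_m2, body_m3, body_m4, body_m5,
    body_mk1, body_mkg]"

lemma length_prog [simp]: "length prog = 42"
  by (simp add: prog_def)

lemma prog_nth:
  "prog ! 0 = body_main" "prog ! 1 = body_pm" "prog ! 2 = body_sel" "prog ! 3 = body_tz" "prog ! 4 = body_vpm"
  "prog ! 5 = body_vcm" "prog ! 6 = body_less" "prog ! 7 = body_tmul" "prog ! 8 = body_tin" "prog ! 9 = body_tcm"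
  "prog ! 10 = body_pick" "prog ! 11 = body_pick1" "prog ! 12 = body_pick2" "prog ! 13 = body_sift"
  "prog ! 14 = body_exp" "prog ! 15 = body_pl" "prog ! 16 = body_bst" "prog ! 17 = body_bb" "prog ! 18 = body_uu"
  "prog ! 19 = body_uu2" "prog ! 20 = body_uu3" "prog ! 21 = body_loop" "prog ! 22 = body_flat" "prog ! 23 = body_hm"
  "prog ! 24 = body_pinv" "prog ! 25 = body_mkt" "prog ! 26 = body_comb" "prog ! 27 = body_fp" "prog ! 28 = body_succ3"
  "prog ! 29 = body_add3" "prog ! 30 = body_be" "prog ! 31 = body_rd" "prog ! 32 = body_f2" "prog ! 33 = body_rs"
  "prog ! 34 = body_rx" "prog ! 35 = body_n1" "prog ! 36 = body_m2" "prog ! 37 = body_m3" "prog ! 38 = body_m4"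
  "prog ! 39 = body_m5" "prog ! 40 = body_mk1" "prog ! 41 = body_mkg"
  by (simp_all add: prog_def)

section \<open>A calculus of upper bounds for running times\<close>

definition ev :: "val list \<Rightarrow> expr \<Rightarrow> val \<Rightarrow> nat \<Rightarrow> bool" where
  "ev env e v B \<longleftrightarrow> (\<exists>t\<le>B. eval prog env e v t)"

definition evl :: "val list \<Rightarrow> expr list \<Rightarrow> val list \<Rightarrow> nat \<Rightarrow> bool" where
  "evl env es vs B \<longleftrightarrow> (\<exists>t\<le>B. evals prog env es vs t)"

definition fn :: "nat \<Rightarrow> val list \<Rightarrow> val \<Rightarrow> nat \<Rightarrow> bool" where
  "fn f vs v B \<longleftrightarrow> f < length prog \<and> ev vs (prog ! f) v B"

text \<open>It detaches the branches from the condition, so that \<open>ev_If\<close> always applies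
  and the shape of the computed value selects the next rule. \<open>fstr\<close> and
  \<open>sndr\<close> do the same for projections of opaque encodings such as portraits.\<close>

definition evif :: "val \<Rightarrow> val list \<Rightarrow> expr \<Rightarrow> expr \<Rightarrow> val \<Rightarrow> nat \<Rightarrow> bool" where
  "evif c env e1 e2 v B \<longleftrightarrow> (if c = Nul then ev env e2 v B else ev env e1 v B)"

definition fstr :: "val \<Rightarrow> val \<Rightarrow> bool" where "fstr u v \<longleftrightarrow> fst_val u = v"
definition sndr :: "val \<Rightarrow> val \<Rightarrow> bool" where "sndr u v \<longleftrightarrow> snd_val u = v"

definition vb :: "bool \<Rightarrow> val" where "vb b = (if b then Pr Nul Nul else Nul)"

text \<open>Repeated rule application executes a body symbolically and synthesises \<open>v'\<close>
  and \<open>B'\<close>; only afterwards are they compared with the claimed value and bound.\<close>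

lemma fnI: "f < 42 \<Longrightarrow> ev vs (prog ! f) v' B' \<Longrightarrow> v' = v \<Longrightarrow> B' \<le> B \<Longrightarrow> fn f vs v B"
  unfolding fn_def ev_def by (metis length_prog order_trans)

lemma fn_mono: "fn f vs v B' \<Longrightarrow> B' \<le> B \<Longrightarrow> fn f vs v B"
  unfolding fn_def ev_def by (meson order_trans)

lemma ev_Arg:
  "ev (a # r) (Arg 0) a 1" "ev (a # b # r) (Arg 1) b 1" "ev (a # b # c # r) (Arg 2) c 1"
  "ev (a # b # c # d # r) (Arg 3) d 1" "ev (a # b # c # d # e # r) (Arg 4) e 1"
  "ev (a # b # c # d # e # f # r) (Arg 5) f 1" "ev (a # b # c # d # e # f # g # r) (Arg 6) g 1"
  unfolding ev_def
  using eval_Arg[of 0 "a # r" prog] eval_Arg[of 1 "a # b # r" prog] eval_Arg[of 2 "a # b # c # r" prog]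
    eval_Arg[of 3 "a # b # c # d # r" prog] eval_Arg[of 4 "a # b # c # d # e # r" prog]
    eval_Arg[of 5 "a # b # c # d # e # f # r" prog] eval_Arg[of 6 "a # b # c # d # e # f # g # r" prog]
  by auto

lemma ev_Nul: "ev env ENul Nul 1"
  unfolding ev_def using eval_Nul by blast

lemma ev_Pr: "ev env e1 v1 B1 \<Longrightarrow> ev env e2 v2 B2 \<Longrightarrow> ev env (EPr e1 e2) (Pr v1 v2) (B1 + B2 + 1)"
  unfolding ev_def by (meson eval_Pr add_le_mono order_refl)

lemma ev_Fst: "ev env e u B \<Longrightarrow> fstr u v \<Longrightarrow> ev env (EFst e) v (B + 1)"
  unfolding ev_def fstr_def by (metis eval_Fst add_le_mono order_refl)

lemma ev_Snd: "ev env e u B \<Longrightarrow> sndr u v \<Longrightarrow> ev env (ESnd e) v (B + 1)"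
  unfolding ev_def sndr_def by (metis eval_Snd add_le_mono order_refl)

lemma ev_If: assumes "ev env c vc B1" "evif vc env e1 e2 v B2" shows "ev env (EIf c e1 e2) v (B1 + B2 + 1)"
proof -
  obtain t1 where t1: "t1 \<le> B1" "eval prog env c vc t1" using assms(1) by (auto simp: ev_def)
  show ?thesis
  proof (cases vc)
    case Nul
    then obtain t2 where t2: "t2 \<le> B2" "eval prog env e2 v t2" using assms(2) by (auto simp: ev_def evif_def)
    show ?thesis unfolding ev_def using eval_If_false[of prog env c t1 e2 v t2 e1] t1 t2 Nul
      by (intro exI[of _ "t1 + t2 + 1"]) simp
  next
    case (Pr a b)
    then obtain t2 where t2: "t2 \<le> B2" "eval prog env e1 v t2" using assms(2) by (auto simp: ev_def evif_def)
    show ?thesis unfolding ev_def using eval_If_true[of prog env c a b t1 e1 v t2 e2] t1 t2 Pr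
      by (intro exI[of _ "t1 + t2 + 1"]) simp
  qed
qed

lemma ev_Call: "evl env es vs B1 \<Longrightarrow> fn f vs v B2 \<Longrightarrow> ev env (ECall f es) v (B1 + B2 + 1)"
  unfolding ev_def evl_def fn_def by (meson eval_Call add_le_mono order_refl)

lemma evl_Nil: "evl env [] [] 0"
  unfolding evl_def using evals_Nil by blast

lemma evl_Cons: "ev env e v B1 \<Longrightarrow> evl env es vs B2 \<Longrightarrow> evl env (e # es) (v # vs) (B1 + B2)"
  unfolding ev_def evl_def by (meson evals_Cons add_le_mono)

lemma evif_simple: "ev env e1 v B \<Longrightarrow> evif (Pr a b) env e1 e2 v B" "ev env e2 v B \<Longrightarrow> evif Nul env e1 e2 v B"
  by (simp_all add: evif_def)

lemma evif_vb: "(b \<Longrightarrow> ev env e1 v1 B1) \<Longrightarrow> (\<not> b \<Longrightarrow> ev env e2 v2 B2) \<Longrightarrow>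
  evif (vb b) env e1 e2 (if b then v1 else v2) (B1 + B2)"
  unfolding evif_def vb_def ev_def by (auto intro: le_add1 le_add2 order_trans)

lemma fst_snd_simple: "fstr (Pr a b) a" "sndr (Pr a b) b" "fstr Nul Nul" "sndr Nul Nul"
  by (simp_all add: fstr_def sndr_def)

lemmas run = ev_Arg ev_Nul ev_Pr ev_Fst ev_Snd ev_If ev_Call evl_Nil evl_Cons evif_simple evif_vb fst_snd_simple

section \<open>Portraits\<close>

abbreviation VL :: "letter \<Rightarrow> val" where "VL \<equiv> val_of_letter"

lemma VL_simps: "VL 0 = Nul" "VL 1 = Pr Nul Nul" "VL (- 1) = Pr Nul (Pr Nul Nul)"
  by (simp_all add: val_of_nat_def numeral_2_eq_2 flip: letter_simps)

lemma VL_fst_snd: "sndr (VL i) (vb (i = - 1))"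
  using letter_cases[of i] by (auto simp: sndr_def vb_def VL_simps)

lemma evif_VL: "(i \<noteq> 0 \<Longrightarrow> ev env e1 v1 B1) \<Longrightarrow> (i = 0 \<Longrightarrow> ev env e2 v2 B2) \<Longrightarrow>
  evif (VL i) env e1 e2 (if i \<noteq> 0 then v1 else v2) (B1 + B2)"
  using letter_cases[of i] unfolding evif_def ev_def
  by (elim disjE) (auto simp: VL_simps intro: le_add1 le_add2 order_trans)

lemma portrait_Suc: assumes "f \<in> Gam"
  shows "portrait (Suc n) f = Pr (VL (al f)) (Pr (VL (1 + al f)) (Pr (VL (- 1 + al f))
    (Pr (portrait n (sec f 0)) (Pr (portrait n (sec f 1)) (Pr (portrait n (sec f (- 1))) Nul)))))"
proof -
  have "tree_section f [i] = sec f i" for i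
    using assms by (simp add: fun_eq_iff tree_section_def Gam_Cons)
  then show ?thesis using assms by (simp add: letter_simps Gam_Cons)
qed

abbreviation NN :: "nat \<Rightarrow> val" where "NN \<equiv> val_of_nat"

lemma NN_simps: "NN 0 = Nul" "NN (Suc m) = Pr Nul (NN m)"
  by (simp_all add: val_of_nat_def)

lemma numeral_le_four_power [simp]:
  "(numeral a :: nat) \<le> numeral b \<Longrightarrow> (numeral a :: nat) \<le> numeral b * 4 ^ n"
  by (metis mult.right_neutral mult_le_mono one_le_numeral one_le_power)

lemma fn_sel: "fn 2 [Pr a (Pr b (Pr c r)), VL i] (if i = 0 then a else if i = 1 then b else c) 20"
  by (rule fnI, simp, unfold prog_nth body_sel_def, (rule run VL_fst_snd evif_VL)+)
    (use letter_cases[of i] in auto)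

text \<open>Base 4 instead of 3: the three recursive calls use three quarters of the bound, and the
  rest pays for the work at the node.\<close>

lemma fn_pm: "f \<in> Gam \<Longrightarrow> g \<in> Gam \<Longrightarrow> fn 1 [portrait n f, portrait n g] (portrait n (f \<circ> g)) (200 * 4 ^ n)"
proof (induction n arbitrary: f g)
  case 0
  show ?case unfolding portrait.simps
    by (rule fnI, simp, unfold prog_nth body_pm_def, (rule run)+) simp_all
next
  case (Suc n)
  have s: "sec f (if i = 0 then 0 else if i = 1 then 1 else - 1) = sec f i" for i
    using letter_cases[of i] by auto
  have sel: "fn 2 [Pr (portrait n (sec f 0)) (Pr (portrait n (sec f 1)) (Pr (portrait n (sec f (- 1))) Nul)), VL i] (portrait n (sec f i)) 20" for i
    using fn_sel[of "portrait n (sec f 0)" "portrait n (sec f 1)" "portrait n (sec f (- 1))" Nul i] letter_cases[of i] by auto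
  have sel': "fn 2 [Pr (VL (al f)) (Pr (VL (1 + al f)) (Pr (VL (- 1 + al f)) r)), VL i] (VL (i + al f)) 20" for i r
    using fn_sel[of "VL (al f)" "VL (1 + al f)" "VL (- 1 + al f)" r i] letter_cases[of i] by auto
  note IH = Suc.IH[OF sec_in_Gam[OF Suc.prems(1)] sec_in_Gam[OF Suc.prems(2)]]
  show ?case
    unfolding portrait_Suc[OF Suc.prems(1)] portrait_Suc[OF Suc.prems(2)] portrait_Suc[OF Gam_comp[OF Suc.prems]]
    apply (rule fnI, simp, unfold prog_nth body_pm_def, (rule run sel sel' IH)+)
    subgoal using Suc.prems by (simp add: al_comp sec_comp algebra_simps del: o_apply)
    subgoal by simp
    done
qed

lemma fn_tz: "f \<in> Gam \<Longrightarrow> m \<le> n \<Longrightarrow> fn 3 [portrait n f, NN m] (vb (f \<in> st m)) (100 * 4 ^ m)"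
proof (induction m arbitrary: n f)
  case 0
  show ?case unfolding NN_simps
    by (rule fnI, simp, unfold prog_nth body_tz_def, (rule run)+) (simp_all add: vb_def 0)
next
  case (Suc m)
  then obtain k where n: "n = Suc k" "m \<le> k" by (cases n) auto
  note IH = Suc.IH[OF sec_in_Gam[OF Suc.prems(1)] n(2)]
  show ?case
    unfolding n(1) portrait_Suc[OF Suc.prems(1)] NN_simps
    apply (rule fnI, simp, unfold prog_nth body_tz_def, (rule run evif_VL IH)+)
    subgoal using Suc.prems by (simp add: vb_def st_Suc letter_all)
    subgoal by simp
    done
qed

section \<open>Running times of the group operations\<close>

definition PP :: "nat \<Rightarrow> (vertex \<Rightarrow> vertex) \<Rightarrow> val" where
  "PP n f = Pr (portrait n f) (portrait n (iv f))"

definition EN :: "nat \<Rightarrow> elt \<Rightarrow> val" where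
  "EN n A = Pr (PP n (ef A)) (Pr (wt A) (iw A))"

definition LL :: "nat \<Rightarrow> elt list \<Rightarrow> val" where
  "LL n es = val_of_list (map (EN n) es)"

lemma enc_fst_snd:
  "fstr (PP n f) (portrait n f)" "sndr (PP n f) (portrait n (iv f))"
  "fstr (EN n A) (PP n (ef A))" "sndr (EN n A) (Pr (wt A) (iw A))"
  "fstr (LL n (e # es)) (EN n e)" "sndr (LL n (e # es)) (LL n es)"
  by (simp_all add: fstr_def sndr_def PP_def EN_def LL_def)

lemma evif_LL: "ev env e1 v B \<Longrightarrow> evif (LL n (e # es)) env e1 e2 v B" "ev env e2 v B \<Longrightarrow> evif (LL n []) env e1 e2 v B"
  by (simp_all add: evif_def LL_def)

lemmas run' = run enc_fst_snd evif_LL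

lemma four_ge_1: "1 \<le> (4::nat) ^ n"
  by simp

lemma numeral_le_four_power' [simp]:
  "(numeral a :: nat) \<le> numeral b \<Longrightarrow> (numeral a :: nat) \<le> 4 ^ n * numeral b"
  using numeral_le_four_power[of a b n] by (simp only: mult.commute)

lemma fn_vpm: assumes "f \<in> Gam" "g \<in> Gam" shows "fn 4 [PP n f, PP n g] (PP n (f \<circ> g)) (420 * 4 ^ n)"
  apply (rule fnI, simp, unfold prog_nth body_vpm_def, (rule run' fn_pm assms Gam_inv)+)
  subgoal using assms by (simp add: PP_def Gam_inv_comp)
  subgoal by simp
  done

lemma fn_vcm: assumes "f \<in> Gam" "g \<in> Gam" shows "fn 5 [PP n f, PP n g] (PP n (comm f g)) (1300 * 4 ^ n)"
proof -
  have v1: "fn 4 [Pr (portrait n (iv g)) (portrait n g), PP n f] (PP n (iv g \<circ> f)) (420 * 4 ^ n)"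
    using fn_vpm[of "iv g" f n] assms by (simp add: PP_def Gam_inv_inv)
  have v2: "fn 4 [PP n h, Pr (portrait n (iv f)) (portrait n f)] (PP n (h \<circ> iv f)) (420 * 4 ^ n)" if "h \<in> Gam" for h
    using fn_vpm[of h "iv f" n] assms that by (simp add: PP_def Gam_inv_inv)
  show ?thesis
    apply (rule fnI, simp, unfold prog_nth body_vcm_def, (rule run' v1 v2 fn_vpm assms Gam_inv Gam_comp)+)
    subgoal by (simp add: comm_def)
    subgoal by simp
    done
qed

definition tl_less :: "nat \<Rightarrow> nat" where
  "tl_less n = (3 ^ n + 1) * (3000 * 4 ^ n)"

text \<open>On level \<open>i\<close> any labels are annihilated by \<open>3 ^ i\<close>
  differences, and \<open>dd m\<close> is the sum of these numbers for \<open>i < m\<close>. This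
  bounds the recursion of \<open>less\<close> on arbitrary elements of the group.\<close>

lemma iterate_comm_st: assumes x: "odo x" and f: "f \<in> Gam" shows "((\<lambda>f. comm f x) ^^ dd m) f \<in> st m"
proof (induction m)
  case 0
  then show ?case using f by simp
next
  case (Suc m)
  let ?g = "((\<lambda>f. comm f x) ^^ dd m) f"
  have "((\<lambda>f. comm f x) ^^ k) h \<in> st m \<and> (dle x m (k + j) h \<longrightarrow> dle x m j (((\<lambda>f. comm f x) ^^ k) h))" if "h \<in> st m" for k j h
    using that
  proof (induction k arbitrary: j)
    case (Suc k)
    then show ?case using odo_Gam[OF x] dle_comm_pw[OF odo_Gam[OF x], of "((\<lambda>f. comm f x) ^^ k) h" m j 0]
      by (auto simp: st_comm)
  qed simp
  from this[OF Suc.IH, of "3 ^ m" 0] have "((\<lambda>f. comm f x) ^^ 3 ^ m) ?g \<in> st (Suc m)"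
    using dle_max[OF x, of m ?g] dle_0 by auto
  moreover have "dd (Suc m) = 3 ^ m + dd m" using dd_eq[of m] by simp
  ultimately show ?case by (simp only: funpow_add o_apply)
qed

text \<open>The recursion followed by the program; it is correct because commutators with
  \<open>x\<close> never leave \<open>st (Suc m)\<close>.\<close>

lemma dless_rec: assumes "x \<in> Gam"
  shows "dless x m h e \<longleftrightarrow> e \<notin> st (Suc m) \<and> (h \<in> st (Suc m) \<or> dless x m (comm h x) (comm e x))"
proof -
  let ?c = "\<lambda>f. comm f x"
  have mono: "(?c ^^ k) f \<in> st (Suc m)" if "f \<in> st (Suc m)" for k f
    using that assms by (induction k) simp_all
  show ?thesis
  proof (cases "e \<in> st (Suc m) \<or> h \<in> st (Suc m)")
    case True
    then show ?thesis unfolding dless_def using mono[of e] by (auto intro: exI[of _ 0])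
  next
    case False
    have "(\<exists>k. (?c ^^ k) h \<in> st (Suc m) \<and> (?c ^^ k) e \<notin> st (Suc m)) \<longleftrightarrow>
      (\<exists>k. (?c ^^ Suc k) h \<in> st (Suc m) \<and> (?c ^^ Suc k) e \<notin> st (Suc m))"
      using False by (metis funpow_0 not0_implies_Suc)
    then show ?thesis using False unfolding dless_def funpow_Suc_right o_apply by blast
  qed
qed

lemma fn_less_aux:
  assumes x: "x \<in> Gam" and m: "Suc m \<le> n"
  shows "h \<in> Gam \<Longrightarrow> e \<in> Gam \<Longrightarrow> ((\<lambda>f. comm f x) ^^ N) e \<in> st (Suc m) \<Longrightarrow>
    fn 6 [PP n h, PP n e, PP n x, NN (Suc m)] (vb (dless x m h e)) ((N + 1) * (3000 * 4 ^ n))"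
proof (induction N arbitrary: h e)
  case 0
  have tz: "fn 3 [portrait n f, NN (Suc m)] (vb (f \<in> st (Suc m))) (100 * 4 ^ n)" if "f \<in> Gam" for f
    by (rule fn_mono[OF fn_tz[OF that m]]) (simp add: m power_increasing del: power_Suc)
  have e: "e \<in> st (Suc m)" using 0 by simp
  have tze: "fn 3 [portrait n e, NN (Suc m)] (Pr Nul Nul) (100 * 4 ^ n)" using tz[OF 0(2)] e by (simp add: vb_def)
  show ?case
    apply (rule fnI, simp, unfold prog_nth body_less_def, (rule run' tze)+)
    subgoal using e x by (subst dless_rec) (simp_all add: vb_def)
    subgoal by simp
    done
next
  case (Suc N)
  have tz: "fn 3 [portrait n f, NN (Suc m)] (vb (f \<in> st (Suc m))) (100 * 4 ^ n)" if "f \<in> Gam" for f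
    by (rule fn_mono[OF fn_tz[OF that m]]) (simp add: m power_increasing del: power_Suc)
  have c: "comm h x \<in> Gam" "comm e x \<in> Gam" using Suc.prems x by simp_all
  have "((\<lambda>f. comm f x) ^^ N) (comm e x) \<in> st (Suc m)" using Suc.prems(3) by (simp only: funpow_Suc_right o_apply)
  note IH = Suc.IH[OF c this]
  show ?case
    apply (rule fnI, simp, unfold prog_nth body_less_def, (rule run' tz Suc.prems x fn_vcm IH)+)
    subgoal using x by (subst (2) dless_rec) (simp_all add: vb_def)
    subgoal by (simp add: algebra_simps)
    done
qed

lemma fn_less: assumes x: "odo x" and m: "Suc m \<le> n" and "h \<in> Gam" "e \<in> Gam"
  shows "fn 6 [PP n h, PP n e, PP n x, NN (Suc m)] (vb (dless x m h e)) (tl_less n)"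
proof (rule fn_mono[OF fn_less_aux[OF odo_Gam[OF x] m assms(3,4) iterate_comm_st[OF x assms(4)]]])
  have "dd (Suc m) \<le> 3 ^ Suc m" using dd_eq[of "Suc m"] by simp
  also have "\<dots> \<le> 3 ^ n" using m by (rule power_increasing) simp
  finally show "(dd (Suc m) + 1) * (3000 * 4 ^ n) \<le> tl_less n" unfolding tl_less_def by (intro mult_right_mono) simp_all
qed

lemma fn_tmul: assumes "ef A \<in> Gam" "ef B \<in> Gam" shows "fn 7 [EN n A, EN n B] (EN n (tmul A B)) (445 * 4 ^ n)"
  apply (rule fnI, simp, unfold prog_nth body_tmul_def, (rule run' fn_vpm assms)+)
  subgoal by (simp add: EN_def tmul_def nd_def)
  subgoal by simp
  done

lemma fn_tin: assumes "ef A \<in> Gam" shows "fn 8 [EN n A] (EN n (tinv A)) 20"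
  apply (rule fnI, simp, unfold prog_nth body_tin_def, (rule run')+)
  using assms by (simp_all add: EN_def tinv_def PP_def Gam_inv_inv)

lemma Gam_closed_simps:
  "ef A \<in> Gam \<Longrightarrow> ef B \<in> Gam \<Longrightarrow> ef (tmul A B) \<in> Gam" "ef A \<in> Gam \<Longrightarrow> ef (tinv A) \<in> Gam"
  "ef A \<in> Gam \<Longrightarrow> ef B \<in> Gam \<Longrightarrow> ef (tcm A B) \<in> Gam"
  by (simp_all del: o_apply)

lemma fn_tcm: assumes "ef A \<in> Gam" "ef B \<in> Gam" shows "fn 9 [EN n A, EN n B] (EN n (tcm A B)) (1400 * 4 ^ n)"
  apply (rule fnI, simp, unfold prog_nth body_tcm_def, (rule run' fn_tmul fn_tin assms Gam_closed_simps)+)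
  subgoal by (simp add: tcm_def)
  subgoal by simp
  done

definition tl_pick :: "nat \<Rightarrow> nat" where
  "tl_pick n = 3 * tl_less n + 1000 * 4 ^ n"

lemma fn_pick: assumes x: "odo (ef x)" and m: "Suc m \<le> n" and G: "ef H \<in> Gam" "ef E \<in> Gam"
  shows "fn 10 [EN n H, EN n E, EN n x, NN (Suc m)] (EN n (tpick x m H E)) (tl_pick n)"
proof -
  have p2: "fn 12 [EN n H, EN n A, EN n E, EN n x, NN (Suc m)]
      (if dless (ef x) m (ef A) (ef E) then EN n A else EN n H) (tl_less n + 20)" if "ef A \<in> Gam" for A
    apply (rule fnI, simp, unfold prog_nth body_pick2_def, (rule run' fn_less[OF x m] G that)+)
    by simp_all
  have p1: "fn 11 [EN n H, EN n A, EN n E, EN n x, NN (Suc m)]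
      (if dless (ef x) m (ef A) (ef E) then EN n A
       else if dless (ef x) m (ef (tmul A E)) (ef E) then EN n (tmul A E) else EN n H) (2 * tl_less n + 500 * 4 ^ n)"
    if "ef A \<in> Gam" for A
    by (rule fnI, simp, unfold prog_nth body_pick1_def, (rule run' fn_less[OF x m] p2 fn_tmul G that Gam_closed_simps)+) simp_all
  show ?thesis
    apply (rule fnI, simp, unfold prog_nth body_pick_def, (rule run' fn_less[OF x m] p1 fn_tmul G Gam_closed_simps)+)
    subgoal by (simp add: tpick_def del: o_apply ef_tmul)
    subgoal by (simp add: tl_pick_def)
    done
qed

lemma tpick_Gam: "ef H \<in> Gam \<Longrightarrow> ef E \<in> Gam \<Longrightarrow> ef (tpick x m H E) \<in> Gam"
  using tpick_cases[of x m H E] by (auto simp del: o_apply)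

lemma tsift_Gam: "ef H \<in> Gam \<Longrightarrow> \<forall>e\<in>set es. ef e \<in> Gam \<Longrightarrow> ef (tsift x m H es) \<in> Gam"
  by (rule tsift_closed[where R = "\<lambda>A. ef A \<in> Gam" and P = "\<lambda>A. ef A \<in> Gam"]) (rule Gam_closed_simps | assumption)+

lemma fn_sift: assumes x: "odo (ef x)" and m: "Suc m \<le> n"
  shows "ef H \<in> Gam \<Longrightarrow> \<forall>e\<in>set es. ef e \<in> Gam \<Longrightarrow>
    fn 13 [EN n H, LL n es, EN n x, NN (Suc m)] (EN n (tsift x m H es)) ((length es + 1) * (tl_pick n + 20))"
proof (induction es arbitrary: H)
  case Nil
  show ?case
    by (rule fnI, simp, unfold prog_nth body_sift_def, (rule run')+) simp_all
next
  case (Cons e es)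
  have G: "ef e \<in> Gam" "\<forall>e\<in>set es. ef e \<in> Gam" using Cons.prems by auto
  note IH = Cons.IH[OF tpick_Gam[OF Cons.prems(1) G(1)] G(2)]
  show ?case
    apply (rule fnI, simp, unfold prog_nth body_sift_def, (rule run' fn_pick[OF x m] IH G Cons.prems(1))+)
    by simp_all
qed

lemma fn_exp: "ef y \<in> Gam \<Longrightarrow> \<forall>X\<in>set Xs. ef X \<in> Gam \<Longrightarrow>
    fn 14 [EN n y, LL n Xs, LL n acc] (LL n (texp y Xs acc)) (4 ^ length Xs * (5000 * 4 ^ n))"
proof (induction Xs arbitrary: y acc)
  case Nil
  show ?case
    apply (rule fnI, simp, unfold prog_nth body_exp_def, (rule run')+)
    subgoal by (simp add: LL_def)
    subgoal using four_ge_1[of n] unfolding list.size power_0 by linarith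
    done
next
  case (Cons X Xs)
  have G: "ef X \<in> Gam" "\<forall>e\<in>set Xs. ef e \<in> Gam" using Cons.prems by auto
  note IH = Cons.IH[OF _ G(2)]
  have h: "4 ^ n \<le> (4::nat) ^ n * 4 ^ length Xs" by simp
  show ?case
    apply (rule fnI, simp, unfold prog_nth body_exp_def, (rule run' IH fn_tcm G Cons.prems(1) Gam_closed_simps)+)
    subgoal by simp
    subgoal by simp (use h four_ge_1[of n] in linarith)
    done
qed

lemma fn_pl: "ef x \<in> Gam \<Longrightarrow> fn 15 [EN n x, NN m, LL n acc] (LL n (tpl x m acc)) ((m + 1) * (1000 * 4 ^ n))"
proof (induction m arbitrary: x acc)
  case 0
  show ?case unfolding NN_simps
    apply (rule fnI, simp, unfold prog_nth body_pl_def, (rule run')+)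
    subgoal by simp
    subgoal using four_ge_1[of n] unfolding add_0_left mult_1 by linarith
    done
next
  case (Suc m)
  have "ef (tmul (tmul x x) x) \<in> Gam" using Suc.prems by (simp del: o_apply)
  note IH = Suc.IH[OF this, of "x # acc"]
  have IH': "fn 15 [EN n (tmul (tmul x x) x), NN m, Pr (EN n x) (LL n acc)] (LL n (tpl (tmul (tmul x x) x) m (x # acc))) ((m + 1) * (1000 * 4 ^ n))"
    using IH by (simp add: LL_def)
  show ?case unfolding NN_simps
    by (rule fnI, simp, unfold prog_nth body_pl_def, (rule run' IH' fn_tmul Suc.prems Gam_closed_simps)+) simp_all
qed

lemma fn_bb: assumes x: "odo (ef x)" and m: "Suc m \<le> n" and G: "ef c \<in> Gam" "ef r \<in> Gam"
  shows "fn 17 [EN n c, EN n r, EN n x, NN (Suc m)] (EN n (tbb x m c r)) (tl_less n + 20)"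
  apply (rule fnI, simp, unfold prog_nth body_bb_def, (rule run' fn_less[OF x m] G)+)
  by (simp_all add: tbb_def)

definition tl_bst :: "nat \<Rightarrow> nat \<Rightarrow> nat" where
  "tl_bst N n = 2 * ((N + 1) * (tl_pick n + 20)) + 3000 * 4 ^ n + 2 * tl_less n"

lemma fn_bst: assumes x: "odo (ef x)" and s: "ef s \<in> Gam" and m: "Suc (Suc m) \<le> n" and Y: "\<forall>e\<in>set Y. ef e \<in> Gam"
  shows "ef c \<in> Gam \<Longrightarrow> \<forall>e\<in>set es. ef e \<in> Gam \<Longrightarrow>
    fn 16 [EN n c, LL n es, LL n Y, EN n x, EN n s, NN (Suc m), NN (Suc (Suc m))] (EN n (tbst x s m Y c es))
      ((length es + 1) * tl_bst (length Y) n)"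
proof (induction es arbitrary: c)
  case Nil
  show ?case
    apply (rule fnI, simp, unfold prog_nth body_bst_def, (rule run')+)
    subgoal by simp
    subgoal by (simp add: tl_bst_def)
    done
next
  case (Cons e es)
  have G: "ef e \<in> Gam" "\<forall>e\<in>set es. ef e \<in> Gam" using Cons.prems by auto
  have xG: "ef x \<in> Gam" using x by (rule odo_Gam)
  have m': "Suc m \<le> n" using m by simp
  have t: "ef (tsift x m (tcm e t) Y) \<in> Gam" if "ef t \<in> Gam" for t
    by (intro tsift_Gam Gam_closed_simps G that Y)
  have b: "ef (tbb x k A B) \<in> Gam" if "ef A \<in> Gam" "ef B \<in> Gam" for k A B using that by (simp add: tbb_def)
  note IH = Cons.IH[OF b[OF b[OF Cons.prems(1) t[OF xG]] t[OF s]] G(2)]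
  show ?case
    apply (rule fnI, simp, unfold prog_nth body_bst_def,
      (rule run' IH fn_bb[OF x m] fn_sift[OF x m'] fn_tcm G Cons.prems(1) t b Gam_closed_simps xG s Y)+)
    subgoal by simp
    subgoal by (simp add: tl_bst_def)
    done
qed

definition tl_uu :: "nat \<Rightarrow> nat" where
  "tl_uu n = (n + 1) * (1000 * 4 ^ n) + 4 ^ n * (5000 * 4 ^ n) + 2000 * 4 ^ n + (3 ^ n + 1) * tl_bst (3 ^ n) n"

lemma tl_uu_ge: "1000 * 4 ^ n \<le> tl_uu n"
  by (simp add: tl_uu_def)

lemma tY_Gam: "ef x \<in> Gam \<Longrightarrow> ef s \<in> Gam \<Longrightarrow> 0 < m \<Longrightarrow> \<forall>e\<in>set (tY x s m). ef e \<in> Gam"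
  by (rule tY_closed[OF Gam_closed])

lemma tpl_Gam: "ef x \<in> Gam \<Longrightarrow> \<forall>e\<in>set (tpl x m []). ef e \<in> Gam"
  by (rule tpl_closed[where P = "\<lambda>A. ef A \<in> Gam"]) (simp_all del: o_apply)

lemma fn_uu: assumes x: "odo (ef x)" and s: "ef s \<in> Gam" and m: "Suc m \<le> n"
  shows "fn 18 [EN n x, EN n s, NN m] (EN n (tu x s m)) (tl_uu n)"
proof -
  have xG: "ef x \<in> Gam" using x by (rule odo_Gam)
  consider "m = 0" | "m = 1" | k where "m = Suc (Suc k)" by (metis One_nat_def old.nat.exhaust)
  then show ?thesis
  proof cases
    case 1
    show ?thesis unfolding 1 NN_simps
      apply (rule fnI, simp, unfold prog_nth body_uu_def, (rule run')+)
      subgoal by simp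
      subgoal using four_ge_1[of n] tl_uu_ge[of n] by linarith
      done
  next
    case 2
    show ?thesis unfolding 2 One_nat_def NN_simps
      apply (rule fnI, simp, unfold prog_nth body_uu_def, (rule run')+)
      subgoal by simp
      subgoal using four_ge_1[of n] tl_uu_ge[of n] by linarith
      done
  next
    case (3 k)
    define Y where "Y = tY x s (Suc k)"
    define Xs where "Xs = tpl x (Suc k) []"
    have Y_eq: "Y = texp (tcm s (hd Xs)) Xs []" by (simp only: Y_def tY_def Xs_def)
    have YG: "\<forall>e\<in>set Y. ef e \<in> Gam" unfolding Y_def by (rule tY_Gam[OF xG s]) simp
    have XG: "\<forall>e\<in>set Xs. ef e \<in> Gam" unfolding Xs_def by (rule tpl_Gam[OF xG])
    obtain X Xs' where X: "Xs = X # Xs'" "ef X \<in> Gam"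
      using XG by (metis Xs_def length_tpl length_greater_0_conv list.exhaust list.set_intros(1) zero_less_Suc add_Suc)
    have lX: "length Xs = Suc k" by (simp add: Xs_def)
    have lY: "length Y \<le> 3 ^ n" using m 3 by (simp add: Y_eq lX power_increasing del: power_Suc)
    have cG: "ef (tmul x (tinv x)) \<in> Gam" using xG by (intro Gam_closed_simps)
    have m3: "Suc (Suc (Suc k)) \<le> n" using m 3 by simp
    have b: "fn 16 [EN n (tmul x (tinv x)), LL n Y, LL n Y, EN n x, EN n s, NN m, Pr Nul (NN m)]
       (EN n (tu x s m)) ((3 ^ n + 1) * tl_bst (3 ^ n) n)"
    proof (rule fn_mono)
      show "fn 16 [EN n (tmul x (tinv x)), LL n Y, LL n Y, EN n x, EN n s, NN m, Pr Nul (NN m)]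
        (EN n (tu x s m)) ((length Y + 1) * tl_bst (length Y) n)"
        using fn_bst[OF x s m3 YG cG YG] by (simp add: 3 Y_def NN_simps)
      have "tl_bst (length Y) n \<le> tl_bst (3 ^ n) n" unfolding tl_bst_def
        by (intro add_mono mult_left_mono mult_right_mono lY order_refl) simp_all
      then show "(length Y + 1) * tl_bst (length Y) n \<le> (3 ^ n + 1) * tl_bst (3 ^ n) n"
        by (intro mult_mono add_mono lY) simp_all
    qed
    have u3: "fn 20 [EN n x, EN n s, NN m, LL n Y] (EN n (tu x s m)) ((3 ^ n + 1) * tl_bst (3 ^ n) n + 500 * 4 ^ n)"
      by (rule fnI, simp, unfold prog_nth body_uu3_def, (rule run' b fn_tmul fn_tin xG Gam_closed_simps)+) simp_all
    have hdXs: "fstr (LL n Xs) (EN n (hd Xs))" "ef (hd Xs) \<in> Gam" using X by (simp_all add: enc_fst_snd)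
    have e: "fn 14 [EN n (tcm s (hd Xs)), LL n Xs, Nul] (LL n Y) (4 ^ n * (5000 * 4 ^ n))"
    proof (rule fn_mono)
      show "fn 14 [EN n (tcm s (hd Xs)), LL n Xs, Nul] (LL n Y) (4 ^ length Xs * (5000 * 4 ^ n))"
        using fn_exp[of "tcm s (hd Xs)" Xs n "[]"] hdXs XG s by (simp add: Y_eq LL_def)
      show "4 ^ length Xs * (5000 * 4 ^ n) \<le> 4 ^ n * (5000 * (4::nat) ^ n)"
        unfolding lX using m 3 by (intro mult_right_mono power_increasing) simp_all
    qed
    have u2: "fn 19 [EN n x, EN n s, NN m, LL n Xs] (EN n (tu x s m))
        ((3 ^ n + 1) * tl_bst (3 ^ n) n + 1950 * 4 ^ n + 4 ^ n * (5000 * 4 ^ n))"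
      by (rule fnI, simp, unfold prog_nth body_uu2_def, (rule run' u3 e fn_tcm s hdXs)+) simp_all
    have p: "fn 15 [EN n x, NN (Suc k), Nul] (LL n Xs) ((n + 1) * (1000 * 4 ^ n))"
    proof (rule fn_mono)
      show "fn 15 [EN n x, NN (Suc k), Nul] (LL n Xs) ((Suc k + 1) * (1000 * 4 ^ n))"
        using fn_pl[OF xG, of n "Suc k" "[]"] by (simp add: Xs_def LL_def)
      show "(Suc k + 1) * (1000 * 4 ^ n) \<le> (n + 1) * (1000 * (4::nat) ^ n)" using m 3 by (intro mult_right_mono) simp_all
    qed
    have u2': "fn 19 [EN n x, EN n s, Pr Nul (Pr Nul (NN k)), LL n Xs] (EN n (tu x s m))
        ((3 ^ n + 1) * tl_bst (3 ^ n) n + 1950 * 4 ^ n + 4 ^ n * (5000 * 4 ^ n))"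
      using u2 3 by (simp add: NN_simps del: tu.simps)
    have p': "fn 15 [EN n x, Pr Nul (NN k), Nul] (LL n Xs) ((n + 1) * (1000 * 4 ^ n))"
      using p by (simp add: NN_simps)
    show ?thesis unfolding 3 NN_simps
      apply (rule fnI, simp, unfold prog_nth body_uu_def, (rule run' u2'[unfolded 3] p')+)
      subgoal by simp
      subgoal by (simp add: tl_uu_def)
      done
  qed
qed

definition tl_loop :: "nat \<Rightarrow> nat" where
  "tl_loop n = tl_uu n + (n + 1) * (1000 * 4 ^ n) + 4 ^ n * (5000 * 4 ^ n) + (3 ^ n + 1) * (tl_pick n + 20) + 100"

lemma fn_loop: assumes x: "odo (ef x)" and s: "ef s \<in> Gam"
  shows "k + m \<le> n \<Longrightarrow> ef g \<in> Gam \<Longrightarrow>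
    fn 21 [EN n g, EN n x, EN n s, NN k, NN m] (EN n (tloop x s k m g)) ((k + 1) * tl_loop n)"
proof (induction k arbitrary: m g)
  case 0
  show ?case unfolding NN_simps
    apply (rule fnI, simp, unfold prog_nth body_loop_def, (rule run')+)
    by (simp_all add: tl_loop_def)
next
  case (Suc k)
  have xG: "ef x \<in> Gam" using x by (rule odo_Gam)
  have m: "Suc m \<le> n" using Suc.prems(1) by simp
  have TG: "\<forall>e\<in>set (ttab x s m). ef e \<in> Gam" by (rule ttab_closed[OF Gam_closed xG s])
  have uG: "ef (tu x s m) \<in> Gam" by (rule tu_closed[OF Gam_closed xG s])
  have p: "fn 15 [EN n x, NN m, Nul] (LL n (tpl x m [])) ((n + 1) * (1000 * 4 ^ n))"
  proof (rule fn_mono)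
    show "fn 15 [EN n x, NN m, Nul] (LL n (tpl x m [])) ((m + 1) * (1000 * 4 ^ n))"
      using fn_pl[OF xG, of n m "[]"] by (simp add: LL_def)
    show "(m + 1) * (1000 * 4 ^ n) \<le> (n + 1) * (1000 * (4::nat) ^ n)" using m by (intro mult_right_mono) simp_all
  qed
  have e: "fn 14 [EN n (tu x s m), LL n (tpl x m []), Nul] (LL n (ttab x s m)) (4 ^ n * (5000 * 4 ^ n))"
  proof (rule fn_mono)
    show "fn 14 [EN n (tu x s m), LL n (tpl x m []), Nul] (LL n (ttab x s m)) (4 ^ length (tpl x m []) * (5000 * 4 ^ n))"
      using fn_exp[OF uG tpl_Gam[OF xG], of n m "[]"] by (simp add: ttab_def LL_def)
    show "4 ^ length (tpl x m []) * (5000 * 4 ^ n) \<le> 4 ^ n * (5000 * (4::nat) ^ n)"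
      using m by (intro mult_right_mono power_increasing) simp_all
  qed
  have si: "fn 13 [EN n g, LL n (ttab x s m), EN n x, Pr Nul (NN m)] (EN n (tsift x m g (ttab x s m))) ((3 ^ n + 1) * (tl_pick n + 20))"
  proof (rule fn_mono)
    show "fn 13 [EN n g, LL n (ttab x s m), EN n x, Pr Nul (NN m)] (EN n (tsift x m g (ttab x s m)))
       ((length (ttab x s m) + 1) * (tl_pick n + 20))"
      using fn_sift[OF x m Suc.prems(2) TG] by (simp add: NN_simps)
    show "(length (ttab x s m) + 1) * (tl_pick n + 20) \<le> (3 ^ n + 1) * (tl_pick n + 20)"
      using m by (intro mult_right_mono add_mono) (simp_all add: power_increasing)
  qed
  have IH: "fn 21 [EN n (tsift x m g (ttab x s m)), EN n x, EN n s, NN k, Pr Nul (NN m)]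
     (EN n (tloop x s k (Suc m) (tsift x m g (ttab x s m)))) ((k + 1) * tl_loop n)"
    using Suc.IH[of "Suc m", OF _ tsift_Gam[OF Suc.prems(2) TG]] Suc.prems(1) by (simp add: NN_simps)
  show ?case unfolding NN_simps(2)[of k]
    apply (rule fnI, simp, unfold prog_nth body_loop_def, (rule run' IH si e p fn_uu[OF x s m])+)
    by (simp_all add: tl_loop_def)
qed

lemma fn_flat: "fn 22 [t, acc] (foldr Pr (flat t) acc) (20 * val_size t)"
proof (induction t arbitrary: acc rule: flat.induct)
  case 1
  show ?case by (rule fnI, simp, unfold prog_nth body_flat_def, (rule run)+) simp_all
next
  case (2 p)
  show ?case by (rule fnI, simp, unfold prog_nth body_flat_def, (rule run)+) simp_all
next
  case (3 t v r)
  show ?case by (rule fnI, simp, unfold prog_nth body_flat_def, (rule run 3)+) simp_all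
qed

lemma pb_tl_loop: "pb tl_loop"
  unfolding tl_loop_def tl_uu_def tl_bst_def tl_pick_def tl_less_def by (intro pb_intros)

section \<open>Inverses as positive powers\<close>

definition HN :: "nat \<Rightarrow> elt \<Rightarrow> val" where
  "HN n A = Pr (portrait n (ef A)) (wt A)"

text \<open>The inverse word is left empty, since this product serves to construct it.\<close>

definition hmul :: "elt \<Rightarrow> elt \<Rightarrow> elt" where
  "hmul A B = Elt (ef A \<circ> ef B) (nd (wt A) (wt B)) Nul"

text \<open>If \<open>q\<close> is the power of \<open>f\<close> with exponent \<open>3 ^ j - 1\<close> and \<open>p\<close> the one with exponent \<open>3 ^ j\<close>,
  then \<open>pv k q p\<close> is the power with exponent \<open>3 ^ (j + k) - 1\<close>.\<close>

fun pv :: "nat \<Rightarrow> elt \<Rightarrow> elt \<Rightarrow> elt" where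
  "pv 0 q p = q"
| "pv (Suc k) q p = pv k (hmul (hmul q p) p) (hmul (hmul p p) p)"

text \<open>The start has exponents \<open>3 ^ 1 - 1\<close> and \<open>3 ^ 1\<close>, so
  \<open>n - 1\<close> rounds end at exponent \<open>3 ^ n - 1\<close>. This is an inverse on level
  \<open>n\<close>, where the power with exponent \<open>3 ^ n\<close> is trivial.\<close>

definition pinv :: "nat \<Rightarrow> (vertex \<Rightarrow> vertex) \<Rightarrow> val \<Rightarrow> elt" where
  "pinv n f w = pv (n - 1) (hmul (Elt f w Nul) (Elt f w Nul)) (hmul (hmul (Elt f w Nul) (Elt f w Nul)) (Elt f w Nul))"

definition mk :: "nat \<Rightarrow> (vertex \<Rightarrow> vertex) \<Rightarrow> val \<Rightarrow> elt" where
  "mk n f w = Elt f w (wt (pinv n f w))"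

lemma ef_hmul [simp]: "ef (hmul A B) = ef A \<circ> ef B"
  by (simp add: hmul_def)

lemma pv_Gam: "ef q \<in> Gam \<Longrightarrow> ef p \<in> Gam \<Longrightarrow> ef (pv k q p) \<in> Gam"
  by (induction k arbitrary: q p) (simp_all del: o_apply)

lemma pinv_Gam: "f \<in> Gam \<Longrightarrow> ef (pinv n f w) \<in> Gam"
  unfolding pinv_def by (rule pv_Gam) (simp_all del: o_apply)

lemma pv_inverse: "ef q \<circ> f = ef p \<Longrightarrow> ef p \<circ> f = f \<circ> ef p \<Longrightarrow> ef (pv k q p) \<circ> f = pw (ef p) k"
proof (induction k arbitrary: q p)
  case (Suc k)
  let ?P = "ef p"
  have c: "?P (f w) = f (?P w)" for w using Suc.prems(2) by (metis comp_apply)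
  have q: "ef q (f w) = ?P w" for w using Suc.prems(1) by (metis comp_apply)
  have "ef (hmul (hmul q p) p) \<circ> f = ef (hmul (hmul p p) p)" by (simp add: fun_eq_iff c q)
  moreover have "ef (hmul (hmul p p) p) \<circ> f = f \<circ> ef (hmul (hmul p p) p)" by (simp add: fun_eq_iff c)
  ultimately have "ef (pv k (hmul (hmul q p) p) (hmul (hmul p p) p)) \<circ> f = pw (ef (hmul (hmul p p) p)) k"
    by (rule Suc.IH)
  moreover have "pw (ef (hmul (hmul p p) p)) k = pw (ef p) (Suc k)"
    unfolding pw_Suc_right by (simp add: cube_def)
  ultimately show ?case by (simp del: o_apply)
qed simp

lemma pinv_inverse: assumes "f \<in> Gam" "0 < n" "length w = n" shows "ef (pinv n f v) w = iv f w"
proof -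
  have "ef (pinv n f v) \<circ> f = pw (f \<circ> f \<circ> f) (n - 1)"
    unfolding pinv_def by (subst pv_inverse) (simp_all add: fun_eq_iff)
  also have "\<dots> = pw f n" using assms(2) by (cases n) (simp_all add: pw_Suc_right cube_def del: o_apply)
  finally have "ef (pinv n f v) (f u) = pw f n u" for u by (metis comp_apply)
  moreover have "pw f n u = u" if "length u = n" for u using st_app[OF pw_st[OF assms(1)]] that by simp
  moreover have "length (iv f w) = n" using assms by simp
  ultimately have "ef (pinv n f v) (f (iv f w)) = iv f w" by metis
  then show ?thesis using assms(1) by simp
qed

lemma VL_inj: "VL i = VL j \<longleftrightarrow> i = j"
  using letter_cases[of i] letter_cases[of j] by (auto simp: VL_simps)

lemma portrait_eq_iff: "f \<in> Gam \<Longrightarrow> g \<in> Gam \<Longrightarrow> portrait n f = portrait n g \<longleftrightarrow> (\<forall>w. length w = n \<longrightarrow> f w = g w)"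
proof (induction n arbitrary: f g)
  case (Suc n)
  have "portrait (Suc n) f = portrait (Suc n) g \<longleftrightarrow> al f = al g \<and> (\<forall>i. portrait n (sec f i) = portrait n (sec g i))"
    using Suc.prems by (auto simp: portrait_Suc VL_inj letter_all simp del: portrait.simps)
  also have "\<dots> \<longleftrightarrow> al f = al g \<and> (\<forall>i w. length w = n \<longrightarrow> sec f i w = sec g i w)"
    using Suc by simp
  also have "\<dots> \<longleftrightarrow> (\<forall>i w. length w = n \<longrightarrow> f (i # w) = g (i # w))"
    using Suc.prems Ex_list_of_length[of n] by (simp add: Gam_Cons) blast
  also have "\<dots> \<longleftrightarrow> (\<forall>w. length w = Suc n \<longrightarrow> f w = g w)"
    by (metis length_Suc_conv length_Cons)
  finally show ?case .
qed simp

lemma fn_hm: assumes "ef A \<in> Gam" "ef B \<in> Gam" shows "fn 23 [HN n A, HN n B] (HN n (hmul A B)) (250 * 4 ^ n)"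
  unfolding HN_def
  apply (rule fnI, simp, unfold prog_nth body_hm_def, (rule run' fn_pm assms)+)
  subgoal by (simp add: hmul_def nd_def)
  subgoal by simp
  done

lemma fn_pinv: "ef q \<in> Gam \<Longrightarrow> ef p \<in> Gam \<Longrightarrow> fn 24 [NN k, HN n q, HN n p] (HN n (pv k q p)) ((k + 1) * (1200 * 4 ^ n))"
proof (induction k arbitrary: q p)
  case 0
  show ?case unfolding NN_simps
    apply (rule fnI, simp, unfold prog_nth body_pinv_def, (rule run')+)
    subgoal by simp
    subgoal using four_ge_1[of n] unfolding add_0_left mult_1 by linarith
    done
next
  case (Suc k)
  have G: "ef (hmul A B) \<in> Gam" if "ef A \<in> Gam" "ef B \<in> Gam" for A B using that by (simp del: o_apply)
  note IH = Suc.IH[OF G[OF G[OF Suc.prems] Suc.prems(2)] G[OF G[OF Suc.prems(2) Suc.prems(2)] Suc.prems(2)]]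
  show ?case unfolding NN_simps
    by (rule fnI, simp, unfold prog_nth body_pinv_def, (rule run' fn_hm IH Suc.prems G)+) simp_all
qed

lemma fn_mkt: assumes f: "f \<in> Gam" and n: "n = Suc k"
  shows "fn 25 [NN n, portrait n f, w] (EN n (mk n f w)) ((n + 1) * (1200 * 4 ^ n))"
proof -
  define A where "A = Elt f w Nul"
  have A: "ef A \<in> Gam" using f by (simp add: A_def)
  have H: "HN n A = Pr (portrait n f) w" by (simp add: A_def HN_def)
  have G: "ef (hmul A B) \<in> Gam" if "ef A \<in> Gam" "ef B \<in> Gam" for A B using that by (simp del: o_apply)
  have p: "fn 24 [NN k, HN n (hmul A A), HN n (hmul (hmul A A) A)] (HN n (pinv n f w)) ((k + 1) * (1200 * 4 ^ n))"
    using fn_pinv[OF G[OF A A] G[OF G[OF A A] A], of k n] by (simp add: pinv_def A_def n)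
  have "portrait n (ef (pinv n f w)) = portrait n (iv f)"
    using f n by (subst portrait_eq_iff) (simp_all add: pinv_Gam pinv_inverse)
  then have E: "EN n (mk n f w) = Pr (Pr (portrait n f) (portrait n (ef (pinv n f w)))) (Pr w (wt (pinv n f w)))"
    by (simp add: EN_def mk_def PP_def)
  have c: "fn 26 [Pr (portrait n f) w, HN n (pinv n f w)] (EN n (mk n f w)) 30" unfolding E
    unfolding HN_def
    by (rule fnI, simp, unfold prog_nth body_comb_def, (rule run')+) simp_all
  have hm1: "fn 23 [Pr (portrait n f) w, Pr (portrait n f) w] (HN n (hmul A A)) (250 * 4 ^ n)" using fn_hm[OF A A, of n] by (simp only: H)
  have hm2: "fn 23 [HN n (hmul A A), Pr (portrait n f) w] (HN n (hmul (hmul A A) A)) (250 * 4 ^ n)"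
    using fn_hm[OF G[OF A A] A, of n] by (simp only: H)
  have nn: "sndr (NN n) (NN k)" by (simp add: n sndr_def NN_simps)
  show ?thesis
    apply (rule fnI, simp, unfold prog_nth body_mkt_def, (rule run' nn c p hm1 hm2)+)
    subgoal by simp
    subgoal by (simp add: n del: power_Suc)
    done
qed

text \<open>A node has at most 22 units outside its three subportraits, and
  \<open>3 * 11 = 22 + 11\<close>; hence the summand 11.\<close>

lemma val_size_portrait: "f \<in> Gam \<Longrightarrow> val_size (portrait n f) + 11 \<le> 12 * 3 ^ n"
proof (induction n arbitrary: f)
  case (Suc n)
  have v: "val_size (VL i) \<le> 5" for i using letter_cases[of i] by (auto simp: VL_simps)
  have "val_size (portrait n (sec f i)) + 11 \<le> 12 * 3 ^ n" for i using Suc by simp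
  from this[of 0] this[of 1] this[of "- 1"] show ?case
    unfolding portrait_Suc[OF Suc.prems] val_size.simps using v[of "al f"] v[of "1 + al f"] v[of "- 1 + al f"] by simp
qed simp

lemma pv_size: "val_size (wt q) \<le> val_size (wt p) \<Longrightarrow> val_size (wt (pv k q p)) + 3 \<le> (val_size (wt p) + 3) * 3 ^ k"
proof (induction k arbitrary: q p)
  case (Suc k)
  have "val_size (wt (hmul (hmul q p) p)) \<le> val_size (wt (hmul (hmul p p) p))"
    using Suc.prems by (simp add: hmul_def nd_def)
  from Suc.IH[OF this] show ?case by (simp add: hmul_def nd_def algebra_simps)
qed simp

lemma pinv_size: "0 < n \<Longrightarrow> val_size (wt (pinv n f w)) \<le> (val_size w + 3) * 3 ^ n"
proof -
  assume n: "0 < n"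
  let ?A = "Elt f w Nul"
  have "val_size (wt (hmul ?A ?A)) \<le> val_size (wt (hmul (hmul ?A ?A) ?A))" by (simp add: hmul_def nd_def)
  from pv_size[OF this, of "n - 1"] have "val_size (wt (pinv n f w)) \<le> (val_size (wt (hmul (hmul ?A ?A) ?A)) + 3) * 3 ^ (n - 1)"
    by (simp add: pinv_def)
  also have "\<dots> = (val_size w + 3) * (3 * 3 ^ (n - 1))" by (simp add: hmul_def nd_def)
  also have "3 * 3 ^ (n - 1) = (3::nat) ^ n" using n by (cases n) simp_all
  finally show ?thesis .
qed

definition sz0 :: "nat \<Rightarrow> nat" where
  "sz0 n = (12 * 3 ^ n + 3) * 3 ^ n"

lemma szle_mk: assumes "f \<in> Gam" "0 < n" shows "szle (sz0 n) (mk n f (Pr Nul (portrait n f)))"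
proof -
  have a: "val_size (Pr Nul (portrait n f)) \<le> 12 * 3 ^ n" using val_size_portrait[OF assms(1), of n] by simp
  have "12 * 3 ^ n * 1 \<le> (12 * 3 ^ n + 3) * (3::nat) ^ n" by (intro mult_mono) simp_all
  then have "val_size (Pr Nul (portrait n f)) \<le> sz0 n" using a unfolding sz0_def by linarith
  moreover have "val_size (wt (pinv n f (Pr Nul (portrait n f)))) \<le> sz0 n"
    unfolding sz0_def by (rule order_trans[OF pinv_size[OF assms(2)]]) (intro mult_right_mono add_right_mono a, simp)
  ultimately show ?thesis by (simp add: szle_def mk_def)
qed

lemma pv_words:
  assumes P: "\<And>A B. P A \<Longrightarrow> P B \<Longrightarrow> P (hmul A B)"
  shows "P q \<Longrightarrow> P p \<Longrightarrow> P (pv k q p)"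
proof (induction k arbitrary: q p)
  case (Suc k)
  have "P (hmul (hmul q p) p)" "P (hmul (hmul p p) p)" using P Suc.prems by blast+
  then show ?case unfolding pv.simps by (rule Suc.IH)
qed simp

lemma valid_mk: assumes S: "S \<subseteq> Gam" "f \<in> S" and n: "0 < n" shows "valid S n id (mk n f (Pr Nul (portrait n f)))"
proof -
  let ?w = "Pr Nul (portrait n f)"
  define P where "P A \<longleftrightarrow> (\<exists>l. set l \<subseteq> S \<and> flat (wt A) = map (portrait n) l \<and> (\<forall>w. wprod l w = ef A w))" for A
  have PH: "P (hmul A B)" if AB: "P A" "P B" for A B
  proof -
    obtain l k where "set l \<subseteq> S" "flat (wt A) = map (portrait n) l" "\<And>w. wprod l w = ef A w"
      "set k \<subseteq> S" "flat (wt B) = map (portrait n) k" "\<And>w. wprod k w = ef B w" using AB unfolding P_def by blast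
    then show ?thesis unfolding P_def by (intro exI[of _ "l @ k"]) (simp add: hmul_def wprod_append)
  qed
  have "P (Elt f ?w Nul)" unfolding P_def using S by (intro exI[of _ "[f]"]) (simp add: wprod_def)
  then have "P (pinv n f ?w)" unfolding pinv_def by (intro pv_words[where P = P, OF PH] PH)
  then obtain k where k: "set k \<subseteq> S" "flat (wt (pinv n f ?w)) = map (portrait n) k" "\<And>w. wprod k w = ef (pinv n f ?w) w"
    unfolding P_def by blast
  have "f \<in> Gam" using S by blast
  then show ?thesis unfolding valid_def
    by (intro conjI exI[of _ "[f]"] exI[of _ k])
      (use S k n in \<open>simp_all add: mk_def wprod_def[of "[f]"] pinv_inverse inv_id\<close>)
qed

section \<open>Choosing two generators\<close>

lemma fn_succ3: "fn 28 [VL i] (VL (i + 1)) 20"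
  using letter_cases[of i]
proof (elim disjE)
  show ?thesis if "i = 0" unfolding that VL_simps
    by (rule fnI, simp, unfold prog_nth body_succ3_def, (rule run)+) (simp_all add: VL_simps)
  show ?thesis if "i = 1" unfolding that VL_simps
    by (rule fnI, simp, unfold prog_nth body_succ3_def, (rule run)+) (simp_all add: VL_simps)
  show ?thesis if "i = - 1" unfolding that VL_simps
    by (rule fnI, simp, unfold prog_nth body_succ3_def, (rule run)+) (simp_all add: VL_simps)
qed

lemma fn_add3: "fn 29 [VL i, VL j] (VL (i + j)) 90"
  apply (rule fnI, simp, unfold prog_nth body_add3_def, (rule run evif_VL VL_fst_snd fn_succ3)+)
  subgoal using letter_cases[of i] letter_double[of "1::letter"] by (auto simp: algebra_simps)
  subgoal by simp
  done

lemma fn_be: assumes "f \<in> Gam" shows "fn 30 [portrait (Suc (Suc k)) f] (VL (be f)) 250"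
  unfolding portrait_Suc[OF assms] portrait_Suc[OF sec_in_Gam[OF assms]]
  apply (rule fnI, simp, unfold prog_nth body_be_def, (rule run fn_add3)+)
  by (simp_all add: be_def add.assoc)

lemma evif_VL_nz: "i \<noteq> 0 \<Longrightarrow> ev env e1 v B \<Longrightarrow> evif (VL i) env e1 e2 v B"
  using letter_cases[of i] by (auto simp: evif_def VL_simps)

lemma evif_VL_0: "ev env e2 v B \<Longrightarrow> evif (VL 0) env e1 e2 v B"
  by (simp add: evif_def VL_simps)

text \<open>Gaussian elimination in the abelianisation: multiples of \<open>(c, d)\<close> are added
  to \<open>(a, b)\<close> until the first coordinate vanishes, and the second one is returned. It
  vanishes exactly when the two vectors are dependent (\<open>rdv_eq_0\<close>).\<close>

definition rdv :: "letter \<Rightarrow> letter \<Rightarrow> letter \<Rightarrow> letter \<Rightarrow> letter" where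
  "rdv a b c d = (if a = 0 then b else if a + c = 0 then b + d else b + d + d)"

lemma rdv_eq_0: "c \<noteq> 0 \<Longrightarrow> rdv a b c d = 0 \<longleftrightarrow> b * c - a * d = 0"
  by (cases a; cases b; cases c; cases d) (simp_all add: rdv_def letter_simps)

lemma letter_third: "a \<noteq> 0 \<Longrightarrow> c \<noteq> 0 \<Longrightarrow> a + c \<noteq> 0 \<Longrightarrow> a + c + c = (0::letter)"
  by (cases a; cases c) (simp_all add: letter_simps)

lemma fn_rd: assumes "c \<noteq> 0" shows "fn 31 [VL a, VL b, VL c, VL d] (VL (rdv a b c d)) 700"
proof -
  have 0: "fn 31 [VL 0, VL b, VL c, VL d] (VL b) 10" for b
    by (rule fnI, simp, unfold prog_nth body_rd_def, (rule run evif_VL_0)+) simp_all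
  have 1: "fn 31 [VL a, VL b, VL c, VL d] (VL (b + d)) 230" if "a \<noteq> 0" "a + c = 0" for a b
    by (rule fnI, simp, unfold prog_nth body_rd_def, (rule run evif_VL_nz[OF that(1)] fn_add3 0[of "b + d", folded that(2)])+) simp_all
  have 2: "fn 31 [VL a, VL b, VL c, VL d] (VL (b + d + d)) 450" if "a \<noteq> 0" "a + c \<noteq> 0" for a b
    by (rule fnI, simp, unfold prog_nth body_rd_def,
      (rule run evif_VL_nz[OF that(1)] fn_add3 1[OF that(2) letter_third[OF that(1) assms that(2)]])+) simp_all
  show ?thesis unfolding rdv_def using fn_mono[OF 0] fn_mono[OF 1] fn_mono[OF 2] by auto
qed

definition PL :: "nat \<Rightarrow> (vertex \<Rightarrow> vertex) list \<Rightarrow> val" where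
  "PL n fs = val_of_list (map (portrait n) fs)"

lemma PL_fst_snd: "fstr (PL n (f # fs)) (portrait n f)" "sndr (PL n (f # fs)) (PL n fs)"
  "ev env e1 v B \<Longrightarrow> evif (PL n (f # fs)) env e1 e2 v B"
  by (simp_all add: PL_def fstr_def sndr_def evif_def)

lemma fstr_portrait: "f \<in> Gam \<Longrightarrow> fstr (portrait (Suc k) f) (VL (al f))"
  by (simp add: fstr_def portrait_Suc del: portrait.simps)

lemma fn_fp: "set fs \<subseteq> Gam \<Longrightarrow> \<exists>f\<in>set fs. al f \<noteq> 0 \<Longrightarrow>
  \<exists>f\<in>set fs. al f \<noteq> 0 \<and> fn 27 [PL (Suc k) fs] (portrait (Suc k) f) ((length fs + 1) * 30)"
proof (induction fs)
  case (Cons f fs)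
  have f: "f \<in> Gam" using Cons.prems by simp
  show ?case
  proof (cases "al f = 0")
    case True
    then obtain g where g: "g \<in> set fs" "al g \<noteq> 0" "fn 27 [PL (Suc k) fs] (portrait (Suc k) g) ((length fs + 1) * 30)"
      using Cons by auto
    have "fn 27 [PL (Suc k) (f # fs)] (portrait (Suc k) g) ((length (f # fs) + 1) * 30)"
      by (rule fnI, simp, unfold prog_nth body_fp_def,
        (rule run PL_fst_snd fstr_portrait[OF f, unfolded True] evif_VL_0 g)+) simp_all
    then show ?thesis using g by auto
  next
    case False
    have "fn 27 [PL (Suc k) (f # fs)] (portrait (Suc k) f) ((length (f # fs) + 1) * 30)"
      by (rule fnI, simp, unfold prog_nth body_fp_def,
        (rule run PL_fst_snd fstr_portrait[OF f] evif_VL_nz[OF False])+) simp_all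
    then show ?thesis using False by auto
  qed
qed simp

lemma fn_f2: assumes p: "p \<in> Gam" "al p \<noteq> 0"
  shows "set fs \<subseteq> Gam \<Longrightarrow> \<exists>q\<in>set fs. rdv (al q) (be q) (al p) (be p) \<noteq> 0 \<Longrightarrow>
    \<exists>q\<in>set fs. rdv (al q) (be q) (al p) (be p) \<noteq> 0 \<and>
      fn 32 [PL (Suc (Suc k)) fs, portrait (Suc (Suc k)) p] (portrait (Suc (Suc k)) q) ((length fs + 1) * 1600)"
proof (induction fs)
  case (Cons f fs)
  let ?n = "Suc (Suc k)"
  have f: "f \<in> Gam" using Cons.prems by simp
  note rd = fn_rd[OF p(2), of "al f" "be f" "be p"]
  show ?case
  proof (cases "rdv (al f) (be f) (al p) (be p) = 0")
    case True
    then obtain g where g: "g \<in> set fs" "rdv (al g) (be g) (al p) (be p) \<noteq> 0"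
      "fn 32 [PL ?n fs, portrait ?n p] (portrait ?n g) ((length fs + 1) * 1600)"
      using Cons by auto
    have "fn 32 [PL ?n (f # fs), portrait ?n p] (portrait ?n g) ((length (f # fs) + 1) * 1600)"
      by (rule fnI, simp, unfold prog_nth body_f2_def,
        (rule run PL_fst_snd fstr_portrait[OF f] fstr_portrait[OF p(1)] fn_be f p(1) rd[unfolded True] evif_VL_0 g)+) simp_all
    then show ?thesis using g by auto
  next
    case False
    have "fn 32 [PL ?n (f # fs), portrait ?n p] (portrait ?n f) ((length (f # fs) + 1) * 1600)"
      by (rule fnI, simp, unfold prog_nth body_f2_def,
        (rule run PL_fst_snd fstr_portrait[OF f] fstr_portrait[OF p(1)] fn_be f p(1) rd evif_VL_nz[OF False])+) simp_all
    then show ?thesis using False by auto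
  qed
qed simp

lemma fstr_PP: "f \<in> Gam \<Longrightarrow> n = Suc k \<Longrightarrow> fstr (portrait n f) (VL (al f))"
  using fstr_portrait by simp

lemma fn_rs: assumes n: "n = Suc k" and G: "ef A \<in> Gam" "ef B \<in> Gam" "al (ef B) \<noteq> 0"
  shows "\<exists>C\<in>{A, tmul A B, tmul (tmul A B) B}. al (ef C) = 0 \<and> be (ef C) = rdv (al (ef A)) (be (ef A)) (al (ef B)) (be (ef B)) \<and>
    fn 33 [EN n A, EN n B] (EN n C) (1500 * 4 ^ n)"
proof -
  have 0: "fn 33 [EN n A, EN n B] (EN n A) 20" if "ef A \<in> Gam" "al (ef A) = 0" for A
    by (rule fnI, simp, unfold prog_nth body_rs_def, (rule run' fstr_PP[OF that(1) n, unfolded that(2)] evif_VL_0)+) simp_all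
  have s: "fn 33 [EN n A, EN n B] v (c + 460 * 4 ^ n)" if "ef A \<in> Gam" "al (ef A) \<noteq> 0" "fn 33 [EN n (tmul A B), EN n B] v c" for A v c
    by (rule fnI, simp, unfold prog_nth body_rs_def,
      (rule run' fstr_PP[OF that(1) n] evif_VL_nz[OF that(2)] fn_tmul G(2) that(1,3))+) simp_all
  have G': "ef (tmul A B) \<in> Gam" "ef (tmul (tmul A B) B) \<in> Gam" by (rule Gam_closed_simps G)+
  have a: "al (ef (tmul A B)) = al (ef A) + al (ef B)" "be (ef (tmul A B)) = be (ef A) + be (ef B)"
    "al (ef (tmul (tmul A B) B)) = al (ef A) + al (ef B) + al (ef B)" "be (ef (tmul (tmul A B) B)) = be (ef A) + be (ef B) + be (ef B)"
    using G G' by (simp_all add: al_comp be_comp del: o_apply)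
  consider "al (ef A) = 0" | "al (ef A) \<noteq> 0" "al (ef A) + al (ef B) = 0" | "al (ef A) \<noteq> 0" "al (ef A) + al (ef B) \<noteq> 0" by blast
  then show ?thesis
  proof cases
    case 1
    have "fn 33 [EN n A, EN n B] (EN n A) (1500 * 4 ^ n)" by (rule fn_mono[OF 0[OF G(1) 1]]) simp
    then show ?thesis using 1 by (auto simp: rdv_def)
  next
    case 2
    have "fn 33 [EN n A, EN n B] (EN n (tmul A B)) (1500 * 4 ^ n)"
      by (rule fn_mono[OF s[OF G(1) 2(1) 0[OF G'(1)]]]) (simp_all add: a 2 del: ef_tmul)
    then show ?thesis using 2 a by (auto simp: rdv_def simp del: ef_tmul)
  next
    case 3
    have "fn 33 [EN n A, EN n B] (EN n (tmul (tmul A B) B)) (1500 * 4 ^ n)"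
      by (rule fn_mono[OF s[OF G(1) 3(1) s[OF G'(1) _ 0[OF G'(2)]]]])
        (simp_all add: a 3 letter_third[OF 3(1) G(3) 3(2)] del: ef_tmul)
    then show ?thesis using 3 a letter_third[OF 3(1) G(3) 3(2)] by (auto simp: rdv_def simp del: ef_tmul)
  qed
qed

lemma fn_rx: assumes n: "n = Suc (Suc k)" and G: "ef X \<in> Gam" "ef s \<in> Gam" "be (ef s) \<noteq> 0"
  shows "\<exists>C\<in>{X, tmul X s, tmul (tmul X s) s}. be (ef C) = 1 \<and> fn 34 [EN n X, EN n s] (EN n C) (2900 * 4 ^ n)"
proof -
  have b: "fn 30 [portrait n f] (VL (be f)) 250" if "f \<in> Gam" for f using fn_be[OF that] n by simp
  have 0: "fn 34 [EN n A, EN n s] (EN n A) 600" if A: "ef A \<in> Gam" "be (ef A) = 1" for A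
  proof -
    have 1: "(1::letter) \<noteq> 0" "((1::letter) = - 1) = False" by simp_all
    have i: "sndr (VL 1) Nul" by (simp add: sndr_def VL_simps)
    show ?thesis
      by (rule fnI, simp, unfold prog_nth body_rx_def, (rule run' b[OF A(1), unfolded A(2)] evif_VL_nz[OF 1(1)] A(1) i)+) simp_all
  qed
  have s: "fn 34 [EN n A, EN n s] v (c + 1100 * 4 ^ n)"
    if A: "ef A \<in> Gam" "be (ef A) \<noteq> 1" and c: "fn 34 [EN n (tmul A s), EN n s] v c" for A v c
  proof (cases "be (ef A) = 0")
    case True
    show ?thesis
      by (rule fnI, simp, unfold prog_nth body_rx_def,
        (rule run' b[OF A(1), unfolded True] evif_VL_0 fn_tmul A(1) G(2) c)+) simp_all
  next
    case False
    then have m1: "be (ef A) = - 1" using A(2) letter_cases by blast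
    have i: "sndr (VL (- 1)) (Pr Nul Nul)" "(- 1 :: letter) \<noteq> 0" by (simp_all add: sndr_def VL_simps)
    show ?thesis
      by (rule fnI, simp, unfold prog_nth body_rx_def,
        (rule run' b[OF A(1), unfolded m1] evif_VL_nz[OF i(2)] i(1) fn_tmul A(1) G(2) c)+) simp_all
  qed
  have G': "ef (tmul X s) \<in> Gam" "ef (tmul (tmul X s) s) \<in> Gam" by (rule Gam_closed_simps G)+
  have a: "be (ef (tmul X s)) = be (ef X) + be (ef s)" "be (ef (tmul (tmul X s) s)) = be (ef X) + be (ef s) + be (ef s)"
    using G G' by (simp_all add: be_comp del: o_apply)
  have third: "be (ef X) + be (ef s) + be (ef s) = 1" if "be (ef X) \<noteq> 1" "be (ef X) + be (ef s) \<noteq> 1"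
    using that G(3) by (cases "be (ef X)"; cases "be (ef s)") (simp_all add: letter_simps)
  consider "be (ef X) = 1" | "be (ef X) \<noteq> 1" "be (ef X) + be (ef s) = 1" | "be (ef X) \<noteq> 1" "be (ef X) + be (ef s) \<noteq> 1" by blast
  then show ?thesis
  proof cases
    case 1
    have "fn 34 [EN n X, EN n s] (EN n X) (2900 * 4 ^ n)" by (rule fn_mono[OF 0[OF G(1) 1]]) simp
    then show ?thesis using 1 by auto
  next
    case 2
    have "fn 34 [EN n X, EN n s] (EN n (tmul X s)) (2900 * 4 ^ n)"
      by (rule fn_mono[OF s[OF G(1) 2(1) 0[OF G'(1)]]]) (simp_all add: a 2 del: ef_tmul)
    then show ?thesis using 2 a by (auto simp del: ef_tmul)
  next
    case 3
    have "fn 34 [EN n X, EN n s] (EN n (tmul (tmul X s) s)) (2900 * 4 ^ n)"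
      by (rule fn_mono[OF s[OF G(1) 3(1) s[OF G'(1) _ 0[OF G'(2)]]]]) (simp_all add: a 3 third[OF 3] del: ef_tmul)
    then show ?thesis using third[OF 3] a by (auto simp del: ef_tmul)
  qed
qed

section \<open>The main function of the program\<close>

definition tl_main :: "nat \<Rightarrow> nat" where
  "tl_main n = 3 * ((n + 1) * (1200 * 4 ^ n)) + (n + 1) * tl_loop n + 20 * SL (8 * sz0 n + 21) n + 7000 * 4 ^ n"

lemma length_flat: "length (flat t) \<le> val_size t"
  by (induction t rule: flat.induct) simp_all

lemma foldr_Pr: "foldr Pr ps Nul = val_of_list ps"
  by (induction ps) simp_all

lemma fn_mk1: "f \<in> Gam \<Longrightarrow> n = Suc k \<Longrightarrow>
  fn 40 [NN n, portrait n f] (EN n (mk n f (Pr Nul (portrait n f)))) ((n + 1) * (1200 * 4 ^ n) + 20)"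
  by (rule fnI, simp, unfold prog_nth body_mk1_def, (rule run fn_mkt | assumption)+) simp_all

text \<open>The target starts with empty words, so that only the factors appended to it by sifting
  are recorded.\<close>

lemma fn_mkg: "g \<in> Gam \<Longrightarrow> n = Suc k \<Longrightarrow>
  fn 41 [NN n, portrait n g] (EN n (Elt g Nul Nul)) ((n + 1) * (1200 * 4 ^ n) + 20)"
  by (rule fnI, simp, unfold prog_nth body_mkg_def, (rule run' fn_mkt | assumption)+)
    (simp_all add: EN_def mk_def)

text \<open>Two generators \<open>p\<close> and \<open>q\<close> with independent images in the
  abelianisation yield, by elimination, an \<open>s\<close> with \<open>al = 0\<close> and
  \<open>be\<close> nonzero and an \<open>x\<close> with \<open>al = be = 1\<close>, as
  \<open>tloop_correct\<close> requires.\<close>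

lemma fn_main_general:
  assumes n: "n = Suc (Suc k)" and fs: "set fs \<subseteq> Gam" and g: "g \<in> Gam"
    and ex1: "\<exists>f\<in>set fs. al f \<noteq> 0"
    and ex2: "\<And>p. p \<in> set fs \<Longrightarrow> al p \<noteq> 0 \<Longrightarrow> \<exists>q\<in>set fs. rdv (al q) (be q) (al p) (be p) \<noteq> 0"
  shows "\<exists>l. set l \<subseteq> set fs \<and> length l \<le> SL (8 * sz0 n + 21) n \<and> (\<forall>w. length w = n \<longrightarrow> wprod l w = g w) \<and>
    fn 0 [NN n, PL n fs, portrait n g] (PL n l) (tl_main n + (length fs + 1) * 2000)"
proof -
  have n0: "0 < n" and n1: "n = Suc (Suc k)" using n by simp_all
  \<comment> \<open>With \<open>z = sz0 n\<close> bounding \<open>P\<close> and \<open>R\<close>,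
    the trees of \<open>s\<close> are bounded by \<open>3 * z + 6\<close>, those of
    \<open>P'\<close> by \<open>2 * z + 3\<close>, and \<open>x\<close> is \<open>P'\<close> times
    at most two copies of \<open>s\<close>, each product adding 3.\<close>
  let ?b = "8 * sz0 n + 21"
  let ?S = "set fs"
  obtain p where p: "p \<in> ?S" "al p \<noteq> 0" "fn 27 [PL n fs] (portrait n p) ((length fs + 1) * 30)"
    using fn_fp[OF fs ex1, of "Suc k"] n by blast
  have pG: "p \<in> Gam" using p fs by blast
  obtain q where q: "q \<in> ?S" "rdv (al q) (be q) (al p) (be p) \<noteq> 0"
    "fn 32 [PL n fs, portrait n p] (portrait n q) ((length fs + 1) * 1600)"
    using fn_f2[OF pG p(2) fs ex2[OF p(1,2)], of k] n by blast
  have qG: "q \<in> Gam" using q fs by blast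
  define P where "P = mk n p (Pr Nul (portrait n p))"
  define R where "R = mk n q (Pr Nul (portrait n q))"
  have PR: "ef P = p" "ef R = q" by (simp_all add: P_def R_def mk_def)
  have vP: "valid ?S n id P" and vR: "valid ?S n id R"
    unfolding P_def R_def using valid_mk[OF fs _ n0] p(1) q(1) by blast+
  have zP: "szle (sz0 n) P" and zR: "szle (sz0 n) R"
    unfolding P_def R_def using szle_mk[OF _ n0] pG qG by blast+
  note op = op_closedD[OF valid_op_closed[OF fs]]
  obtain s where s: "s \<in> {R, tmul R P, tmul (tmul R P) P}" "al (ef s) = 0" "be (ef s) \<noteq> 0"
    "fn 33 [EN n R, EN n P] (EN n s) (1600 * 4 ^ n)"
  proof -
    obtain s where "s \<in> {R, tmul R P, tmul (tmul R P) P}" "al (ef s) = 0"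
      "be (ef s) = rdv (al q) (be q) (al p) (be p)" "fn 33 [EN n R, EN n P] (EN n s) (1500 * 4 ^ n)"
      using fn_rs[OF n1, of R P, unfolded PR, OF qG pG p(2)] by blast
    then show ?thesis using that q(2) fn_mono[of 33 _ _ "1500 * 4 ^ n" "1600 * 4 ^ n"] by simp
  qed
  have vs: "valid ?S n id s" using s(1) op(1)[OF vR vP] op(1)[OF op(1)[OF vR vP] vP] vR by auto
  have zs: "szle (3 * sz0 n + 6) s"
    using s(1) szle_mono[OF zR] szle_mono[OF szle_tmul[OF zR zP]] szle_mono[OF szle_tmul[OF szle_tmul[OF zR zP] zP]] by auto
  have sG: "ef s \<in> Gam" using vs by (simp add: valid_def)
  \<comment> \<open>Doubling turns \<open>al p = - 1\<close> into 1, since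
    \<open>- 1 - 1 = 1\<close> modulo 3.\<close>
  define P' where "P' = (if al p = - 1 then tmul P P else P)"
  have vP': "valid ?S n id P'" using vP op(1)[OF vP vP] by (simp add: P'_def)
  have zP': "szle (2 * sz0 n + 3) P'"
    using szle_mono[OF zP] szle_mono[OF szle_tmul[OF zP zP]] by (simp add: P'_def)
  have P'G: "ef P' \<in> Gam" using vP' by (simp add: valid_def)
  have alP': "al (ef P') = 1" using p(2) letter_cases[of "al p"] pG by (auto simp: P'_def PR al_comp)
  obtain x where x: "x \<in> {P', tmul P' s, tmul (tmul P' s) s}" "be (ef x) = 1" "fn 34 [EN n P', EN n s] (EN n x) (2900 * 4 ^ n)"
    using fn_rx[OF n1 P'G sG s(3)] by blast
  have vx: "valid ?S n id x" using x(1) op(1)[OF vP' vs] op(1)[OF op(1)[OF vP' vs] vs] vP' by auto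
  have zx: "szle ?b x"
    using x(1) szle_mono[OF zP'] szle_mono[OF szle_tmul[OF zP' zs]] szle_mono[OF szle_tmul[OF szle_tmul[OF zP' zs] zs]] by auto
  have zs': "szle ?b s" by (rule szle_mono[OF zs]) simp
  have xG: "ef x \<in> Gam" using vx by (simp add: valid_def)
  have "al (ef x) = 1"
    using x(1) alP' s(2) P'G sG Gam_comp[OF P'G sG] by (auto simp: al_comp simp del: o_apply)
  then have ox: "odo (ef x)" using x(2) xG by (simp add: odo_def)
  define A where "A = tloop x s n 0 (Elt g Nul Nul)"
  have "ef A \<in> st (n + 0)" unfolding A_def
    by (rule tloop_correct[OF ox sG s(2,3)]) (simp add: g)
  then have Ast: "ef A \<in> st n" by simp
  have "valid ?S n g (Elt g Nul Nul)" unfolding valid_def using g by (intro conjI exI[of _ "[]"]) simp_all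
  then have vA: "valid ?S n g A" unfolding A_def by (rule valid_tloop[OF fs g vx vs])
  obtain l where l: "set l \<subseteq> ?S" "flat (iw A) = map (portrait n) l" "\<And>w. length w = n \<Longrightarrow> wprod l w = g w"
    using valid_trivial[OF fs g vA Ast] by blast
  have "szle (1 + n * (3 ^ n * (2 * ST ?b n + 6))) A"
    unfolding A_def by (rule szle_tloop[OF zx zs']) (simp_all add: szle_def)
  then have zA: "val_size (iw A) \<le> SL ?b n" by (simp add: szle_def SL_def)
  have len: "length l \<le> SL ?b n"
    using length_flat[of "iw A"] zA l(2) by (metis length_map order_trans)
  have lo: "fn 21 [EN n (Elt g Nul Nul), EN n x, EN n s, NN n, Nul] (EN n A) ((n + 1) * tl_loop n)"
    using fn_loop[OF ox sG, of n 0 n "Elt g Nul Nul"] g by (simp add: A_def NN_simps)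
  have fl: "fn 22 [iw A, Nul] (PL n l) (20 * SL ?b n)"
    by (rule fn_mono[of _ _ _ "20 * val_size (iw A)"])
      (use fn_flat[of "iw A" Nul] zA in \<open>simp_all add: l(2) foldr_Pr PL_def\<close>)
  note mkg = fn_mkg[OF g, of n "Suc k", OF n1]
  have m5: "fn 39 [NN n, portrait n g, EN n x, EN n s] (PL n l)
      ((n + 1) * (1200 * 4 ^ n) + (n + 1) * tl_loop n + 20 * SL ?b n + 60)"
    by (rule fnI, simp, unfold prog_nth body_m5_def, (rule run' mkg lo fl)+) simp_all
  have rx: "fn 34 [if al p = - 1 then EN n (tmul P P) else EN n P, EN n s] (EN n x) (2900 * 4 ^ n)"
    using x(3) by (simp add: P'_def split: if_splits)
  have fP: "fstr (portrait n (ef P)) (VL (al p))" using fstr_PP[OF pG n1] by (simp add: PR)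
  have PG: "ef P \<in> Gam" using pG PR by simp
  have m4: "fn 38 [NN n, portrait n g, EN n P, EN n s] (PL n l)
      ((n + 1) * (1200 * 4 ^ n) + (n + 1) * tl_loop n + 20 * SL ?b n + 60 + 3500 * 4 ^ n)"
    by (rule fnI, simp, unfold prog_nth body_m4_def, (rule run' fP VL_fst_snd fn_tmul PG rx m5)+) simp_all
  have m3: "fn 37 [NN n, portrait n g, EN n P, EN n R] (PL n l)
      ((n + 1) * (1200 * 4 ^ n) + (n + 1) * tl_loop n + 20 * SL ?b n + 100 + 5100 * 4 ^ n)"
    by (rule fnI, simp, unfold prog_nth body_m3_def, (rule run' s(4) m4)+) simp_all
  note mkp = fn_mk1[OF pG, of n "Suc k", OF n1, folded P_def]
  note mkq = fn_mk1[OF qG, of n "Suc k", OF n1, folded R_def]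
  have m2: "fn 36 [NN n, PL n fs, portrait n g, portrait n p] (PL n l)
      (3 * ((n + 1) * (1200 * 4 ^ n)) + (n + 1) * tl_loop n + 20 * SL ?b n + 200 + 5100 * 4 ^ n + (length fs + 1) * 1600)"
    by (rule fnI, simp, unfold prog_nth body_m2_def, (rule run' mkp mkq q(3) m3)+) simp_all
  have nn: "sndr (NN n) (Pr Nul (NN k))" "ev env e1 v B \<Longrightarrow> evif (NN n) env e1 e2 v B" for env e1 e2 v B
    by (simp_all add: n sndr_def NN_simps evif_def)
  have "fn 0 [NN n, PL n fs, portrait n g] (PL n l) (tl_main n + (length fs + 1) * 2000)"
    apply (rule fnI, simp, unfold prog_nth body_main_def, (rule run' nn p(3) m2)+)
    subgoal by simp
    subgoal by (simp add: tl_main_def)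
    done
  then show ?thesis using l len by blast
qed

text \<open>On level 1 the quotient is cyclic of order 3, and portraits of depth 1 do not show
  \<open>be\<close>, so a power of a single generator is taken.\<close>

lemma fn_main_1:
  assumes fs: "set fs \<subseteq> Gam" and g: "g \<in> Gam" and ex: "\<exists>f\<in>set fs. al f \<noteq> 0"
  shows "\<exists>l. set l \<subseteq> set fs \<and> length l \<le> 2 \<and> (\<forall>w. length w = 1 \<longrightarrow> wprod l w = g w) \<and>
    fn 0 [NN 1, PL 1 fs, portrait 1 g] (PL 1 l) (400 + (length fs + 1) * 2000)"
proof -
  obtain p where p: "p \<in> set fs" "al p \<noteq> 0" "fn 27 [PL 1 fs] (portrait 1 p) ((length fs + 1) * 30)"
    using fn_fp[OF fs ex, of 0] by auto
  have pG: "p \<in> Gam" using p fs by blast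
  have f: "fstr (portrait 1 f) (VL (al f))" if "f \<in> Gam" for f using fstr_portrait[OF that, of 0] by simp
  define l where "l = (if al g = 0 then [] else if al g + (al p + al p) = 0 then [p] else [p, p])"
  have n1: "fn 35 [portrait 1 p, portrait 1 g] (PL 1 l) 300"
    apply (rule fnI, simp, unfold prog_nth body_n1_def, (rule run f pG g fn_add3 evif_VL)+)
    subgoal by (simp add: l_def PL_def)
    subgoal by simp
    done
  have nn: "sndr (NN 1) Nul" "ev env e1 v B \<Longrightarrow> evif (NN 1) env e1 e2 v B" for env e1 e2 v B
    by (simp_all add: sndr_def NN_simps(1) NN_simps(2)[of 0] evif_def)
  have "fn 0 [NN 1, PL 1 fs, portrait 1 g] (PL 1 l) (400 + (length fs + 1) * 2000)"
    by (rule fnI, simp, unfold prog_nth body_main_def, (rule run nn p(3) n1)+) simp_all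
  moreover have "wprod l w = g w" if lw: "length w = 1" for w
  proof -
    obtain i where w: "w = [i]" using lw by (metis One_nat_def length_0_conv length_Suc_conv)
    have "al g = 0 \<or> al g = al p \<or> al g = al p + al p" "al p + (al p + al p) = 0"
      using p(2) by (cases "al g"; cases "al p"; simp add: letter_simps)+
    then show ?thesis unfolding w l_def using g pG p(2)
      by (cases "al g"; cases "al p") (simp_all add: wprod_def Gam_Cons letter_simps algebra_simps)
  qed
  moreover have "set l \<subseteq> set fs" "length l \<le> 2" using p by (auto simp: l_def)
  ultimately show ?thesis by blast
qed

lemma fn_main_0: "fn 0 [NN 0, a, b] Nul 10"
  unfolding NN_simps by (rule fnI, simp, unfold prog_nth body_main_def, (rule run)+) simp_all

lemma pb_main: "pb (\<lambda>n. SL (8 * sz0 n + 21) n)" "pb tl_main"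
proof -
  have "pb (\<lambda>n. 8 * sz0 n + 21)" unfolding sz0_def by (intro pb_intros)
  then show 1: "pb (\<lambda>n. SL (8 * sz0 n + 21) n)" by (rule pb_SL)
  show "pb tl_main" unfolding tl_main_def by (intro pb_intros pb_tl_loop 1)
qed

section \<open>The congruence quotients\<close>

lemma Aut_simps [simp]: "mult Aut_T3 = (\<circ>)" "one Aut_T3 = id" "mult FG = (\<circ>)" "one FG = id"
  by (simp_all add: Aut_T3_def FG_def)

lemma group_Aut: "group Aut_T3"
proof (rule groupI)
  show "x \<otimes>\<^bsub>Aut_T3\<^esub> y \<in> carrier Aut_T3" if "x \<in> carrier Aut_T3" "y \<in> carrier Aut_T3" for x y
    using that by (auto simp: Aut_T3_def bij_comp)
  show "\<one>\<^bsub>Aut_T3\<^esub> \<in> carrier Aut_T3" by (simp add: Aut_T3_def)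
  show "\<exists>y\<in>carrier Aut_T3. y \<otimes>\<^bsub>Aut_T3\<^esub> x = \<one>\<^bsub>Aut_T3\<^esub>" if x: "x \<in> carrier Aut_T3" for x
  proof (rule bexI[of _ "iv x"])
    have b: "bij x" and e: "\<And>u v. tree_edge (x u) (x v) \<longleftrightarrow> tree_edge u v" using x by (auto simp: Aut_T3_def)
    have "tree_edge (iv x u) (iv x v) \<longleftrightarrow> tree_edge u v" for u v
      using e[of "iv x u" "iv x v"] b by (simp add: bij_is_surj surj_f_inv_f)
    then show "iv x \<in> carrier Aut_T3" using b by (simp add: Aut_T3_def bij_imp_bij_inv)
    show "iv x \<otimes>\<^bsub>Aut_T3\<^esub> x = \<one>\<^bsub>Aut_T3\<^esub>" using b by (simp add: fun_eq_iff bij_is_inj)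
  qed
qed (simp_all add: comp_assoc)

lemma Gam_snoc: "f \<in> Gam \<Longrightarrow> \<exists>y. f (u @ [x]) = f u @ [y]"
  by (induction u arbitrary: f) (simp_all add: Gam_Cons)

lemma Gam_Aut: assumes "f \<in> Gam" shows "f \<in> carrier Aut_T3"
proof -
  have "tree_edge (f u) (f v) \<longleftrightarrow> tree_edge u v" for u v
  proof
    show "tree_edge (f u) (f v)" if "tree_edge u v" using that Gam_snoc[OF assms] by (auto simp: tree_edge_def)
    assume "tree_edge (f u) (f v)"
    then obtain y where y: "f v = f u @ [y]" by (auto simp: tree_edge_def)
    then have "length v = Suc (length u)" using Gam_length[OF assms, of v] assms by simp
    then obtain v' z where v: "v = v' @ [z]" by (metis length_Suc_conv_rev)
    then have "f v' = f u" using y Gam_snoc[OF assms, of v' z] by auto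
    then have "v' = u" using Gam_inj[OF assms] by blast
    then show "tree_edge u v" using v by (auto simp: tree_edge_def)
  qed
  then show ?thesis using Gam_bij[OF assms] by (simp add: Aut_T3_def)
qed

lemma carrier_FG: "carrier FG = Gam"
proof
  have "f \<in> Gam" if "f \<in> generate Aut_T3 {fg_a, fg_b}" for f
    using that
  proof (induction rule: generate.induct)
    case one
    then show ?case using Gam_id by (simp only: Aut_simps)
  next
    case (incl h)
    then show ?case by auto
  next
    case (inv h)
    then have h: "h \<in> Gam" by auto
    have "inv\<^bsub>Aut_T3\<^esub> h = iv h"
      by (rule group.inv_equality[OF group_Aut]) (use h Gam_Aut in simp_all)
    then show ?case using h by simp
  next
    case (eng f g)
    then show ?case by (simp del: o_apply)
  qed
  then show "carrier FG \<subseteq> Gam" by (auto simp: FG_def)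
  have ab: "fg_a \<in> generate Aut_T3 {fg_a, fg_b}" "fg_b \<in> generate Aut_T3 {fg_a, fg_b}"
    by (auto intro: generate.incl)
  have "f \<in> generate Aut_T3 {fg_a, fg_b}" if "f \<in> Gam" for f
    using that
  proof (induction rule: Gam.induct)
    case Gam_id
    show ?case using generate.one[of Aut_T3] by (simp only: Aut_simps)
  next
    case (Gam_a f)
    show ?case using generate.eng[OF ab(1) Gam_a(2)] by (simp only: Aut_simps)
  next
    case (Gam_b f)
    show ?case using generate.eng[OF ab(2) Gam_b(2)] by (simp only: Aut_simps)
  qed
  then show "Gam \<subseteq> carrier FG" by (auto simp: FG_def)
qed

lemma group_FG: "group FG"
  unfolding FG_def
  by (rule subgroup.subgroup_is_group[OF group.generate_is_subgroup[OF group_Aut] group_Aut])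
    (simp add: Gam_Aut)

lemma Stab_eq: "Stab n = st n"
  using st_fix st_Gam by (auto simp: Stab_def carrier_FG)

lemma inv_FG: "f \<in> Gam \<Longrightarrow> inv\<^bsub>FG\<^esub> f = iv f"
  by (rule group.inv_equality[OF group_FG]) (simp_all add: carrier_FG)

lemma normal_Stab: "Stab n \<lhd> FG"
proof -
  have "subgroup (Stab n) FG"
  proof (rule group.subgroupI[OF group_FG])
    show "Stab n \<subseteq> carrier FG" by (auto simp: Stab_def)
    show "Stab n \<noteq> {}" using st_id unfolding Stab_eq by blast
    show "inv\<^bsub>FG\<^esub> a \<in> Stab n" if "a \<in> Stab n" for a using that by (simp add: Stab_eq inv_FG st_Gam)
    show "a \<otimes>\<^bsub>FG\<^esub> b \<in> Stab n" if "a \<in> Stab n" "b \<in> Stab n" for a b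
      using that by (simp add: Stab_eq del: o_apply)
  qed
  moreover have "x \<otimes>\<^bsub>FG\<^esub> h \<otimes>\<^bsub>FG\<^esub> inv\<^bsub>FG\<^esub> x \<in> Stab n" if "x \<in> carrier FG" "h \<in> Stab n" for x h
    using st_conj[of h n "iv x"] that by (simp add: Stab_eq inv_FG carrier_FG conj_by_def Gam_inv_inv)
  ultimately show ?thesis by (simp add: group.normal_inv_iff[OF group_FG])
qed

definition cs :: "nat \<Rightarrow> (vertex \<Rightarrow> vertex) \<Rightarrow> (vertex \<Rightarrow> vertex) set" where
  "cs n f = Stab n #>\<^bsub>FG\<^esub> f"

lemma mem_cs: assumes "f \<in> Gam" shows "h \<in> cs n f \<longleftrightarrow> h \<in> Gam \<and> (\<forall>w. length w = n \<longrightarrow> h w = f w)"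
proof
  assume "h \<in> cs n f"
  then obtain k where k: "k \<in> st n" "h = k \<circ> f" by (auto simp: cs_def r_coset_def Stab_eq)
  then show "h \<in> Gam \<and> (\<forall>w. length w = n \<longrightarrow> h w = f w)"
    using assms by (simp add: st_Gam st_app[of k n "f _"])
next
  assume h: "h \<in> Gam \<and> (\<forall>w. length w = n \<longrightarrow> h w = f w)"
  have "h \<circ> iv f \<in> st n" using h assms by (simp add: st_fix)
  moreover have "h = (h \<circ> iv f) \<circ> f" using assms by (simp add: fun_eq_iff)
  ultimately show "h \<in> cs n f" unfolding cs_def r_coset_def Stab_eq by auto
qed

lemma cs_self: "f \<in> Gam \<Longrightarrow> f \<in> cs n f"
  by (simp add: mem_cs)

lemma cs_eq_iff: assumes "f \<in> Gam" "g \<in> Gam" shows "cs n f = cs n g \<longleftrightarrow> (\<forall>w. length w = n \<longrightarrow> f w = g w)"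
  using cs_self[OF assms(1), of n] assms by (auto simp: mem_cs set_eq_iff)

lemma carrier_level: "carrier (FG_level n) = cs n ` Gam"
  by (auto simp: FG_level_def FactGroup_def RCOSETS_def cs_def carrier_FG)

lemma group_level: "group (FG_level n)"
  unfolding FG_level_def by (rule normal.factorgroup_is_group[OF normal_Stab])

lemma mult_level: "f \<in> Gam \<Longrightarrow> g \<in> Gam \<Longrightarrow> cs n f \<otimes>\<^bsub>FG_level n\<^esub> cs n g = cs n (f \<circ> g)"
  using normal.rcos_sum[OF normal_Stab, of f g n] by (simp add: FG_level_def FactGroup_def cs_def carrier_FG)

lemma one_level: "\<one>\<^bsub>FG_level n\<^esub> = cs n id"
proof -
  have "cs n id = st n" by (auto simp: cs_def r_coset_def Stab_eq)
  then show ?thesis by (simp add: FG_level_def FactGroup_def Stab_eq)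
qed

definition rp :: "(vertex \<Rightarrow> vertex) set \<Rightarrow> vertex \<Rightarrow> vertex" where
  "rp X = (SOME f. f \<in> X)"

lemma rp_cs: assumes "f \<in> Gam" shows "rp (cs n f) \<in> Gam" "length w = n \<Longrightarrow> rp (cs n f) w = f w"
  using someI[of "\<lambda>h. h \<in> cs n f", OF cs_self[OF assms]] assms by (auto simp: rp_def mem_cs)

lemma cs_rp: assumes "X \<in> carrier (FG_level n)" shows "rp X \<in> Gam" "cs n (rp X) = X"
proof -
  obtain f where f: "f \<in> Gam" "X = cs n f" using assms by (auto simp: carrier_level)
  show "rp X \<in> Gam" using rp_cs(1)[OF f(1)] f(2) by simp
  show "cs n (rp X) = X" unfolding f(2) using cs_eq_iff[OF rp_cs(1)[OF f(1)] f(1)] rp_cs(2)[OF f(1)] by blast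
qed

lemma enc_cs: assumes "f \<in> Gam" shows "enc_level n (cs n f) = portrait n f"
proof -
  have "portrait n (rp (cs n f)) = portrait n f" using portrait_eq_iff[OF rp_cs(1)[OF assms] assms] rp_cs(2)[OF assms] by blast
  then show ?thesis by (simp add: enc_level_def rp_def)
qed

lemma word_prod_simps: "word_prod G [] = \<one>\<^bsub>G\<^esub>" "word_prod G (x # xs) = x \<otimes>\<^bsub>G\<^esub> word_prod G xs"
  by (simp_all add: word_prod_def)

lemma word_prod_cs: "set l \<subseteq> Gam \<Longrightarrow> word_prod (FG_level n) (map (cs n) l) = cs n (wprod l)"
proof (induction l)
  case Nil
  have "wprod [] = id" by (simp add: wprod_def)
  then show ?case unfolding \<open>wprod [] = id\<close> by (simp only: list.map word_prod_simps one_level)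
next
  case (Cons f l)
  have "wprod (f # l) = f \<circ> wprod l" by (simp add: wprod_def)
  then show ?case unfolding \<open>wprod (f # l) = f \<circ> wprod l\<close>
    using Cons mult_level[of f "wprod l" n] wprod_Gam[of l] by (simp add: word_prod_simps del: o_apply)
qed

text \<open>Such a \<open>psi\<close> factors through the quotient; if it vanished on all
  generators, it would vanish everywhere.\<close>

lemma generates_functional:
  assumes gen: "generates (FG_level n) S" and hom: "\<And>f g. f \<in> Gam \<Longrightarrow> g \<in> Gam \<Longrightarrow> psi (f \<circ> g) = psi f + (psi g :: letter)"
    and triv: "\<And>f. f \<in> st n \<Longrightarrow> psi f = 0" and h: "h \<in> Gam" "psi h \<noteq> 0"
  shows "\<exists>X\<in>S. psi (rp X) \<noteq> 0"
proof (rule ccontr)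
  assume "\<not> ?thesis"
  then have S0: "psi (rp X) = 0" if "X \<in> S" for X using that by blast
  have psi_cs: "psi f = psi g" if "f \<in> Gam" "g \<in> Gam" "cs n f = cs n g" for f g
  proof -
    have "iv f \<circ> g \<in> st n" using that by (simp add: cs_eq_iff st_fix) (metis inv_cancel(1))
    then have "psi (f \<circ> (iv f \<circ> g)) = psi f + psi (iv f \<circ> g)" "psi (iv f \<circ> g) = 0"
      using that hom[of f "iv f \<circ> g"] triv by simp_all
    moreover have "f \<circ> (iv f \<circ> g) = g" using that by (simp add: fun_eq_iff)
    ultimately show ?thesis by simp
  qed
  have idz: "psi id = 0" using triv[OF st_id] .
  have S: "S \<subseteq> carrier (FG_level n)" and G: "generate (FG_level n) S = carrier (FG_level n)"
    using gen by (auto simp: generates_def)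
  have "\<exists>f\<in>Gam. X = cs n f \<and> psi f = 0" if "X \<in> generate (FG_level n) S" for X
    using that
  proof (induction rule: generate.induct)
    case one
    then show ?case using one_level Gam_id idz by blast
  next
    case (incl X)
    then show ?case using cs_rp[of X n] S S0 by (metis subsetD)
  next
    case (inv X)
    have r: "rp X \<in> Gam" "cs n (rp X) = X" using cs_rp[of X n] S inv by auto
    have "inv\<^bsub>FG_level n\<^esub> X = cs n (iv (rp X))"
    proof (rule group.inv_equality[OF group_level])
      show "cs n (iv (rp X)) \<otimes>\<^bsub>FG_level n\<^esub> X = \<one>\<^bsub>FG_level n\<^esub>"
        using mult_level[of "iv (rp X)" "rp X" n] r by (simp add: one_level)
    qed (use r inv S in \<open>auto simp: carrier_level\<close>)
    moreover have "psi (iv (rp X)) = 0"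
      using hom[of "iv (rp X)" "rp X"] r S0[OF inv] idz by simp
    ultimately show ?case using r by auto
  next
    case (eng X Y)
    then show ?case using mult_level hom by (metis Gam_comp add_0)
  qed
  moreover have "cs n h \<in> generate (FG_level n) S" using h G by (simp add: carrier_level)
  ultimately obtain f where "f \<in> Gam" "cs n h = cs n f" "psi f = 0" by blast
  then show False using psi_cs[OF h(1)] h(2) by auto
qed

text \<open>For \<open>n = 0\<close> the group is trivial and the logarithmic bounds are zero. There
  the word must be empty, and the whole running time is charged to the encoding of \<open>S\<close>,
  whose size is at least 1.\<close>

lemma navigation:
  assumes gen: "generates (FG_level n) (set S)" and g: "X \<in> carrier (FG_level n)"
  shows "\<exists>w T. runs prog [NN n, val_of_list (map (enc_level n) S), enc_level n X] (val_of_list (map (enc_level n) w)) T \<and>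
    set w \<subseteq> set S \<and> length w \<le> (if n = 0 then 0 else SL (8 * sz0 n + 21) n + 2) \<and> word_prod (FG_level n) w = X \<and>
    T \<le> (if n = 0 then 0 else tl_main n + 400) + 2000 * val_size (val_of_list (map (enc_level n) S))"
proof -
  define fs where "fs = map rp S"
  have S: "set S \<subseteq> carrier (FG_level n)" using gen by (simp add: generates_def)
  have fsG: "set fs \<subseteq> Gam" using S cs_rp(1) by (auto simp: fs_def)
  have PL: "PL n fs = val_of_list (map (enc_level n) S)"
  proof -
    have "enc_level n = (\<lambda>X. portrait n (rp X))" by (simp add: fun_eq_iff enc_level_def rp_def)
    then show ?thesis by (simp add: PL_def fs_def comp_def)
  qed
  have sz: "length fs + 1 \<le> val_size (val_of_list (map (enc_level n) S))"
    unfolding fs_def by (induction S) auto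
  have rX: "rp X \<in> Gam" "cs n (rp X) = X" using cs_rp[OF g] .
  have eX: "enc_level n X = portrait n (rp X)" by (simp add: enc_level_def rp_def)
  have main: "\<exists>w T. runs prog [NN n, val_of_list (map (enc_level n) S), enc_level n X] (val_of_list (map (enc_level n) w)) T \<and>
      set w \<subseteq> set S \<and> length w \<le> L \<and> word_prod (FG_level n) w = X \<and>
      T \<le> B + 2000 * val_size (val_of_list (map (enc_level n) S))"
    if l: "set l \<subseteq> set fs" "length l \<le> L" "\<And>w. length w = n \<Longrightarrow> wprod l w = rp X w"
      "fn 0 [NN n, PL n fs, portrait n (rp X)] (PL n l) (B + (length fs + 1) * 2000)" for l L B
  proof -
    have lG: "set l \<subseteq> Gam" using l(1) fsG by blast
    have "map (enc_level n) (map (cs n) l) = map (portrait n) l" using lG enc_cs by auto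
    then have v: "PL n l = val_of_list (map (enc_level n) (map (cs n) l))" by (simp only: PL_def)
    obtain t where t: "t \<le> B + (length fs + 1) * 2000"
      "eval prog [NN n, PL n fs, portrait n (rp X)] (prog ! 0) (PL n l) t"
      using l(4) by (auto simp: fn_def ev_def)
    have "prog \<noteq> []" by (simp add: prog_def)
    then have "runs prog [NN n, val_of_list (map (enc_level n) S), enc_level n X] (val_of_list (map (enc_level n) (map (cs n) l))) t"
      using t(2) unfolding runs_def v PL eX by simp
    moreover have "cs n f \<in> set S" if fl: "f \<in> set l" for f
    proof -
      obtain Y where "Y \<in> set S" "f = rp Y" using fl l(1) by (auto simp: fs_def)
      then show ?thesis using cs_rp(2)[of Y n] S by auto
    qed
    then have "set (map (cs n) l) \<subseteq> set S" by auto
    moreover have "word_prod (FG_level n) (map (cs n) l) = X"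
      using word_prod_cs[OF lG, of n] rX l(3) cs_eq_iff[OF wprod_Gam[OF lG] rX(1), of n] by simp
    moreover have "t \<le> B + 2000 * val_size (val_of_list (map (enc_level n) S))" using order_trans[OF t(1) add_left_mono[OF mult_le_mono1[OF sz]]] by (simp only: mult.commute)
    moreover have "length (map (cs n) l) \<le> L" using l(2) by simp
    ultimately show ?thesis by blast
  qed
  have al1: "\<exists>f\<in>set fs. al f \<noteq> 0" if "n \<noteq> 0"
  proof -
    have "al f = 0" if "f \<in> st n" for f
      using st_mono[OF that, of "Suc 0"] \<open>n \<noteq> 0\<close> by (simp add: st_Suc)
    then show ?thesis using generates_functional[OF gen, of al fg_a] by (auto simp: fs_def al_comp)
  qed
  consider "n = 0" | "n = 1" | k where "n = Suc (Suc k)" by (metis One_nat_def old.nat.exhaust)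
  then show ?thesis
  proof cases
    case 1
    have "fn 0 [NN n, PL n fs, portrait n (rp X)] (PL n []) (0 + (length fs + 1) * 2000)"
      using fn_mono[OF fn_main_0, of "(length fs + 1) * 2000"] 1 by (simp add: PL_def)
    moreover have "wprod [] w = rp X w" if "length w = n" for w using 1 rX(1) that by simp
    ultimately show ?thesis using main[where l = "[]" and L = 0 and B = 0] 1 by simp
  next
    case 2
    obtain l where "set l \<subseteq> set fs" "length l \<le> 2" "\<And>w. length w = n \<Longrightarrow> wprod l w = rp X w"
      "fn 0 [NN n, PL n fs, portrait n (rp X)] (PL n l) (400 + (length fs + 1) * 2000)"
      using fn_main_1[OF fsG rX(1)] al1 2 by auto
    then have "set l \<subseteq> set fs" "length l \<le> SL (8 * sz0 n + 21) n + 2" "\<And>w. length w = n \<Longrightarrow> wprod l w = rp X w"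
      "fn 0 [NN n, PL n fs, portrait n (rp X)] (PL n l) (tl_main n + 400 + (length fs + 1) * 2000)"
      by (auto elim: fn_mono)
    from main[OF this] show ?thesis using 2 by simp
  next
    case (3 k)
    have ex2: "\<exists>q\<in>set fs. rdv (al q) (be q) (al p) (be p) \<noteq> 0" if "al p \<noteq> 0" for p
    proof -
      have "\<exists>Y\<in>set S. be (rp Y) * al p - al (rp Y) * be p \<noteq> 0"
      \<comment> \<open>The functional is the determinant of the abelianised \<open>f\<close> and
        \<open>p\<close>; its value at \<open>fg_b\<close> is \<open>al p\<close>.\<close>
      proof (rule generates_functional[OF gen, of "\<lambda>f. be f * al p - al f * be p" fg_b])
        show "be f * al p - al f * be p = 0" if "f \<in> st n" for f
        proof -
          have "f \<in> st (Suc (Suc 0))" "f \<in> st (Suc 0)" using st_mono[OF that] 3 by simp_all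
          then have "al f = 0" "be f = 0" using st_Suc_Q[of f "Suc 0"] by (simp_all add: st_Suc[of f 0] Q_def)
          then show ?thesis by simp
        qed
      qed (use that in \<open>simp_all add: al_comp be_comp algebra_simps\<close>)
      then show ?thesis using rdv_eq_0[OF that] by (auto simp: fs_def)
    qed
    obtain l where "set l \<subseteq> set fs" "length l \<le> SL (8 * sz0 n + 21) n" "\<And>w. length w = n \<Longrightarrow> wprod l w = rp X w"
      "fn 0 [NN n, PL n fs, portrait n (rp X)] (PL n l) (tl_main n + (length fs + 1) * 2000)"
      using fn_main_general[OF 3 fsG rX(1) al1 ex2] 3 by auto
    then have "set l \<subseteq> set fs" "length l \<le> SL (8 * sz0 n + 21) n + 2" "\<And>w. length w = n \<Longrightarrow> wprod l w = rp X w"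
      "fn 0 [NN n, PL n fs, portrait n (rp X)] (PL n l) (tl_main n + 400 + (length fs + 1) * 2000)"
      by (auto elim: fn_mono)
    from main[OF this] show ?thesis using 3 by simp
  qed
qed

section \<open>The order of the congruence quotients\<close>

lemma finite_portraits: "finite (portrait n ` Gam)"
proof (induction n)
  case 0
  have "portrait 0 ` Gam \<subseteq> {Nul}" by auto
  then show ?case by (rule finite_subset) simp
next
  case (Suc n)
  let ?A = "portrait n ` Gam"
  let ?f = "\<lambda>(i, a, b, c). Pr (VL i) (Pr (VL (1 + i)) (Pr (VL (- 1 + i)) (Pr a (Pr b (Pr c Nul)))))"
  have l: "finite (UNIV :: letter set)"
    by (rule finite_subset[of _ "{0, 1, - 1}"]) (use letter_cases in auto)
  have "portrait (Suc n) f \<in> ?f ` (UNIV \<times> ?A \<times> ?A \<times> ?A)" if "f \<in> Gam" for f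
    unfolding portrait_Suc[OF that]
    by (rule image_eqI[of _ _ "(al f, portrait n (sec f 0), portrait n (sec f 1), portrait n (sec f (- 1)))"])
      (use that in simp_all)
  then have "portrait (Suc n) ` Gam \<subseteq> ?f ` (UNIV \<times> ?A \<times> ?A \<times> ?A)" by blast
  then show ?case using Suc l by (meson finite_SigmaI finite_imageI finite_subset)
qed

lemma order_level: "order (FG_level n) = card (portrait n ` Gam)" and finite_level: "finite (carrier (FG_level n))"
proof -
  have "inj_on (enc_level n) (carrier (FG_level n))"
  proof (rule inj_onI)
    fix X Y assume "X \<in> carrier (FG_level n)" "Y \<in> carrier (FG_level n)" "enc_level n X = enc_level n Y"
    then obtain f g where "f \<in> Gam" "g \<in> Gam" "X = cs n f" "Y = cs n g" "enc_level n (cs n f) = enc_level n (cs n g)"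
      by (auto simp: carrier_level)
    then show "X = Y" by (simp add: enc_cs portrait_eq_iff cs_eq_iff)
  qed
  moreover have img: "enc_level n ` carrier (FG_level n) = portrait n ` Gam"
    unfolding carrier_level image_image by (rule image_cong[OF refl]) (rule enc_cs)
  ultimately show "order (FG_level n) = card (portrait n ` Gam)"
    unfolding order_def by (metis card_image)
  show "finite (carrier (FG_level n))"
    using \<open>inj_on (enc_level n) (carrier (FG_level n))\<close> finite_portraits[of n] unfolding img[symmetric]
    by (rule finite_imageD[rotated])
qed

text \<open>By \<open>emb_KK\<close> any three elements of \<open>KK\<close> are the sections of one
  element of \<open>KK\<close>, so the number of portraits at least cubes from one depth to the
  next.\<close>

lemma card_KK_step: "card (portrait n ` KK) ^ 3 \<le> card (portrait (Suc n) ` KK)"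
proof -
  let ?A = "portrait n ` KK"
  let ?f = "\<lambda>(a, b, c). Pr (VL 0) (Pr (VL 1) (Pr (VL (- 1)) (Pr a (Pr b (Pr c Nul)))))"
  have sub: "KK \<subseteq> Gam" using KK_Gam by blast
  have fin: "finite (portrait (Suc n) ` KK)" using finite_subset[OF image_mono[OF sub] finite_portraits] .
  have "?f (portrait n f, portrait n g, portrait n h) \<in> portrait (Suc n) ` KK" if "f \<in> KK" "g \<in> KK" "h \<in> KK" for f g h
  proof -
    define v where "v = emb 0 f \<circ> emb 1 g \<circ> emb (- 1) h"
    have v: "v \<in> KK" unfolding v_def using that by (intro KK_comp emb_KK)
    have e: "emb 0 f \<in> Gam" "emb 1 g \<in> Gam" "emb (- 1) h \<in> Gam" using that emb_KK KK_Gam by blast+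
    have G: "f \<in> Gam" "g \<in> Gam" "h \<in> Gam" using that KK_Gam by blast+
    have "al v = 0" "sec v 0 = f" "sec v 1 = g" "sec v (- 1) = h"
      unfolding v_def using e G by (simp_all add: al_comp sec_comp emb_al_sec)
    then have "portrait (Suc n) v = ?f (portrait n f, portrait n g, portrait n h)"
      unfolding portrait_Suc[OF KK_Gam[OF v]] by simp
    then show ?thesis using v by (metis imageI)
  qed
  then have "?f ` (?A \<times> ?A \<times> ?A) \<subseteq> portrait (Suc n) ` KK" by auto
  then have "card (?f ` (?A \<times> ?A \<times> ?A)) \<le> card (portrait (Suc n) ` KK)" by (rule card_mono[OF fin])
  moreover have "card (?f ` (?A \<times> ?A \<times> ?A)) = card (?A \<times> ?A \<times> ?A)"
    by (rule card_image) (auto simp: inj_on_def)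
  ultimately show ?thesis by (simp add: card_cartesian_product power3_eq_cube mult.assoc)
qed

lemma card_KK: "2 ^ 3 ^ m \<le> card (portrait (Suc (Suc m)) ` KK)"
proof (induction m)
  case 0
  let ?k = "comm fg_b fg_a"
  have fin: "finite (portrait (Suc (Suc 0)) ` KK)"
    by (rule finite_subset[OF image_mono finite_portraits]) (use KK_Gam in blast)
  have k: "?k \<in> Gam" by simp
  have "?k \<circ> iv ?k \<in> KK" by (intro KK_comp KK_inv KK_base)
  then have id: "id \<in> KK" using inv_comp_cancel(2)[OF k] by (simp only:)
  have "sec ?k 0 = iv fg_a" by (simp add: comm_def sec_comp al_comp iv_fg)
  then have "lab ?k [0] = - 1" by (simp add: al_inv)
  then have "?k [0, 0] \<noteq> [0, 0]" using Gam_Cons[OF k, of 0 "[0]"] Gam_Cons[OF sec_in_Gam[OF k, of 0], of 0 "[]"] k by (auto simp: al_comm)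
  then have "portrait (Suc (Suc 0)) ?k \<noteq> portrait (Suc (Suc 0)) id"
    using portrait_eq_iff[OF k Gam_id, of "Suc (Suc 0)"] by (auto intro!: exI[of _ "[0, 0]"])
  then have "card {portrait (Suc (Suc 0)) ?k, portrait (Suc (Suc 0)) id} = 2" by simp
  moreover have "{portrait (Suc (Suc 0)) ?k, portrait (Suc (Suc 0)) id} \<subseteq> portrait (Suc (Suc 0)) ` KK"
    unfolding insert_subset by (intro conjI empty_subsetI imageI id KK_base)
  ultimately show ?case using card_mono[OF fin] by (metis power_0 power_one_right)
next
  case (Suc m)
  have "(2::nat) ^ 3 ^ Suc m = (2 ^ 3 ^ m) ^ 3" by (simp add: power_mult[symmetric] mult.commute)
  also have "\<dots> \<le> card (portrait (Suc (Suc m)) ` KK) ^ 3" by (rule power_mono[OF Suc]) simp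
  also have "\<dots> \<le> card (portrait (Suc (Suc (Suc m))) ` KK)" by (rule card_KK_step)
  finally show ?case .
qed

text \<open>For \<open>n >= 2\<close> the order is at least \<open>2 ^ 3 ^ (n - 2)\<close> by
  \<open>card_KK\<close>, whence the divisor \<open>9 = 3 ^ 2\<close>; for \<open>n = 1\<close> an
  order of at least 2 is enough.\<close>

lemma ln_order: assumes "0 < n" shows "ln 2 / 9 * 3 ^ n \<le> ln (real (order (FG_level n)))"
proof -
  consider "n = 1" | m where "n = Suc (Suc m)" using assms by (metis One_nat_def gr0_implies_Suc not0_implies_Suc)
  then show ?thesis
  proof cases
    case 1
    have "portrait 1 fg_a \<noteq> portrait 1 id"
      using portrait_eq_iff[OF fg_in_Gam(1) Gam_id, of 1] by (auto intro!: exI[of _ "[0]"] simp: fg_a_Cons)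
    then have "card {portrait 1 fg_a, portrait 1 id} = 2" by simp
    moreover have "{portrait 1 fg_a, portrait 1 id} \<subseteq> portrait 1 ` Gam"
      unfolding insert_subset by (intro conjI empty_subsetI imageI fg_in_Gam(1) Gam_id)
    ultimately have "2 \<le> order (FG_level 1)" unfolding order_level using card_mono[OF finite_portraits[of 1]] by metis
    then have "ln 2 \<le> ln (real (order (FG_level 1)))" by simp
    moreover have "ln 2 / 9 * 3 ^ 1 \<le> ln (2::real)" by simp
    ultimately show ?thesis unfolding 1 by linarith
  next
    case (2 m)
    have "2 ^ 3 ^ m \<le> order (FG_level n)"
      unfolding order_level 2
      by (rule order_trans[OF card_KK card_mono[OF finite_portraits]]) (use KK_Gam in blast)
    then have "real (2 ^ 3 ^ m) \<le> real (order (FG_level n))" by (simp only: of_nat_le_iff)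
    then have le: "(2::real) ^ 3 ^ m \<le> real (order (FG_level n))" by simp
    moreover have "(0::real) < 2 ^ 3 ^ m" by simp
    ultimately have "ln (2 ^ 3 ^ m) \<le> ln (real (order (FG_level n)))"
      by (subst ln_le_cancel_iff) linarith+
    moreover have "ln ((2::real) ^ 3 ^ m) = ln 2 / 9 * 3 ^ n" by (simp add: ln_realpow 2)
    ultimately show ?thesis by simp
  qed
qed

lemma pb_polylog: assumes "pb f"
  shows "\<exists>C::real>0. \<exists>K::real>0. \<forall>n>0. real (f n) \<le> K * ln (real (order (FG_level n))) powr C"
proof -
  obtain k where k: "\<And>n. f n \<le> 3 ^ (k * Suc n)" using assms by (auto simp: pb_def)
  define c :: real where "c = ln 2 / 9"
  have c: "0 < c" by (simp add: c_def)
  \<comment> \<open>For positive \<open>n\<close> one has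
    \<open>k * Suc n \<le> n * (2 * k)\<close>; the summand 1 keeps the exponent positive when
    \<open>k = 0\<close>.\<close>
  define N where "N = 2 * k + 1"
  have "real (f n) \<le> (1 / c) ^ N * ln (real (order (FG_level n))) powr real N" if n: "0 < n" for n
  proof -
    let ?L = "ln (real (order (FG_level n)))"
    have L: "c * 3 ^ n \<le> ?L" using ln_order[OF n] by (simp add: c_def)
    then have L0: "0 < ?L" using c by (smt (verit) mult_pos_pos zero_less_power)
    have "k * Suc n \<le> n * N" using n by (cases n) (simp_all add: N_def)
    then have "f n \<le> 3 ^ (n * N)" using k[of n] by (meson one_le_numeral order_trans power_increasing)
    then have "real (f n) \<le> (3 ^ n) ^ N" by (metis of_nat_le_iff of_nat_numeral of_nat_power power_mult)
    also have "\<dots> \<le> (?L / c) ^ N"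
      using L c by (intro power_mono) (simp_all add: pos_le_divide_eq mult.commute)
    also have "\<dots> = (1 / c) ^ N * ?L powr real N" using L0 by (simp add: powr_realpow power_divide)
    finally show ?thesis .
  qed
  then show ?thesis using c by (intro exI[of _ "real N"] exI[of _ "(1 / c) ^ N"] conjI) (simp_all add: N_def)
qed

lemma diam_plus_le:
  assumes "\<And>S X. generates (FG_level n) (set S) \<Longrightarrow> X \<in> carrier (FG_level n) \<Longrightarrow>
    \<exists>w. set w \<subseteq> set S \<and> length w \<le> L \<and> word_prod (FG_level n) w = X"
  shows "diam_plus (FG_level n) \<le> L"
proof -
  let ?G = "FG_level n"
  have wrt: "diam_plus_wrt ?G S \<le> L" if "generates ?G S" for S
  proof -
    have "finite S" using that finite_subset[OF _ finite_level] by (auto simp: generates_def)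
    then obtain l where l: "set l = S" using finite_list by blast
    have S: "S \<subseteq> carrier ?G" using that by (simp add: generates_def)
    interpret G: group ?G by (rule group_level)
    have "word_prod ?G w \<in> carrier ?G" if "set w \<subseteq> S" for w
      using that S by (induction w) (auto simp: word_prod_simps)
    then have "pos_ball ?G S L = carrier ?G"
      using assms[of l] that l unfolding pos_ball_def by blast
    then show ?thesis unfolding diam_plus_wrt_def by (rule Least_le)
  qed
  have "generates ?G (carrier ?G)"
    using group.generate_incl[OF group_level, of "carrier ?G" n] unfolding generates_def
    by (auto intro: generate.incl)
  then have "{diam_plus_wrt ?G S | S. generates ?G S} \<noteq> {}" by blast
  moreover have "finite {diam_plus_wrt ?G S | S. generates ?G S}"
    by (rule finite_subset[of _ "{..L}"]) (use wrt in auto)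
  ultimately show ?thesis unfolding diam_plus_def using wrt by (subst Max_le_iff) auto
qed

theorem theorem1p3:
  shows "\<exists>C::real>0. \<exists>K::real>0.
    (\<forall>n. real (diam_plus (FG_level n)) \<le> K * ln (real (order (FG_level n))) powr C) \<and>
    (\<exists>C'::real>0. \<exists>K'::real>0.
      directed_navigation_solvable FG_level enc_level
        (\<lambda>n. nat \<lfloor>K * ln (real (order (FG_level n))) powr C\<rfloor>)
        (\<lambda>n. nat \<lfloor>K' * ln (real (order (FG_level n))) powr C'\<rfloor>))"
proof -
  define L where "L n = (if n = 0 then 0 else SL (8 * sz0 n + 21) n + 2)" for n
  define B where "B n = (if n = 0 then 0 else tl_main n + 400)" for n
  have "pb L" by (rule pb_mono[OF pb_add[OF pb_main(1) pb_const[of 2]]]) (simp add: L_def)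
  then obtain C K :: real where C: "0 < C" "0 < K" and CK: "\<And>n. 0 < n \<Longrightarrow> real (L n) \<le> K * ln (real (order (FG_level n))) powr C"
    using pb_polylog by metis
  have "pb B" by (rule pb_mono[OF pb_add[OF pb_main(2) pb_const[of 400]]]) (simp add: B_def)
  then obtain C' K' :: real where C': "0 < C'" "0 < K'" and CK': "\<And>n. 0 < n \<Longrightarrow> real (B n) \<le> K' * ln (real (order (FG_level n))) powr C'"
    using pb_polylog by metis
  have nonneg: "0 \<le> K * ln (real (order (FG_level n))) powr C" "0 \<le> K' * ln (real (order (FG_level n))) powr C'" for n
    using C C' by simp_all
  have rL: "real (L n) \<le> K * ln (real (order (FG_level n))) powr C" for n
    using CK[of n] nonneg(1)[of n] by (cases "n = 0") (simp_all add: L_def)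
  have rB: "real (B n) \<le> K' * ln (real (order (FG_level n))) powr C'" for n
    using CK'[of n] nonneg(2)[of n] by (cases "n = 0") (simp_all add: B_def)
  have nL: "L n \<le> nat \<lfloor>K * ln (real (order (FG_level n))) powr C\<rfloor>" for n using rL by (rule le_nat_floor)
  have nB: "B n \<le> nat \<lfloor>K' * ln (real (order (FG_level n))) powr C'\<rfloor>" for n using rB by (rule le_nat_floor)
  note nav = navigation[folded L_def B_def]
  have d: "diam_plus (FG_level n) \<le> L n" for n
    by (rule diam_plus_le) (use nav in blast)
  have "real (diam_plus (FG_level n)) \<le> K * ln (real (order (FG_level n))) powr C" for n
    using rL[of n] d[of n] by simp
  moreover have "directed_navigation_solvable FG_level enc_level
      (\<lambda>n. nat \<lfloor>K * ln (real (order (FG_level n))) powr C\<rfloor>) (\<lambda>n. nat \<lfloor>K' * ln (real (order (FG_level n))) powr C'\<rfloor>)"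
    unfolding directed_navigation_solvable_def
  proof (intro conjI exI[of _ prog] exI[of _ 2000] allI impI)
    show "diam_plus (FG_level n) \<le> nat \<lfloor>K * ln (real (order (FG_level n))) powr C\<rfloor>" for n
      by (rule order_trans[OF d nL])
    show "\<exists>w T. runs prog [NN n, val_of_list (map (enc_level n) S), enc_level n g] (val_of_list (map (enc_level n) w)) T \<and>
        set w \<subseteq> set S \<and> length w \<le> nat \<lfloor>K * ln (real (order (FG_level n))) powr C\<rfloor> \<and> word_prod (FG_level n) w = g \<and>
        T \<le> nat \<lfloor>K' * ln (real (order (FG_level n))) powr C'\<rfloor> + 2000 * val_size (val_of_list (map (enc_level n) S))"
      if S: "generates (FG_level n) (set S) \<and> distinct S \<and> g \<in> carrier (FG_level n)" for n S g
    proof -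
      obtain w T where w: "runs prog [NN n, val_of_list (map (enc_level n) S), enc_level n g] (val_of_list (map (enc_level n) w)) T"
        "set w \<subseteq> set S" "length w \<le> L n" "word_prod (FG_level n) w = g"
        "T \<le> B n + 2000 * val_size (val_of_list (map (enc_level n) S))"
        using nav[of n S g] S by blast
      then show ?thesis using nL[of n] nB[of n] by (intro exI[of _ w] exI[of _ T]) auto
    qed
  qed
  ultimately show ?thesis using C C' by blast
qed

end
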